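(* Let $S$ be a closed, bounded from below, densely defined symmetric operator on a separable Hilbert space $\mathcal H$ with finite and equal defect numbers $(n,n)$, and let $(\mathcal K,\Gamma_0,\Gamma_1)$ be a boundary triplet for $S$. Let $\mathcal F$ be the Lagrangian plane corresponding to the Friedrichs extension $H_F$ of $S$. For any integers $\tilde\sigma_\pm\ge0$ with $\tilde\sigma_-+\tilde\sigma_+\le n$, there exist Lagrangian planes $\mathcal L_1$ and $\mathcal L_2$ such that $$\iota(\mathcal L_1,\mathcal L_2,\mathcal F)=\tilde\sigma_-,\qquad\iota(\mathcal L_2,\mathcal L_1,\mathcal F)=\tilde\sigma_+,$$ and such that for the corresponding self-adjoint extensions $H_1$ and $H_2$ of $S$ both of the bounds $-\tilde\sigma_-\le\sigma(H_1,H_2;\lambda)\le\tilde\sigma_+$ are sharp. To be precise, there exists $\lambda_0\in\mathbb R$, below $\operatorname{Spec}_{\mathrm{ess}}(S)$, such that $$\sigma(H_1,H_2;\lambda_0-0)=-\tilde\sigma_-,\qquad\sigma(H_1,H_2;\lambda_0+0)=\tilde\sigma_+,$$ where $\lambda_0\pm0$ denotes the one-sided limits $\lambda\to\lambda_0\pm$.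
   Context: All inner products are linear in the second argument. A boundary triplet $(\mathcal K,\Gamma_0,\Gamma_1)$ for $S$ consists of an $n$-dimensional complex Hilbert space $\mathcal K$ and linear maps $\Gamma_0,\Gamma_1:\operatorname{dom}(S^* )\to\mathcal K$ such that $\mathbf\Gamma f:=(\Gamma_0f,\Gamma_1f)$ defines a surjection $\operatorname{dom}(S^* )\to\mathcal K\oplus\mathcal K$ and $\langle f,S^*g\rangle_{\mathcal H}-\langle S^*f,g\rangle_{\mathcal H}=\langle\Gamma_0f,\Gamma_1g\rangle_{\mathcal K}-\langle\Gamma_1f,\Gamma_0g\rangle_{\mathcal K}$ for all $f,g\in\operatorname{dom}(S^* )$. The symplectic form on $\mathcal K\oplus\mathcal K$ is $\omega(u,v)=\langle u_0,v_1\rangle_{\mathcal K}-\langle u_1,v_0\rangle_{\mathcal K}$. A subspace $\mathcal L$ is a Lagrangian plane if $\mathcal L=\{u:\omega(u,v)=0\ \forall v\in\mathcal L\}$. Self-adjoint extensions $H$ of $S$ are in one-to-one correspondence with Lagrangian planes $\mathcal L$ via $\operatorname{dom}(H)=\{f\in\operatorname{dom}(S^* ):\mathbf\Gamma f\in\mathcal L\}$; in particular $\mathcal F=\mathbf\Gamma(\operatorname{dom}(H_F))$. $\operatorname{Spec}_{\mathrm{ess}}(S):=\{z\in\mathbb C: S-z\text{ is not Fredholm}\}$, which equals $\operatorname{Spec}_{\mathrm{ess}}(H)$ for every self-adjoint extension $H$ of $S$. For $\lambda\in\mathbb R$ below the essential spectrum, $\sigma(H_1,H_2;\lambda):=N(H_1;(-\infty,\lambda])-N(H_2;(-\infty,\lambda])$,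 where $N(H;I)$ is the number of eigenvalues of $H$ in $I$ counted with multiplicity. Duistermaat index: for Lagrangian planes $\alpha,\beta,\gamma$ with $\alpha\cap\beta=0=\beta\cap\gamma$, $\gamma$ is the graph $\{u+Lu:u\in\alpha\}$ of a linear map $L:\alpha\to\beta$; let $Q(\alpha,\beta;\gamma)$ be the Hermitian form $(u_1,u_2)\mapsto\omega(u_1,Lu_2)$ on $\alpha$, and let $n_-$ of a Hermitian form be the maximal dimension of a subspace on which it is negative definite. For arbitrary Lagrangian planes $\mathcal L_1,\mathcal L_2,\mathcal L_3$, choose a Lagrangian plane $\hat{\mathcal L}$ transversal to all three and set $\iota(\mathcal L_1,\mathcal L_2,\mathcal L_3):=n_-(Q(\mathcal L_2,\hat{\mathcal L};\mathcal L_3))-n_-(Q(\mathcal L_1,\hat{\mathcal L};\mathcal L_3))+n_-(Q(\mathcal L_1,\hat{\mathcal L};\mathcal L_2))$, which does not depend on the choice of $\hat{\mathcal L}$. *)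

theory Defs
  imports "HOL-Analysis.Analysis"
begin

section \<open>Complex Hilbert spaces\<close>

text \<open>The inner product is antilinear in the first and linear in the second argument.
  No separability or dimension restriction is built in.\<close>

class chilbert = banach +
  fixes scaleC :: "complex \<Rightarrow> 'a \<Rightarrow> 'a" (infixr "*\<^sub>C" 75)
    and cinner :: "'a \<Rightarrow> 'a \<Rightarrow> complex"
  assumes scaleR_eq_scaleC: "r *\<^sub>R x = complex_of_real r *\<^sub>C x"
    and scaleC_add_right: "a *\<^sub>C (x + y) = a *\<^sub>C x + a *\<^sub>C y"
    and scaleC_add_left: "(a + b) *\<^sub>C x = a *\<^sub>C x + b *\<^sub>C x"
    and scaleC_scaleC: "a *\<^sub>C b *\<^sub>C x = (a * b) *\<^sub>C x"
    and cinner_commute: "cinner x y = cnj (cinner y x)"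
    and cinner_add_right: "cinner x (y + z) = cinner x y + cinner x z"
    and cinner_scaleC_right: "cinner x (a *\<^sub>C y) = a * cinner x y"
    and cinner_self: "cinner x x = complex_of_real ((norm x)\<^sup>2)"

lemma scaleC_one: "1 *\<^sub>C x = (x :: 'a :: chilbert)"
  using scaleR_eq_scaleC[of 1 x] by simp

global_interpretation complex_vector:
  vector_space "scaleC :: complex \<Rightarrow> 'a \<Rightarrow> 'a :: chilbert"
  by unfold_locales (simp_all add: scaleC_add_right scaleC_add_left scaleC_scaleC scaleC_one)

abbreviation csubspace :: "'a::chilbert set \<Rightarrow> bool" where
  "csubspace \<equiv> complex_vector.subspace"

abbreviation cspan :: "'a::chilbert set \<Rightarrow> 'a set" where
  "cspan \<equiv> complex_vector.span"

abbreviation cindependent :: "'a::chilbert set \<Rightarrow> bool" where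
  "cindependent \<equiv> complex_vector.independent"

abbreviation cdim :: "'a::chilbert set \<Rightarrow> nat" where
  "cdim \<equiv> complex_vector.dim"

text \<open>The library's \<open>dim\<close> is 0 on infinite-dimensional spaces, so statements that assert a
  dimension go through an explicit finite basis.\<close>

definition has_cdim :: "'a::chilbert set \<Rightarrow> nat \<Rightarrow> bool" where
  "has_cdim V n \<longleftrightarrow> (\<exists>B. finite B \<and> cindependent B \<and> cspan B = V \<and> card B = n)"

definition clinear_on :: "'a::chilbert set \<Rightarrow> ('a \<Rightarrow> 'b::chilbert) \<Rightarrow> bool" where
  "clinear_on V f \<longleftrightarrow>
     (\<forall>x\<in>V. \<forall>y\<in>V. f (x + y) = f x + f y) \<and> (\<forall>c. \<forall>x\<in>V. f (c *\<^sub>C x) = c *\<^sub>C f x)"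

instantiation complex :: chilbert
begin

definition scaleC_complex :: "complex \<Rightarrow> complex \<Rightarrow> complex" where
  "scaleC_complex a x = a * x"

definition cinner_complex :: "complex \<Rightarrow> complex \<Rightarrow> complex" where
  "cinner_complex x y = cnj x * y"

instance
proof
  show "cinner x x = complex_of_real ((norm x)\<^sup>2)" for x :: complex
    by (metis cinner_complex_def complex_norm_square mult.commute)
qed (simp_all add: scaleC_complex_def cinner_complex_def scaleR_conv_of_real algebra_simps)

end

text \<open>The direct sum of two Hilbert spaces.\<close>

instantiation prod :: (chilbert, chilbert) chilbert
begin

definition scaleC_prod :: "complex \<Rightarrow> 'a \<times> 'b \<Rightarrow> 'a \<times> 'b" where
  "scaleC_prod c x = (c *\<^sub>C fst x, c *\<^sub>C snd x)"

definition cinner_prod :: "'a \<times> 'b \<Rightarrow> 'a \<times> 'b \<Rightarrow> complex" where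
  "cinner_prod x y = cinner (fst x) (fst y) + cinner (snd x) (snd y)"

instance
proof
  fix x y z :: "'a \<times> 'b"
  show "cinner x x = complex_of_real ((norm x)\<^sup>2)"
    by (simp add: cinner_prod_def cinner_self norm_prod_def)
  show "cinner x y = cnj (cinner y x)"
    unfolding cinner_prod_def complex_cnj_add by (metis cinner_commute)
qed (simp_all add: scaleC_prod_def cinner_prod_def prod_eq_iff scaleR_eq_scaleC scaleC_add_right
      scaleC_add_left scaleC_scaleC cinner_add_right cinner_scaleC_right algebra_simps)

end

section \<open>Unbounded operators\<close>

text \<open>An operator is identified with its graph: \<open>(f, g) \<in> T\<close> means \<open>f \<in> dom T\<close> and \<open>T f = g\<close>,
  the domain is \<open>Domain T\<close>, and \<open>closed T\<close> says that \<open>T\<close> is a closed operator.\<close>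

definition is_operator :: "('a::chilbert \<times> 'a) set \<Rightarrow> bool" where
  "is_operator T \<longleftrightarrow> csubspace T \<and> single_valued T"

definition densely_defined :: "('a::chilbert \<times> 'a) set \<Rightarrow> bool" where
  "densely_defined T \<longleftrightarrow> closure (Domain T) = UNIV"

definition op_adjoint :: "('a::chilbert \<times> 'a) set \<Rightarrow> ('a \<times> 'a) set" where
  "op_adjoint T = {(g, h). \<forall>(f, k)\<in>T. cinner g k = cinner h f}"

definition symmetric_op :: "('a::chilbert \<times> 'a) set \<Rightarrow> bool" where
  "symmetric_op T \<longleftrightarrow> (\<forall>(f, Tf)\<in>T. \<forall>(g, Tg)\<in>T. cinner f Tg = cinner Tf g)"

definition bounded_from_below :: "('a::chilbert \<times> 'a) set \<Rightarrow> bool" where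
  "bounded_from_below T \<longleftrightarrow> (\<exists>c::real. \<forall>(f, Tf)\<in>T. c * (norm f)\<^sup>2 \<le> Re (cinner f Tf))"

definition eigenspace :: "('a::chilbert \<times> 'a) set \<Rightarrow> complex \<Rightarrow> 'a set" where
  "eigenspace T z = {f. (f, z *\<^sub>C f) \<in> T}"

definition has_defect_numbers :: "('a::chilbert \<times> 'a) set \<Rightarrow> nat \<Rightarrow> nat \<Rightarrow> bool" where
  "has_defect_numbers S m n \<longleftrightarrow>
     has_cdim (eigenspace (op_adjoint S) \<i>) m \<and> has_cdim (eigenspace (op_adjoint S) (- \<i>)) n"

definition op_shift :: "('a::chilbert \<times> 'a) set \<Rightarrow> complex \<Rightarrow> ('a \<times> 'a) set" where
  "op_shift T z = {(f, g - z *\<^sub>C f) | f g. (f, g) \<in> T}"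

text \<open>Meant for closed operators; the second and third conditions say that the range is closed
  and of finite codimension.\<close>

definition fredholm :: "('a::chilbert \<times> 'a) set \<Rightarrow> bool" where
  "fredholm T \<longleftrightarrow>
     (\<exists>B. finite B \<and> cspan B = {f. (f, 0) \<in> T}) \<and>
     closed (Range T) \<and>
     (\<exists>B. finite B \<and> cspan (Range T \<union> B) = UNIV)"

definition ess_spec :: "('a::chilbert \<times> 'a) set \<Rightarrow> complex set" where
  "ess_spec T = {z. \<not> fredholm (op_shift T z)}"

definition below_ess_spec :: "real \<Rightarrow> ('a::chilbert \<times> 'a) set \<Rightarrow> bool" where
  "below_ess_spec l T \<longleftrightarrow> (\<forall>z\<in>ess_spec T. l < Re z)"

text \<open>Number of eigenvalues in \<open>I\<close> with multiplicity. This is the intended number only when it is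
  finite, as it is for \<open>I = {..l}\<close> with \<open>l\<close> below the essential spectrum and \<open>H\<close> self-adjoint and
  bounded from below.\<close>

definition eigenvalue_count :: "('a::chilbert \<times> 'a) set \<Rightarrow> real set \<Rightarrow> nat" where
  "eigenvalue_count H I =
     (\<Sum>l | l \<in> I \<and> eigenspace H (complex_of_real l) \<noteq> {0}. cdim (eigenspace H (complex_of_real l)))"

definition spectral_shift :: "('a::chilbert \<times> 'a) set \<Rightarrow> ('a \<times> 'a) set \<Rightarrow> real \<Rightarrow> int" where
  "spectral_shift H1 H2 l = int (eigenvalue_count H1 {..l}) - int (eigenvalue_count H2 {..l})"

section \<open>The Friedrichs extension\<close>

text \<open>The form of \<open>S\<close> is \<open>s(g, f) = cinner g (S f)\<close> on \<open>dom S\<close>. A sequence \<open>u\<close> in the graph of \<open>S\<close>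
  s-converges to \<open>f\<close> if its first components \<open>f\<^sub>n\<close> tend to \<open>f\<close> and \<open>s(f\<^sub>m - f\<^sub>n, f\<^sub>m - f\<^sub>n) \<rightarrow> 0\<close>.
  The Friedrichs extension is the operator associated with the closure of the form.\<close>

definition form_converges ::
    "('a::chilbert \<times> 'a) set \<Rightarrow> (nat \<Rightarrow> 'a \<times> 'a) \<Rightarrow> 'a \<Rightarrow> bool" where
  "form_converges S u f \<longleftrightarrow>
     (\<forall>n. u n \<in> S) \<and> (\<lambda>n. fst (u n)) \<longlonglongrightarrow> f \<and>
     (\<forall>e>0. \<exists>N. \<forall>m\<ge>N. \<forall>n\<ge>N. cmod (cinner (fst (u m) - fst (u n)) (snd (u m) - snd (u n))) < e)"

definition form_domain :: "('a::chilbert \<times> 'a) set \<Rightarrow> 'a set" where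
  "form_domain S = {f. \<exists>u. form_converges S u f}"

definition closed_form :: "('a::chilbert \<times> 'a) set \<Rightarrow> 'a \<Rightarrow> 'a \<Rightarrow> complex" where
  "closed_form S g f =
     (THE c. \<forall>v u. form_converges S v g \<longrightarrow> form_converges S u f \<longrightarrow>
        (\<lambda>n. cinner (fst (v n)) (snd (u n))) \<longlonglongrightarrow> c)"

definition friedrichs :: "('a::chilbert \<times> 'a) set \<Rightarrow> ('a \<times> 'a) set" where
  "friedrichs S =
     {(f, h). f \<in> form_domain S \<and> (\<forall>g\<in>form_domain S. closed_form S g f = cinner g h)}"

section \<open>Boundary triplets and Lagrangian planes\<close>

text \<open>The boundary maps are total functions of which only the values on \<open>dom S*\<close> matter.
  The auxiliary space is the whole type \<open>'k\<close>.\<close>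

definition boundary_triplet ::
    "nat \<Rightarrow> ('h::chilbert \<times> 'h) set \<Rightarrow> ('h \<Rightarrow> 'k::chilbert) \<Rightarrow> ('h \<Rightarrow> 'k) \<Rightarrow> bool" where
  "boundary_triplet n S G0 G1 \<longleftrightarrow>
     has_cdim (UNIV :: 'k set) n \<and>
     clinear_on (Domain (op_adjoint S)) G0 \<and> clinear_on (Domain (op_adjoint S)) G1 \<and>
     (\<lambda>f. (G0 f, G1 f)) ` Domain (op_adjoint S) = UNIV \<and>
     (\<forall>(f, Sf)\<in>op_adjoint S. \<forall>(g, Sg)\<in>op_adjoint S.
        cinner f Sg - cinner Sf g = cinner (G0 f) (G1 g) - cinner (G1 f) (G0 g))"

definition symp :: "'k::chilbert \<times> 'k \<Rightarrow> 'k \<times> 'k \<Rightarrow> complex" where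
  "symp u v = cinner (fst u) (snd v) - cinner (snd u) (fst v)"

definition lagrangian :: "('k::chilbert \<times> 'k) set \<Rightarrow> bool" where
  "lagrangian L \<longleftrightarrow> csubspace L \<and> L = {u. \<forall>v\<in>L. symp u v = 0}"

definition extension_of ::
    "('h::chilbert \<times> 'h) set \<Rightarrow> ('h \<Rightarrow> 'k::chilbert) \<Rightarrow> ('h \<Rightarrow> 'k) \<Rightarrow> ('k \<times> 'k) set \<Rightarrow> ('h \<times> 'h) set"
  where "extension_of S G0 G1 L = {(f, g) \<in> op_adjoint S. (G0 f, G1 f) \<in> L}"

definition friedrichs_plane ::
    "('h::chilbert \<times> 'h) set \<Rightarrow> ('h \<Rightarrow> 'k::chilbert) \<Rightarrow> ('h \<Rightarrow> 'k) \<Rightarrow> ('k \<times> 'k) set" where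
  "friedrichs_plane S G0 G1 = (\<lambda>f. (G0 f, G1 f)) ` Domain (friedrichs S)"

section \<open>The Duistermaat index\<close>

text \<open>For \<open>A \<inter> B = 0 = B \<inter> C\<close>, the plane \<open>C\<close> is the graph \<open>{u + L u | u \<in> A}\<close> of the linear map
  \<open>L = graph_map A B C\<close> from \<open>A\<close> to \<open>B\<close>.\<close>

definition graph_map ::
    "('k::chilbert \<times> 'k) set \<Rightarrow> ('k \<times> 'k) set \<Rightarrow> ('k \<times> 'k) set \<Rightarrow> 'k \<times> 'k \<Rightarrow> 'k \<times> 'k" where
  "graph_map A B C u = (THE w. w \<in> B \<and> u + w \<in> C)"

definition Qform ::
    "('k::chilbert \<times> 'k) set \<Rightarrow> ('k \<times> 'k) set \<Rightarrow> ('k \<times> 'k) set \<Rightarrow> 'k \<times> 'k \<Rightarrow> 'k \<times> 'k \<Rightarrow> complex" where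
  "Qform A B C u1 u2 = symp u1 (graph_map A B C u2)"

text \<open>Intended for a Hermitian form \<open>q\<close> on a finite-dimensional space \<open>A\<close>.\<close>

definition neg_index :: "'a::chilbert set \<Rightarrow> ('a \<Rightarrow> 'a \<Rightarrow> complex) \<Rightarrow> nat" where
  "neg_index A q = Max {cdim V | V. csubspace V \<and> V \<subseteq> A \<and> (\<forall>u\<in>V - {0}. Re (q u u) < 0)}"

definition transversal :: "('k::chilbert \<times> 'k) set \<Rightarrow> ('k \<times> 'k) set \<Rightarrow> bool" where
  "transversal A B \<longleftrightarrow> A \<inter> B = {0}"

text \<open>The value does not depend on the auxiliary plane picked by the choice operator.\<close>

definition duistermaat ::
    "('k::chilbert \<times> 'k) set \<Rightarrow> ('k \<times> 'k) set \<Rightarrow> ('k \<times> 'k) set \<Rightarrow> int" where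
  "duistermaat L1 L2 L3 =
     (let P = (SOME P. lagrangian P \<and> transversal L1 P \<and> transversal L2 P \<and> transversal L3 P)
      in int (neg_index L2 (Qform L2 P L3)) - int (neg_index L1 (Qform L1 P L3))
         + int (neg_index L1 (Qform L1 P L2)))"

end

theory Submission
  imports Defs
begin

text \<open>
  Let \<open>c\<close> be a lower bound of \<open>S\<close>, put \<open>\<lambda>\<^sub>0 = c - 1\<close>, \<open>\<mu> = c - 2\<close>, and let \<open>N(z)\<close> be the kernel of
  \<open>S* - z\<close>. For \<open>k \<in> N(\<lambda>\<^sub>0)\<close> there is a unique \<open>g \<in> dom H\<^sub>F\<close> with \<open>k - g \<in> N(\<mu>)\<close>, and
  \<open>\<omega>(\<Gamma> k, \<Gamma> g')\<close> is a positive definite form in such pairs. Orthonormalising it gives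
  pairs \<open>(k\<^sub>i, g\<^sub>i)\<close>, \<open>i < n\<close>, for which \<open>m\<^sub>i = \<Gamma> k\<^sub>i\<close>, \<open>f\<^sub>i = \<Gamma> g\<^sub>i\<close> is a symplectic basis and the
  \<open>f\<^sub>i\<close> span the Friedrichs plane. Consider the diagonal planes \<open>L\<^sub>p\<close> spanned by
  \<open>m\<^sub>i + p\<^sub>i f\<^sub>i\<close> with \<open>p\<^sub>i \<in> {-1, 0, 1}\<close>. The extension belonging to \<open>L\<^sub>p\<close> has the
  eigenvectors \<open>k\<^sub>i\<close> (\<open>p\<^sub>i = 0\<close>) at \<open>\<lambda>\<^sub>0\<close> and \<open>k\<^sub>i - g\<^sub>i\<close> (\<open>p\<^sub>i = -1\<close>) at \<open>\<mu>\<close>, and no other eigenvectors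
  up to slightly above \<open>\<lambda>\<^sub>0\<close>, because its form is coercive on the remaining directions. Moreover
  \<open>\<iota>(L\<^sub>p, L\<^sub>q, F)\<close> is the number of \<open>i\<close> with \<open>q\<^sub>i < p\<^sub>i\<close>. The planes with
  \<open>p = (0, \<dots>, 0, 1, \<dots>, 1)\<close> (\<open>\<sigma>\<^sub>- + \<sigma>\<^sub>+\<close> zeros) and \<open>q = (-1, \<dots>, -1, 1, \<dots>, 1)\<close> (\<open>\<sigma>\<^sub>-\<close> entries \<open>-1\<close>)
  have the prescribed indices, and \<open>\<sigma>\<close> jumps from \<open>-\<sigma>\<^sub>-\<close> to \<open>\<sigma>\<^sub>+\<close> at \<open>\<lambda>\<^sub>0\<close>.
\<close>

section \<open>Hermitian forms on complex subspaces\<close>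

text \<open>Everything happens below the lower bound \<open>c\<close>, out of reach of the
  Friedrichs extension: a vector of N(z) with boundary value in the Friedrichs plane would be an
  eigenvector of it below \<open>c\<close>. So for z < c boundary values determine the elements of
  N(z), and their plane is a graph relative to the Friedrichs plane. The two graphs at
  \<open>l0\<close> and \<open>mu\<close> differ by an increment of the Weyl function, which is
  definite. This is why one orthonormalisation makes both planes diagonal, with slopes 0 and -1, and
  why slope 1 is a coercive direction. The problem decouples into one-dimensional ones, each with
  one of three slopes.

  On the index side the auxiliary plane is an uncontrolled choice. The Friedrichs plane would be the
  convenient one, but it is excluded, being one of the three arguments; an identity between negative
  indices of four planes makes the passage.

  On the spectral side min-max and the spectral theorem are avoided: a hypothetical further
  eigenvector is corrected by known ones at \<open>l0\<close> and \<open>mu\<close>, and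
  orthogonality of eigenvectors contradicts coercivity on the corrected vector.\<close>

lemma cinner_add_left: "cinner (x + y) z = cinner x z + cinner y z"
  for x :: "'a::chilbert"
  by (metis cinner_commute cinner_add_right complex_cnj_add)

lemma cinner_scaleC_left: "cinner (a *\<^sub>C x) y = cnj a * cinner x y"
  for x :: "'a::chilbert"
  by (metis cinner_commute cinner_scaleC_right complex_cnj_mult)

lemma cinner_zero_right [simp]: "cinner x (0::'a::chilbert) = 0"
  using cinner_add_right[of x 0 0] by simp

lemma cinner_zero_left [simp]: "cinner (0::'a::chilbert) x = 0"
  using cinner_add_left[of 0 0 x] by simp

lemma cinner_minus_right: "cinner x (- y) = - cinner x y" for x :: "'a::chilbert"
  using cinner_add_right[of x y "- y"] by (simp add: eq_neg_iff_add_eq_0 add.commute)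

lemma cinner_minus_left: "cinner (- x) y = - cinner x y" for x :: "'a::chilbert"
  using cinner_add_left[of x "- x" y] by (simp add: eq_neg_iff_add_eq_0 add.commute)

lemma cinner_diff_right: "cinner x (y - z) = cinner x y - cinner x z" for x :: "'a::chilbert"
  using cinner_add_right[of x y "- z"] by (simp add: cinner_minus_right)

lemma cinner_diff_left: "cinner (x - y) z = cinner x z - cinner y z" for x :: "'a::chilbert"
  using cinner_add_left[of x "- y" z] by (simp add: cinner_minus_left)

lemmas cinner_simps = cinner_add_left cinner_add_right cinner_scaleC_left cinner_scaleC_right
  cinner_diff_left cinner_diff_right cinner_minus_left cinner_minus_right

lemma cinner_self_eq_0: "cinner x x = 0 \<longleftrightarrow> x = 0" for x :: "'a::chilbert"
  by (simp add: cinner_self)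

lemma cinner_orthogonal_UNIV: "(\<And>y. cinner x y = 0) \<Longrightarrow> x = 0" for x :: "'a::chilbert"
  using cinner_self_eq_0[of x] by simp

lemma Re_cinner_self: "Re (cinner x x) = (norm x)\<^sup>2" for x :: "'a::chilbert"
  by (simp add: cinner_self)

lemma csubspace_diff: "csubspace V \<Longrightarrow> x \<in> V \<Longrightarrow> y \<in> V \<Longrightarrow> x - y \<in> V"
  by (rule complex_vector.subspace_diff)

lemma fst_scaleC [simp]: "fst (c *\<^sub>C x) = c *\<^sub>C fst x"
  by (simp add: scaleC_prod_def)

lemma snd_scaleC [simp]: "snd (c *\<^sub>C x) = c *\<^sub>C snd x"
  by (simp add: scaleC_prod_def)

text \<open>Relative to a subspace because the forms in use, such as \<open>shifted_form\<close> on
  \<open>S\<close> and \<open>Q\<close> on \<open>R\<close>, are symmetric only there.\<close>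

definition herm_form :: "'a::chilbert set \<Rightarrow> ('a \<Rightarrow> 'a \<Rightarrow> complex) \<Rightarrow> bool" where
  "herm_form V q \<longleftrightarrow> csubspace V \<and>
     (\<forall>u\<in>V. \<forall>v\<in>V. \<forall>w\<in>V. q u (v + w) = q u v + q u w) \<and>
     (\<forall>c. \<forall>u\<in>V. \<forall>v\<in>V. q u (c *\<^sub>C v) = c * q u v) \<and>
     (\<forall>u\<in>V. \<forall>v\<in>V. q u v = cnj (q v u))"

lemma herm_form_cinner: "csubspace V \<Longrightarrow> herm_form V cinner"
  by (simp add: herm_form_def cinner_simps) (intro ballI, rule cinner_commute)

context
  fixes V :: "'a::chilbert set" and q
  assumes q: "herm_form V q"
begin

lemma herm_form_subspace: "csubspace V"
  using q by (simp add: herm_form_def)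

lemma herm_form_cnj: "u \<in> V \<Longrightarrow> v \<in> V \<Longrightarrow> q u v = cnj (q v u)"
  using q unfolding herm_form_def by blast

lemma herm_form_add_right: "u \<in> V \<Longrightarrow> v \<in> V \<Longrightarrow> w \<in> V \<Longrightarrow> q u (v + w) = q u v + q u w"
  using q unfolding herm_form_def by blast

lemma herm_form_scale_right: "u \<in> V \<Longrightarrow> v \<in> V \<Longrightarrow> q u (c *\<^sub>C v) = c * q u v"
  using q unfolding herm_form_def by blast

lemma herm_form_add_left: "u \<in> V \<Longrightarrow> v \<in> V \<Longrightarrow> w \<in> V \<Longrightarrow> q (v + w) u = q v u + q w u"
  using herm_form_cnj[of "v + w" u] herm_form_cnj[of v u] herm_form_cnj[of w u]
  by (simp add: herm_form_add_right complex_vector.subspace_add[OF herm_form_subspace])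

lemma herm_form_scale_left: "u \<in> V \<Longrightarrow> v \<in> V \<Longrightarrow> q (c *\<^sub>C v) u = cnj c * q v u"
  using herm_form_cnj[of "c *\<^sub>C v" u] herm_form_cnj[of v u]
  by (simp add: herm_form_scale_right complex_vector.subspace_scale[OF herm_form_subspace])

lemma herm_form_zero_right: "u \<in> V \<Longrightarrow> q u 0 = 0"
  using herm_form_scale_right[of u u 0] by simp

lemma herm_form_zero_left: "u \<in> V \<Longrightarrow> q 0 u = 0"
  using herm_form_scale_left[of u u 0] by simp

lemma herm_form_sum_right:
  assumes "u \<in> V" "\<And>i. i \<in> I \<Longrightarrow> f i \<in> V"
  shows "q u (\<Sum>i\<in>I. f i) = (\<Sum>i\<in>I. q u (f i))"
  using assms(2)
proof (induction I rule: infinite_finite_induct)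
  case (insert i I)
  have "(\<Sum>i\<in>I. f i) \<in> V"
    using insert by (intro complex_vector.subspace_sum herm_form_subspace) auto
  then show ?case
    using insert assms(1) by (simp add: herm_form_add_right)
qed (simp_all add: herm_form_zero_right assms)

lemma herm_form_combination_right:
  assumes "u \<in> V" "\<And>i. i \<in> I \<Longrightarrow> f i \<in> V"
  shows "q u (\<Sum>i\<in>I. c i *\<^sub>C f i) = (\<Sum>i\<in>I. c i * q u (f i))"
proof -
  have "q u (\<Sum>i\<in>I. c i *\<^sub>C f i) = (\<Sum>i\<in>I. q u (c i *\<^sub>C f i))"
    using assms herm_form_subspace
    by (intro herm_form_sum_right) (auto intro: complex_vector.subspace_scale)
  also have "\<dots> = (\<Sum>i\<in>I. c i * q u (f i))"
    using assms by (intro sum.cong) (auto simp: herm_form_scale_right)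
  finally show ?thesis .
qed

lemma herm_form_combination_left:
  assumes "u \<in> V" "\<And>i. i \<in> I \<Longrightarrow> f i \<in> V"
  shows "q (\<Sum>i\<in>I. c i *\<^sub>C f i) u = (\<Sum>i\<in>I. cnj (c i) * q (f i) u)"
proof -
  have mem: "(\<Sum>i\<in>I. c i *\<^sub>C f i) \<in> V"
    using assms herm_form_subspace
    by (intro complex_vector.subspace_sum) (auto intro: complex_vector.subspace_scale)
  have "q (\<Sum>i\<in>I. c i *\<^sub>C f i) u = cnj (\<Sum>i\<in>I. c i * q u (f i))"
    by (simp add: herm_form_cnj[OF mem assms(1)] herm_form_combination_right[OF assms(1), of I f c] assms(2))
  also have "\<dots> = (\<Sum>i\<in>I. cnj (c i) * q (f i) u)"
    using assms by (auto simp: herm_form_cnj[of "f _" u] intro!: sum.cong)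
  finally show ?thesis .
qed

end

lemma herm_form_uminus:
  assumes "herm_form V q" shows "herm_form V (\<lambda>u v. - q u v)"
  unfolding herm_form_def
proof (intro conjI ballI allI)
  fix u v assume "u \<in> V" "v \<in> V"
  then show "- q u v = cnj (- q v u)"
    using herm_form_cnj[OF assms, of u v] by simp
qed (simp_all add: herm_form_subspace[OF assms] herm_form_add_right[OF assms]
    herm_form_scale_right[OF assms])

definition orthonormal_set :: "('a \<Rightarrow> 'a \<Rightarrow> complex) \<Rightarrow> 'a set \<Rightarrow> bool" where
  "orthonormal_set q E \<longleftrightarrow> finite E \<and> (\<forall>u\<in>E. \<forall>v\<in>E. q u v = (if u = v then 1 else 0))"

lemma orthonormal_coefficient:
  assumes "herm_form V q" "E \<subseteq> V" "orthonormal_set q E" "e \<in> E"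
  shows "q e (\<Sum>u\<in>E. c u *\<^sub>C u) = c e"
proof -
  have "q e (\<Sum>u\<in>E. c u *\<^sub>C u) = (\<Sum>u\<in>E. c u * q e u)"
    by (rule herm_form_combination_right[OF assms(1)]) (use assms in auto)
  also have "\<dots> = (\<Sum>u\<in>E. if u = e then c u else 0)"
    using assms(3,4) by (intro sum.cong) (auto simp: orthonormal_set_def)
  also have "\<dots> = c e"
    using assms(3,4) by (simp add: orthonormal_set_def)
  finally show ?thesis .
qed

lemma cindependentI:
  assumes "finite B" "\<And>c b. (\<Sum>u\<in>B. c u *\<^sub>C u) = 0 \<Longrightarrow> b \<in> B \<Longrightarrow> c b = 0"
  shows "cindependent B"
  using assms complex_vector.independent_if_scalars_zero by blast

lemma orthonormal_independent:
  assumes "herm_form V q" "E \<subseteq> V" "orthonormal_set q E"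
  shows "cindependent E"
proof (rule cindependentI)
  show "finite E" using assms(3) by (simp add: orthonormal_set_def)
  fix c b assume "(\<Sum>u\<in>E. c u *\<^sub>C u) = 0" "b \<in> E"
  then show "c b = 0"
    using orthonormal_coefficient[OF assms, of b c] herm_form_zero_right[OF assms(1)] assms(2) by auto
qed

text \<open>A maximal orthonormal set: a vector orthogonal to it on which the form is positive
  could be normalised and added.\<close>

lemma maximal_orthonormal_set:
  assumes q: "herm_form V q" and "finite B" "V \<subseteq> cspan B"
  obtains E where "E \<subseteq> V" "orthonormal_set q E" "cindependent E"
    "\<And>v. v \<in> V \<Longrightarrow> \<forall>e\<in>E. q e v = 0 \<Longrightarrow> Re (q v v) \<le> 0"
proof -
  let ?P = "\<lambda>k. \<exists>E\<subseteq>V. orthonormal_set q E \<and> card E = k"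
  \<comment> \<open>Orthonormal sets are independent, so their size is bounded and a largest one
    exists.\<close>
  have bound: "k \<le> card B" if "?P k" for k
    using that orthonormal_independent[OF q] complex_vector.independent_span_bound[OF \<open>finite B\<close>]
      assms(3) by (metis order_trans)
  have "?P 0"
    by (intro exI[of _ "{}"]) (simp add: orthonormal_set_def)
  then obtain k where k: "?P k" "\<And>j. ?P j \<Longrightarrow> j \<le> k"
    using Nat.ex_has_greatest_nat[of ?P 0 "card B"] bound by blast
  obtain E where E: "E \<subseteq> V" "orthonormal_set q E" "card E = k" using k(1) by blast
  have "Re (q v v) \<le> 0" if v: "v \<in> V" "\<forall>e\<in>E. q e v = 0" for v
  proof (rule ccontr)
    assume "\<not> Re (q v v) \<le> 0"
    then have pos: "Re (q v v) > 0" by simp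
    define t where "t = 1 / sqrt (Re (q v v))"
    define w where "w = complex_of_real t *\<^sub>C v"
    have w: "w \<in> V"
      unfolding w_def using v herm_form_subspace[OF q] by (auto intro: complex_vector.subspace_scale)
    have real: "q v v = complex_of_real (Re (q v v))"
      by (metis Reals_cnj_iff complex_is_Real_iff herm_form_cnj[OF q v(1) v(1)] of_real_Re)
    have "q w w = complex_of_real (t * t * Re (q v v))"
      unfolding w_def using v herm_form_subspace[OF q] real
      by (simp add: herm_form_scale_left[OF q] herm_form_scale_right[OF q] complex_vector.subspace_scale)
    also have "t * t * Re (q v v) = 1"
      using pos unfolding t_def by simp
    finally have ww: "q w w = 1" by simp
    have ew: "q e w = 0" "q w e = 0" if "e \<in> E" for e
    proof -
      have "e \<in> V" using E that by blast
      then show "q e w = 0"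
        unfolding w_def using v that by (simp add: herm_form_scale_right[OF q])
      then show "q w e = 0"
        using herm_form_cnj[OF q w \<open>e \<in> V\<close>] by simp
    qed
    have "w \<notin> E" using ww ew by force
    have "?P (Suc k)"
      using E w ww ew \<open>w \<notin> E\<close>
      by (intro exI[of _ "insert w E"]) (auto simp: orthonormal_set_def)
    then show False using k(2)[of "Suc k"] by simp
  qed
  then show ?thesis using that E orthonormal_independent[OF q E(1,2)] by blast
qed

text \<open>Subtracting the expansion from \<open>v\<close> leaves a vector orthogonal to a maximal
  orthonormal set; the form is not positive on it, so positivity forces it to vanish.\<close>

lemma orthonormal_basis:
  assumes q: "herm_form V q" and "finite B" "V \<subseteq> cspan B"
    and pos: "\<And>v. v \<in> V \<Longrightarrow> v \<noteq> 0 \<Longrightarrow> Re (q v v) > 0"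
  obtains E where "E \<subseteq> V" "orthonormal_set q E" "cindependent E"
    "\<And>v. v \<in> V \<Longrightarrow> v = (\<Sum>e\<in>E. q e v *\<^sub>C e)"
proof -
  obtain E where E: "E \<subseteq> V" "orthonormal_set q E" "cindependent E"
    "\<And>v. v \<in> V \<Longrightarrow> \<forall>e\<in>E. q e v = 0 \<Longrightarrow> Re (q v v) \<le> 0"
    using maximal_orthonormal_set[OF assms(1-3)] by blast
  have "v = (\<Sum>e\<in>E. q e v *\<^sub>C e)" if "v \<in> V" for v
  proof -
    let ?s = "\<Sum>e\<in>E. q e v *\<^sub>C e"
    have V: "csubspace V" by (rule herm_form_subspace[OF q])
    have s: "?s \<in> V"
      using E(1) V by (intro complex_vector.subspace_sum) (auto intro: complex_vector.subspace_scale)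
    have r: "v - ?s \<in> V" using s that V by (rule_tac csubspace_diff)
    have "q e (v - ?s) = 0" if e: "e \<in> E" for e
    proof -
      have "e \<in> V" using E e by blast
      then have "q e v = q e (v - ?s) + q e ?s"
        using herm_form_add_right[OF q \<open>e \<in> V\<close> r s] by simp
      then show ?thesis
        using orthonormal_coefficient[OF q E(1,2) e, of "\<lambda>e. q e v"] by simp
    qed
    then have "v - ?s = 0" using E(4)[OF r] pos[OF r] by fastforce
    then show ?thesis by simp
  qed
  then show ?thesis using that E by blast
qed

section \<open>Linear maps and dimension\<close>

lemma clinear_on_add: "clinear_on V f \<Longrightarrow> x \<in> V \<Longrightarrow> y \<in> V \<Longrightarrow> f (x + y) = f x + f y"
  by (simp add: clinear_on_def)

lemma clinear_on_scale: "clinear_on V f \<Longrightarrow> x \<in> V \<Longrightarrow> f (c *\<^sub>C x) = c *\<^sub>C f x"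
  by (simp add: clinear_on_def)

lemma clinear_on_zero: "clinear_on V f \<Longrightarrow> csubspace V \<Longrightarrow> f 0 = 0"
  using clinear_on_scale[of V f 0 0] by (simp add: complex_vector.subspace_0)

lemma clinear_on_minus: "clinear_on V f \<Longrightarrow> x \<in> V \<Longrightarrow> f (- x) = - f x"
  using clinear_on_scale[of V f x "-1"] by simp

lemma clinear_on_diff:
  assumes "clinear_on V f" "csubspace V" "x \<in> V" "y \<in> V" shows "f (x - y) = f x - f y"
  using clinear_on_add[OF assms(1), of x "- y"] clinear_on_minus[OF assms(1,4)] assms
  by (simp add: complex_vector.subspace_neg)

lemma clinear_on_combination:
  assumes f: "clinear_on V f" and V: "csubspace V" and "\<And>i. i \<in> I \<Longrightarrow> v i \<in> V"
  shows "f (\<Sum>i\<in>I. c i *\<^sub>C v i) = (\<Sum>i\<in>I. c i *\<^sub>C f (v i))"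
  using assms(3)
proof (induction I rule: infinite_finite_induct)
  case (insert i I)
  have "(\<Sum>i\<in>I. c i *\<^sub>C v i) \<in> V"
    using insert V
    by (intro complex_vector.subspace_sum) (auto intro: complex_vector.subspace_scale)
  then show ?case
    using insert V
    by (simp add: clinear_on_add[OF f] clinear_on_scale[OF f] complex_vector.subspace_scale)
qed (use f V in \<open>simp_all add: clinear_on_zero\<close>)

lemma csubspace_image:
  assumes f: "clinear_on V f" and V: "csubspace V"
  shows "csubspace (f ` V)"
  unfolding complex_vector.subspace_def
proof (intro conjI ballI allI)
  show "0 \<in> f ` V"
    using clinear_on_zero[OF f V] complex_vector.subspace_0[OF V] by force
  fix x y assume "x \<in> f ` V" "y \<in> f ` V"
  then show "x + y \<in> f ` V"
    using clinear_on_add[OF f] complex_vector.subspace_add[OF V] by (smt (verit) imageE imageI)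
next
  fix c x assume "x \<in> f ` V"
  then show "c *\<^sub>C x \<in> f ` V"
    using clinear_on_scale[OF f] complex_vector.subspace_scale[OF V] by (smt (verit) imageE imageI)
qed

lemma clinear_on_inj:
  assumes f: "clinear_on V f" and V: "csubspace V" and "\<And>v. v \<in> V \<Longrightarrow> f v = 0 \<Longrightarrow> v = 0"
  shows "inj_on f V"
proof (rule inj_onI)
  fix x y assume xy: "x \<in> V" "y \<in> V" "f x = f y"
  then have "f (x - y) = 0" using clinear_on_diff[OF f V] by simp
  then show "x = y" using assms(3)[OF csubspace_diff[OF V xy(1,2)]] by simp
qed

lemma cindependent_image:
  assumes f: "clinear_on V f" and V: "csubspace V" and inj: "inj_on f V"
    and B: "finite B" "B \<subseteq> V" "cindependent B"
  shows "cindependent (f ` B)"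
proof (rule cindependentI)
  show "finite (f ` B)" using B by simp
  fix c b assume 0: "(\<Sum>u\<in>f ` B. c u *\<^sub>C u) = 0" and b: "b \<in> f ` B"
  have "(\<Sum>u\<in>f ` B. c u *\<^sub>C u) = (\<Sum>u\<in>B. c (f u) *\<^sub>C f u)"
    by (subst sum.reindex) (use inj B(2) in \<open>auto simp: inj_on_subset\<close>)
  also have "\<dots> = f (\<Sum>u\<in>B. c (f u) *\<^sub>C u)"
    by (rule clinear_on_combination[OF f V, of B "\<lambda>u. u", symmetric]) (use B in auto)
  finally have "f (\<Sum>u\<in>B. c (f u) *\<^sub>C u) = f 0"
    using 0 clinear_on_zero[OF f V] by simp
  moreover have "(\<Sum>u\<in>B. c (f u) *\<^sub>C u) \<in> V"
    using B V by (intro complex_vector.subspace_sum) (auto intro: complex_vector.subspace_scale)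
  ultimately have "(\<Sum>u\<in>B. c (f u) *\<^sub>C u) = 0"
    using inj complex_vector.subspace_0[OF V] by (auto dest: inj_onD)
  then show "c b = 0"
    using b complex_vector.independentD[OF B(3) B(1) subset_refl, of "\<lambda>u. c (f u)"] by auto
qed

text \<open>An injective map carries finite independent sets to independent sets in
  \<open>cspan T\<close>, which bounds their size. Finite dimension of \<open>V\<close> is thus a
  conclusion; this is how kernels of the adjoint become finite-dimensional, through their boundary
  values.\<close>

lemma finite_basis_of_injection:
  assumes f: "clinear_on V f" and V: "csubspace V" and inj: "inj_on f V"
    and "finite T" "f ` V \<subseteq> cspan T"
  obtains B where "finite B" "B \<subseteq> V" "cindependent B" "cspan B = V" "card B \<le> card T"
proof -
  have fin: "finite B \<and> card B \<le> card T" if B: "B \<subseteq> V" "cindependent B" for B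
  proof -
    have le: "card A \<le> card T" if "A \<subseteq> B" "finite A" for A
    proof -
      have "cindependent A" using that B(2) complex_vector.independent_mono by blast
      then have "cindependent (f ` A)"
        using cindependent_image[OF f V inj] that B by auto
      then have "card (f ` A) \<le> card T"
        using complex_vector.independent_span_bound[OF \<open>finite T\<close>, of "f ` A"] assms(5) B that by blast
      moreover have "card (f ` A) = card A"
        using inj B that by (meson card_image inj_on_subset order_trans)
      ultimately show ?thesis by simp
    qed
    have "finite B"
    proof (rule ccontr)
      assume "infinite B"
      then obtain A where "A \<subseteq> B" "finite A" "card A = Suc (card T)"
        using infinite_arbitrarily_large by blast
      then show False using le[of A] infinite_super by (metis not_less_eq_eq order_refl card.infinite nat.distinct(1))
    qed
    then show ?thesis using le by blast
  qed
  obtain B where B: "B \<subseteq> V" "cindependent B" "V \<subseteq> cspan B"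
    using complex_vector.maximal_independent_subset by blast
  have "cspan B = V"
    using B V by (simp add: complex_vector.span_subspace)
  then show ?thesis using that B fin by blast
qed

lemma cdim_image:
  assumes f: "clinear_on V f" and V: "csubspace V" and inj: "inj_on f V"
    and "finite T" "V \<subseteq> cspan T"
  shows "cdim (f ` V) = cdim V"
proof -
  obtain B where B: "finite B" "B \<subseteq> V" "cindependent B" "cspan B = V"
    by (rule finite_basis_of_injection[of V "\<lambda>x. x" T])
      (use V assms(4,5) in \<open>auto simp: clinear_on_def intro: that\<close>)
  have "f ` V \<subseteq> cspan (f ` B)"
  proof
    fix y assume "y \<in> f ` V"
    then obtain x where "x \<in> cspan B" "y = f x" using B by auto
    then obtain c where "x = (\<Sum>b\<in>B. c b *\<^sub>C b)"
      using complex_vector.span_finite[OF B(1)] by auto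
    then have "y = (\<Sum>b\<in>B. c b *\<^sub>C f b)"
      using clinear_on_combination[OF f V, of B "\<lambda>b. b" c] B \<open>y = f x\<close> by auto
    then show "y \<in> cspan (f ` B)"
      by (auto intro!: complex_vector.span_sum complex_vector.span_scale intro: complex_vector.span_base)
  qed
  then have "cdim (f ` V) = card (f ` B)"
    using B(2) by (intro complex_vector.dim_unique[OF _ _ cindependent_image[OF f V inj B(1-3)]]) auto
  also have "\<dots> = card B" using inj B by (meson card_image inj_on_subset)
  also have "\<dots> = cdim V" using complex_vector.dim_span_eq_card_independent[OF B(3)] B(4) by simp
  finally show ?thesis .
qed

section \<open>The negative index\<close>

abbreviation negative_on :: "('a::chilbert \<Rightarrow> 'a \<Rightarrow> complex) \<Rightarrow> 'a set \<Rightarrow> bool" where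
  "negative_on q V \<equiv> csubspace V \<and> (\<forall>u\<in>V - {0}. Re (q u u) < 0)"

text \<open>The span of \<open>E\<close> is a negative subspace. Conversely the map \<open>f\<close>
  in the proof, which is minus the projection onto that span, is injective on every negative
  subspace: its kernel is orthogonal to \<open>E\<close>, where the form is nonnegative.\<close>

lemma neg_index_eq_card:
  assumes q: "herm_form A q" and fin: "finite B" "A \<subseteq> cspan B"
    and E: "E \<subseteq> A" "orthonormal_set (\<lambda>u v. - q u v) E"
    and nonneg: "\<And>v. v \<in> A \<Longrightarrow> \<forall>e\<in>E. q e v = 0 \<Longrightarrow> 0 \<le> Re (q v v)"
  shows "neg_index A q = card E"
proof -
  have finE: "finite E" using E by (simp add: orthonormal_set_def)
  have q': "herm_form A (\<lambda>u v. - q u v)" by (rule herm_form_uminus[OF q])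
  have A: "csubspace A" by (rule herm_form_subspace[OF q])
  have ind: "cindependent E" by (rule orthonormal_independent[OF q' E])
  have le: "cdim V \<le> card E" if V: "V \<subseteq> A" "negative_on q V" for V
  proof -
    define f where "f v = (\<Sum>e\<in>E. q e v *\<^sub>C e)" for v
    have EA: "e \<in> A" if "e \<in> E" for e using E that by blast
    have lin: "clinear_on V f"
      unfolding clinear_on_def f_def
    proof (intro conjI ballI allI)
      fix x y assume "x \<in> V" "y \<in> V"
      then have "x \<in> A" "y \<in> A" using V by auto
      then show "(\<Sum>e\<in>E. q e (x + y) *\<^sub>C e) = (\<Sum>e\<in>E. q e x *\<^sub>C e) + (\<Sum>e\<in>E. q e y *\<^sub>C e)"
        using EA by (simp add: herm_form_add_right[OF q] scaleC_add_left sum.distrib)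
    next
      fix c x assume "x \<in> V"
      then have "x \<in> A" using V by auto
      then show "(\<Sum>e\<in>E. q e (c *\<^sub>C x) *\<^sub>C e) = c *\<^sub>C (\<Sum>e\<in>E. q e x *\<^sub>C e)"
        using EA by (simp add: herm_form_scale_right[OF q] complex_vector.scale_sum_right scaleC_scaleC)
    qed
    have "inj_on f V"
    proof (rule clinear_on_inj[OF lin])
      show "csubspace V" using V by blast
      fix v assume v: "v \<in> V" "f v = 0"
      then have "\<forall>e\<in>E. q e v = 0"
        using complex_vector.independentD[OF ind finE subset_refl, of "\<lambda>e. q e v"]
        unfolding f_def by blast
      then have "0 \<le> Re (q v v)" using nonneg v V by blast
      then show "v = 0" using v V by force
    qed
    moreover have "f ` V \<subseteq> cspan E"
      by (auto simp: f_def intro!: complex_vector.span_sum complex_vector.span_scale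
          intro: complex_vector.span_base)
    ultimately obtain B where "cindependent B" "cspan B = V" "card B \<le> card E"
      using finite_basis_of_injection[OF lin conjunct1[OF V(2)] _ finE] by metis
    then show ?thesis using complex_vector.dim_span_eq_card_independent by metis
  qed
  have "negative_on q (cspan E)"
  proof (intro conjI ballI)
    fix u assume u: "u \<in> cspan E - {0}"
    then obtain c where c: "u = (\<Sum>e\<in>E. c e *\<^sub>C e)"
      using complex_vector.span_finite[OF finE] by auto
    have uA: "u \<in> A"
      using u complex_vector.span_minimal[OF E(1) A] by auto
    have "- q u u = (\<Sum>e\<in>E. cnj (c e) * - q e u)"
      using herm_form_combination_left[OF q' uA, of E "\<lambda>e. e" c] E c by auto
    also have "\<dots> = (\<Sum>e\<in>E. cnj (c e) * c e)"
      using orthonormal_coefficient[OF q' E, of _ c] c by (intro sum.cong) auto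
    also have "\<dots> = (\<Sum>e\<in>E. complex_of_real ((cmod (c e))\<^sup>2))"
      by (metis (no_types, lifting) complex_norm_square mult.commute)
    finally have *: "- Re (q u u) = (\<Sum>e\<in>E. (cmod (c e))\<^sup>2)"
      by (metis Re_complex_of_real of_real_sum uminus_complex.sel(1))
    have "\<exists>e\<in>E. c e \<noteq> 0" using u c by (auto intro: ccontr)
    then have "0 < (\<Sum>e\<in>E. (cmod (c e))\<^sup>2)"
      using finE by (auto intro!: sum_pos2)
    then show "Re (q u u) < 0" using * by simp
  qed auto
  then have "card E \<in> {cdim V | V. csubspace V \<and> V \<subseteq> A \<and> (\<forall>u\<in>V - {0}. Re (q u u) < 0)}"
    using complex_vector.dim_span_eq_card_independent[OF ind]
      complex_vector.span_minimal[OF E(1) A] by (intro CollectI exI[of _ "cspan E"]) simp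
  moreover have "finite {cdim V | V. csubspace V \<and> V \<subseteq> A \<and> (\<forall>u\<in>V - {0}. Re (q u u) < 0)}"
    by (rule finite_subset[of _ "{..card E}"]) (use le in auto)
  ultimately show ?thesis
    unfolding neg_index_def by (intro Max_eqI) (use le in auto)
qed

lemma negative_orthonormal_set:
  assumes q: "herm_form A q" and fin: "finite B" "A \<subseteq> cspan B"
  obtains E where "E \<subseteq> A" "orthonormal_set (\<lambda>u v. - q u v) E" "neg_index A q = card E"
    "\<And>v. v \<in> A \<Longrightarrow> \<forall>e\<in>E. q e v = 0 \<Longrightarrow> 0 \<le> Re (q v v)"
proof -
  obtain E where E: "E \<subseteq> A" "orthonormal_set (\<lambda>u v. - q u v) E"
      "\<And>v. v \<in> A \<Longrightarrow> \<forall>e\<in>E. - q e v = 0 \<Longrightarrow> Re (- q v v) \<le> 0"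
    by (rule maximal_orthonormal_set[OF herm_form_uminus[OF q] fin]) (rule that)
  have *: "0 \<le> Re (q v v)" if "v \<in> A" "\<forall>e\<in>E. q e v = 0" for v
    using E(3)[OF that(1)] that(2) by simp
  show ?thesis by (rule that[OF E(1,2) neg_index_eq_card[OF q fin E(1,2) *] *])
qed

text \<open>Negative subspaces correspond under image and preimage. Comparing real parts on the
  diagonal is enough, since \<open>neg_index\<close> sees nothing else.\<close>

lemma neg_index_transport:
  assumes f: "clinear_on A f" "f ` A = A'" and inj: "inj_on f A" and A: "csubspace A"
    and fin: "finite T" "A \<subseteq> cspan T"
    and eq: "\<And>x. x \<in> A \<Longrightarrow> Re (q' (f x) (f x)) = Re (q x x)"
  shows "neg_index A' q' = neg_index A q"
proof -
  have lin: "clinear_on V f" if "V \<subseteq> A" for V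
    using f(1) that by (simp add: clinear_on_def subset_iff)
  have dim: "cdim (f ` V) = cdim V" if "V \<subseteq> A" "csubspace V" for V
    by (rule cdim_image[OF lin[OF that(1)] that(2) inj_on_subset[OF inj that(1)] fin(1)
          order_trans[OF that(1) fin(2)]])
  have f0: "f 0 = 0" by (rule clinear_on_zero[OF f(1) A])
  have "{cdim V | V. csubspace V \<and> V \<subseteq> A \<and> (\<forall>u\<in>V - {0}. Re (q u u) < 0)} =
        {cdim V | V. csubspace V \<and> V \<subseteq> A' \<and> (\<forall>u\<in>V - {0}. Re (q' u u) < 0)}" (is "?L = ?R")
  proof (intro equalityI subsetI)
    fix k assume "k \<in> ?L"
    then obtain V where V: "k = cdim V" "csubspace V" "V \<subseteq> A" "\<forall>u\<in>V - {0}. Re (q u u) < 0" by auto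
    have "csubspace (f ` V)" by (rule csubspace_image[OF lin[OF V(3)] V(2)])
    moreover have "f ` V \<subseteq> A'" using V f by blast
    moreover have "Re (q' (f x) (f x)) < 0" if "x \<in> V" "f x \<noteq> 0" for x
    proof -
      have "x \<noteq> 0" using that f0 by auto
      then show ?thesis using V(3,4) that eq[of x] by auto
    qed
    ultimately show "k \<in> ?R"
      using dim[OF V(3,2)] V(1) by (intro CollectI exI[of _ "f ` V"]) auto
  next
    fix k assume "k \<in> ?R"
    then obtain W where W: "k = cdim W" "csubspace W" "W \<subseteq> A'" "\<forall>u\<in>W - {0}. Re (q' u u) < 0" by auto
    define V where "V = {x \<in> A. f x \<in> W}"
    have VA: "V \<subseteq> A" by (auto simp: V_def)
    have fV: "f ` V = W" using f W by (auto simp: V_def)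
    have "csubspace V"
      unfolding V_def complex_vector.subspace_def using f0
      by (auto simp: clinear_on_add[OF f(1)] clinear_on_scale[OF f(1)] complex_vector.subspace_0[OF A]
          complex_vector.subspace_0[OF W(2)] complex_vector.subspace_add[OF A]
          complex_vector.subspace_add[OF W(2)] complex_vector.subspace_scale[OF A]
          complex_vector.subspace_scale[OF W(2)])
    moreover have "Re (q u u) < 0" if u: "u \<in> V - {0}" for u
    proof -
      have "f u \<noteq> 0"
          using u inj_onD[OF inj, of u 0] f0 complex_vector.subspace_0[OF A] VA by auto
      then show ?thesis using bspec[OF W(4), of "f u"] eq[of u] u unfolding V_def by auto
    qed
    ultimately show "k \<in> ?L"
      using dim[OF VA] fV W(1) VA by (intro CollectI exI[of _ V]) auto
  qed
  then show ?thesis unfolding neg_index_def by (simp only:)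
qed

lemma csubspace_Times: "csubspace A \<Longrightarrow> csubspace A' \<Longrightarrow> csubspace (A \<times> A')"
  by (auto simp: complex_vector.subspace_def scaleC_prod_def zero_prod_def)

lemma finite_span_Times:
  assumes "A \<subseteq> cspan B" "A' \<subseteq> cspan B'"
  shows "A \<times> A' \<subseteq> cspan ((\<lambda>x. (x, 0)) ` B \<union> (\<lambda>x. (0, x)) ` B')"
proof -
  let ?S = "cspan ((\<lambda>x. (x, 0)) ` B \<union> (\<lambda>x. (0, x)) ` B')"
  have "cspan B \<subseteq> {x. (x, 0) \<in> ?S}"
  proof (rule complex_vector.span_minimal)
    show "B \<subseteq> {x. (x, 0) \<in> ?S}" by (auto intro: complex_vector.span_base)
    have "(x + y, 0) \<in> ?S" if "(x, 0) \<in> ?S" "(y, 0) \<in> ?S" for x y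
      using complex_vector.span_add[OF that] by simp
    moreover have "(c *\<^sub>C x, 0) \<in> ?S" if "(x, 0) \<in> ?S" for x c
      using complex_vector.span_scale[OF that, of c] by (simp add: scaleC_prod_def)
    moreover have "(0, 0) \<in> ?S"
      using complex_vector.span_zero by (metis zero_prod_def)
    ultimately show "csubspace {x. (x, 0) \<in> ?S}"
      by (auto simp: complex_vector.subspace_def)
  qed
  moreover have "cspan B' \<subseteq> {x. (0, x) \<in> ?S}"
  proof (rule complex_vector.span_minimal)
    show "B' \<subseteq> {x. (0, x) \<in> ?S}" by (auto intro: complex_vector.span_base)
    have "(0, x + y) \<in> ?S" if "(0, x) \<in> ?S" "(0, y) \<in> ?S" for x y
      using complex_vector.span_add[OF that] by simp
    moreover have "(0, c *\<^sub>C x) \<in> ?S" if "(0, x) \<in> ?S" for x c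
      using complex_vector.span_scale[OF that, of c] by (simp add: scaleC_prod_def)
    moreover have "(0, 0) \<in> ?S"
      using complex_vector.span_zero by (metis zero_prod_def)
    ultimately show "csubspace {x. (0, x) \<in> ?S}"
      by (auto simp: complex_vector.subspace_def)
  qed
  ultimately have "(x, 0) + (0, y) \<in> ?S" if "x \<in> A" "y \<in> A'" for x y
    using that assms by (intro complex_vector.span_add) auto
  then show ?thesis by auto
qed

text \<open>Maximal negative orthonormal sets of the two factors, embedded in the product, together
  form one for the orthogonal sum.\<close>

lemma neg_index_Times:
  assumes q: "herm_form A q" "finite B" "A \<subseteq> cspan B"
    and q': "herm_form A' q'" "finite B'" "A' \<subseteq> cspan B'"
  shows "neg_index (A \<times> A') (\<lambda>u v. q (fst u) (fst v) + q' (snd u) (snd v))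
           = neg_index A q + neg_index A' q'"
proof -
  obtain E where E: "E \<subseteq> A" "orthonormal_set (\<lambda>u v. - q u v) E" "neg_index A q = card E"
    "\<And>v. v \<in> A \<Longrightarrow> \<forall>e\<in>E. q e v = 0 \<Longrightarrow> 0 \<le> Re (q v v)"
    by (rule negative_orthonormal_set[OF q]) (rule that)
  obtain E' where E': "E' \<subseteq> A'" "orthonormal_set (\<lambda>u v. - q' u v) E'" "neg_index A' q' = card E'"
    "\<And>v. v \<in> A' \<Longrightarrow> \<forall>e\<in>E'. q' e v = 0 \<Longrightarrow> 0 \<le> Re (q' v v)"
    by (rule negative_orthonormal_set[OF q']) (rule that)
  let ?h = "\<lambda>u v. q (fst u) (fst v) + q' (snd u) (snd v)"
  let ?F = "(\<lambda>x. (x, 0)) ` E \<union> (\<lambda>x. (0, x)) ` E'"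
  have A: "csubspace A" "csubspace A'" using q q' by (simp_all add: herm_form_def)
  have z: "0 \<in> A" "0 \<in> A'" using A complex_vector.subspace_0 by auto
  note zr = herm_form_zero_right[OF q(1)] herm_form_zero_left[OF q(1)]
  note zr' = herm_form_zero_right[OF q'(1)] herm_form_zero_left[OF q'(1)]
  have e: "- q u v = (if u = v then 1 else 0)" if "u \<in> E" "v \<in> E" for u v
    using E(2) that unfolding orthonormal_set_def by blast
  have e': "- q' u v = (if u = v then 1 else 0)" if "u \<in> E'" "v \<in> E'" for u v
    using E'(2) that unfolding orthonormal_set_def by blast
  \<comment> \<open>Zero is the only vector the two embedded copies could share.\<close>
  have n0: "0 \<notin> E" "0 \<notin> E'"
    using e[of 0 0] e'[of 0 0] zr[OF z(1)] zr'[OF z(2)] by auto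
  have "herm_form (A \<times> A') ?h"
    unfolding herm_form_def
  proof (intro conjI ballI allI)
    show "csubspace (A \<times> A')" using A by (rule csubspace_Times)
    fix u v w assume m: "u \<in> A \<times> A'" "v \<in> A \<times> A'" 
    show "?h u v = cnj (?h v u)"
      using m herm_form_cnj[OF q(1), of "fst u" "fst v"] herm_form_cnj[OF q'(1), of "snd u" "snd v"]
      by (simp only: complex_cnj_add mem_Times_iff)
    show "?h u (c *\<^sub>C v) = c * ?h u v" for c
      using m by (auto simp: scaleC_prod_def herm_form_scale_right[OF q(1)]
          herm_form_scale_right[OF q'(1)] algebra_simps)
    assume "w \<in> A \<times> A'"
    then show "?h u (v + w) = ?h u v + ?h u w"
      using m by (auto simp: herm_form_add_right[OF q(1)] herm_form_add_right[OF q'(1)])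
  qed
  moreover have "?F \<subseteq> A \<times> A'" using E E' z by auto
  moreover have "orthonormal_set (\<lambda>u v. - ?h u v) ?F"
  proof -
    have "- ?h u v = (if u = v then 1 else 0)" if "u \<in> ?F" "v \<in> ?F" for u v
      using that z n0 e e' zr zr' subsetD[OF E(1)] subsetD[OF E'(1)]
      by (elim UnE imageE) (auto split: if_splits)
    moreover have "finite ?F" using E(2) E'(2) by (simp add: orthonormal_set_def)
    ultimately show ?thesis unfolding orthonormal_set_def by blast
  qed
  moreover have "0 \<le> Re (?h v v)" if v: "v \<in> A \<times> A'" "\<forall>e\<in>?F. ?h e v = 0" for v
  proof -
    have "q e (fst v) = 0" if "e \<in> E" for e
      using bspec[OF v(2), of "(e, 0)"] that zr' v(1) by auto
    moreover have "q' e (snd v) = 0" if "e \<in> E'" for e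
      using bspec[OF v(2), of "(0, e)"] that zr v(1) by auto
    ultimately show ?thesis using E(4)[of "fst v"] E'(4)[of "snd v"] v(1) by auto
  qed
  ultimately have "neg_index (A \<times> A') ?h = card ?F"
    using q q' finite_span_Times[OF q(3) q'(3)]
    by (intro neg_index_eq_card[where B = "(\<lambda>x. (x, 0)) ` B \<union> (\<lambda>x. (0, x)) ` B'"]) auto
  also have "\<dots> = card ((\<lambda>x. (x, 0::'b)) ` E) + card ((\<lambda>x. (0::'a, x)) ` E')"
    using E(2) E'(2) n0 by (intro card_Un_disjoint) (auto simp: orthonormal_set_def)
  also have "\<dots> = neg_index A q + neg_index A' q'"
    using E(3) E'(3) by (simp add: card_image inj_on_def)
  finally show ?thesis .
qed

section \<open>Lagrangian planes\<close>

lemma symp_add_right: "symp u (v + w) = symp u v + symp u w"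
  by (simp add: symp_def cinner_simps)

lemma symp_add_left: "symp (u + v) w = symp u w + symp v w"
  by (simp add: symp_def cinner_simps)

lemma symp_diff_right: "symp u (v - w) = symp u v - symp u w"
  by (simp add: symp_def cinner_simps)

lemma symp_diff_left: "symp (u - v) w = symp u w - symp v w"
  by (simp add: symp_def cinner_simps)

lemma symp_minus_right: "symp u (- v) = - symp u v"
  by (simp add: symp_def cinner_simps)

lemma symp_scale_right: "symp u (c *\<^sub>C v) = c * symp u v"
  by (simp add: symp_def cinner_simps scaleC_prod_def algebra_simps)

lemma symp_scale_left: "symp (c *\<^sub>C u) v = cnj c * symp u v"
  by (simp add: symp_def cinner_simps scaleC_prod_def algebra_simps)

lemma symp_zero_right [simp]: "symp u 0 = 0"
  by (simp add: symp_def)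

lemma symp_zero_left [simp]: "symp 0 u = 0"
  by (simp add: symp_def)

lemma symp_cnj: "symp u v = - cnj (symp v u)"
  using cinner_commute[of "fst u" "snd v"] cinner_commute[of "snd u" "fst v"]
  by (simp add: symp_def)

lemma symp_sum_right: "symp u (\<Sum>i\<in>I. c i *\<^sub>C v i) = (\<Sum>i\<in>I. c i * symp u (v i))"
  by (induction I rule: infinite_finite_induct) (simp_all add: symp_add_right symp_scale_right)

lemma symp_sum_left: "symp (\<Sum>i\<in>I. c i *\<^sub>C v i) u = (\<Sum>i\<in>I. cnj (c i) * symp (v i) u)"
  by (induction I rule: infinite_finite_induct) (simp_all add: symp_add_left symp_scale_left)

lemmas symp_simps = symp_add_left symp_add_right symp_scale_left symp_scale_right
  symp_diff_left symp_diff_right symp_minus_right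

lemma symp_eq_0_commute: "symp u v = 0 \<longleftrightarrow> symp v u = 0"
  using symp_cnj[of u v] by auto

lemma lagrangian_subspace: "lagrangian L \<Longrightarrow> csubspace L"
  by (simp add: lagrangian_def)

lemma lagrangian_iff: "lagrangian L \<Longrightarrow> u \<in> L \<longleftrightarrow> (\<forall>v\<in>L. symp u v = 0)"
  unfolding lagrangian_def by blast

lemma lagrangian_symp: "lagrangian L \<Longrightarrow> u \<in> L \<Longrightarrow> v \<in> L \<Longrightarrow> symp u v = 0"
  using lagrangian_iff by blast

lemma lagrangianI:
  assumes "csubspace L" "\<And>u v. u \<in> L \<Longrightarrow> v \<in> L \<Longrightarrow> symp u v = 0"
    and "\<And>u. (\<And>v. v \<in> L \<Longrightarrow> symp u v = 0) \<Longrightarrow> u \<in> L"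
  shows "lagrangian L"
  unfolding lagrangian_def
proof (intro conjI equalityI subsetI CollectI ballI)
  show "u \<in> L" if "u \<in> {u. \<forall>v\<in>L. symp u v = 0}" for u
    using that assms(3) by simp
qed (simp_all add: assms(1,2))

lemma finite_span_prod_UNIV:
  assumes "has_cdim (UNIV :: 'k::chilbert set) n"
  obtains T :: "('k::chilbert \<times> 'k) set" where "finite T" "cspan T = UNIV" "card T \<le> 2 * n"
proof -
  obtain B :: "'k set" where B: "finite B" "cspan B = UNIV" "card B = n"
    using assms unfolding has_cdim_def by blast
  let ?T = "(\<lambda>x. (x, 0::'k)) ` B \<union> (\<lambda>x. (0::'k, x)) ` B"
  have "cspan ?T = UNIV"
    using finite_span_Times[of UNIV B UNIV B] B(2) by auto
  moreover have "card ?T \<le> 2 * n"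
    using card_Un_le[of "(\<lambda>x. (x, 0::'k)) ` B" "(\<lambda>x. (0::'k, x)) ` B"]
      card_image_le[OF B(1), of "\<lambda>x. (x, 0::'k)"] card_image_le[OF B(1), of "\<lambda>x. (0::'k, x)"] B(3)
    by linarith
  moreover have "finite ?T" using B(1) by simp
  ultimately show ?thesis using that by blast
qed

context
  fixes n :: nat
  assumes dim: "has_cdim (UNIV :: 'k::chilbert set) n"
begin

text \<open>The rotation (a, b) to (-b, a) turns the inner product into the symplectic form. Applied
  to the component of \<open>u\<close> orthogonal to A + B it gives a vector symplectically
  orthogonal to both planes, hence lying in both, hence zero. This takes the place of a dimension
  count.\<close>

lemma lagrangian_sum_UNIV:
  fixes A B :: "('k \<times> 'k) set"
  assumes A: "lagrangian A" and B: "lagrangian B" and AB: "A \<inter> B = {0}"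
  obtains a b where "a \<in> A" "b \<in> B" "u = a + b"
proof -
  let ?U = "{x + y | x y. x \<in> A \<and> y \<in> B}"
  have sA: "csubspace A" and sB: "csubspace B" using A B by (simp_all add: lagrangian_subspace)
  have U: "csubspace ?U" by (rule complex_vector.subspace_sums[OF sA sB])
  have AU: "x \<in> ?U" if "x \<in> A" for x
    using that complex_vector.subspace_0[OF sB] by (intro CollectI exI[of _ x] exI[of _ 0]) simp
  have BU: "x \<in> ?U" if "x \<in> B" for x
    using that complex_vector.subspace_0[OF sA] by (intro CollectI exI[of _ 0] exI[of _ x]) simp
  obtain T :: "('k \<times> 'k) set" where T: "finite T" "cspan T = UNIV"
    by (rule finite_span_prod_UNIV[OF dim])
  obtain E where E: "E \<subseteq> ?U" "orthonormal_set cinner E"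
    "\<And>v. v \<in> ?U \<Longrightarrow> v = (\<Sum>e\<in>E. cinner e v *\<^sub>C e)"
  proof (rule orthonormal_basis[OF herm_form_cinner[OF U] T(1)])
    show "?U \<subseteq> cspan T" using T by simp
    show "0 < Re (cinner v v)" if "v \<noteq> 0" for v :: "'k \<times> 'k"
      using that by (simp add: Re_cinner_self)
  qed (rule that)
  let ?s = "\<Sum>e\<in>E. cinner e u *\<^sub>C e"
  define r where "r = u - ?s"
  have er: "cinner e r = 0" if "e \<in> E" for e
    using orthonormal_coefficient[OF herm_form_cinner[OF complex_vector.subspace_UNIV] subset_UNIV
        E(2) that, of "\<lambda>e. cinner e u"]
    by (simp add: r_def cinner_diff_right)
  have Ur: "cinner w r = 0" if "w \<in> ?U" for w
  proof -
    have "cinner w r = cinner (\<Sum>e\<in>E. cinner e w *\<^sub>C e) r"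
      using E(3)[OF that] by simp
    also have "\<dots> = (\<Sum>e\<in>E. cnj (cinner e w) * cinner e r)"
      by (rule herm_form_combination_left[OF herm_form_cinner[OF complex_vector.subspace_UNIV]]) auto
    finally show ?thesis using er by simp
  qed
  define r' where "r' = (- snd r, fst r)"
  have "symp w r' = cinner w r" for w
    by (simp add: symp_def r'_def cinner_prod_def cinner_minus_right)
  then have "symp r' w = 0" if "w \<in> ?U" for w
    using Ur[OF that] symp_eq_0_commute[of r' w] by simp
  then have "r' \<in> A" "r' \<in> B"
    using lagrangian_iff[OF A, of r'] lagrangian_iff[OF B, of r'] AU BU by simp_all
  then have "r' \<in> A \<inter> B" ..
  then have "r' = 0" unfolding AB by simp
  then have "u = ?s"
    by (simp add: r'_def r_def zero_prod_def prod_eq_iff)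
  moreover have "?s \<in> ?U"
    by (intro complex_vector.subspace_sum[OF U] complex_vector.subspace_scale[OF U] subsetD[OF E(1)])
  ultimately have "u \<in> ?U" by simp
  then show ?thesis using that by blast
qed

section \<open>Graph maps and their Hermitian forms\<close>

context
  fixes B C :: "('k \<times> 'k) set"
  assumes B: "lagrangian B" and C: "lagrangian C" and BC: "B \<inter> C = {0}"
begin

lemma graph_map_eq:
  assumes "w \<in> B" "u + w \<in> C" shows "graph_map A B C u = w"
  unfolding graph_map_def
proof (rule the_equality)
  fix w' assume w': "w' \<in> B \<and> u + w' \<in> C"
  have "w' - w \<in> B"
    using w' assms csubspace_diff[OF lagrangian_subspace[OF B]] by blast
  moreover have "w' - w \<in> C"
    using csubspace_diff[OF lagrangian_subspace[OF C], of "u + w'" "u + w"] w' assms by simp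
  ultimately have "w' - w \<in> B \<inter> C" ..
  then show "w' = w" unfolding BC by simp
qed (use assms in blast)

lemma graph_map_in: "graph_map A B C u \<in> B" (is ?in1)
  and graph_map_graph: "u + graph_map A B C u \<in> C" (is ?in2)
proof -
  obtain b c where bc: "b \<in> B" "c \<in> C" "u = b + c"
    by (rule lagrangian_sum_UNIV[OF B C BC])
  have "- b \<in> B" "u + - b \<in> C"
    using bc complex_vector.subspace_neg[OF lagrangian_subspace[OF B]] by auto
  then show ?in1 ?in2 using graph_map_eq[of "- b" u A] by auto
qed

lemma graph_map_linear: "clinear_on V (graph_map A B C)"
  unfolding clinear_on_def
proof (intro conjI ballI allI)
  have sB: "csubspace B" and sC: "csubspace C"
    using B C by (simp_all add: lagrangian_subspace)
  show "graph_map A B C (x + y) = graph_map A B C x + graph_map A B C y" for x y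
  proof (rule graph_map_eq)
    show "graph_map A B C x + graph_map A B C y \<in> B"
      by (intro complex_vector.subspace_add sB graph_map_in)
    show "x + y + (graph_map A B C x + graph_map A B C y) \<in> C"
      using complex_vector.subspace_add[OF sC graph_map_graph[of x] graph_map_graph[of y]]
      by (simp add: algebra_simps)
  qed
  show "graph_map A B C (c *\<^sub>C x) = c *\<^sub>C graph_map A B C x" for c x
  proof (rule graph_map_eq)
    show "c *\<^sub>C graph_map A B C x \<in> B"
      by (intro complex_vector.subspace_scale sB graph_map_in)
    show "c *\<^sub>C x + c *\<^sub>C graph_map A B C x \<in> C"
      using complex_vector.subspace_scale[OF sC graph_map_graph[of x], of c]
      by (simp add: scaleC_add_right)
  qed
qed

text \<open>Expanding the vanishing pairing of two graph vectors of \<open>C\<close>, the terms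
  inside \<open>A\<close> and inside \<open>B\<close> drop out by isotropy; the two cross terms that
  remain say that the form is symmetric.\<close>

lemma Qform_herm:
  assumes A: "lagrangian A" shows "herm_form A (Qform A B C)"
  unfolding herm_form_def
proof (intro conjI ballI allI)
  show "csubspace A" by (rule lagrangian_subspace[OF A])
  fix c u v assume m: "u \<in> A" "v \<in> A"
  show "Qform A B C u (c *\<^sub>C v) = c * Qform A B C u v"
    using clinear_on_scale[OF graph_map_linear, of v A A c] m
    by (simp add: Qform_def symp_scale_right)
next
  fix u v assume m: "u \<in> A" "v \<in> A"
  show "Qform A B C u v = cnj (Qform A B C v u)"
  proof -
    let ?g = "graph_map A B C"
    have "symp (u + ?g u) (v + ?g v) = 0"
      by (intro lagrangian_symp[OF C] graph_map_graph)
    moreover have "symp u v = 0" by (rule lagrangian_symp[OF A m])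
    moreover have "symp (?g u) (?g v) = 0" by (intro lagrangian_symp[OF B] graph_map_in)
    ultimately have "symp u (?g v) + symp (?g u) v = 0" by (simp add: symp_simps add.commute)
    then show ?thesis
      using symp_cnj[of "?g u" v] by (simp add: Qform_def eq_neg_iff_add_eq_0 add.commute)
  qed
next
  fix u v w assume "u \<in> A" "v \<in> A" "w \<in> A"
  then show "Qform A B C u (v + w) = Qform A B C u v + Qform A B C u w"
    using clinear_on_add[OF graph_map_linear, of v A w A]
    by (simp add: Qform_def symp_add_right)
qed

end

text \<open>Modulo \<open>F\<close> all three planes are identified; with \<open>a\<close>, \<open>b\<close> the forms of \<open>F\<close> over \<open>L1\<close>, \<open>L2\<close>
  along \<open>P\<close>, \<open>r\<close> the form of \<open>L2\<close> over \<open>L1\<close> along \<open>P\<close> and \<open>D\<close> the form of \<open>L2\<close> over \<open>L1\<close> along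
  \<open>F\<close>, the identity is \<open>b(z) + r(x) = D(y) + a(x + y)\<close> for \<open>y \<equiv> z - (x + w)\<close>, where
  \<open>x + w \<in> L2\<close>, \<open>w \<in> P\<close>. It is a two-fold completion of the square.\<close>

lemma neg_index_four_planes:
  fixes L1 L2 F P :: "('k \<times> 'k) set"
  assumes L1: "lagrangian L1" and L2: "lagrangian L2" and F: "lagrangian F" and P: "lagrangian P"
    and L1F: "L1 \<inter> F = {0}" and L2F: "L2 \<inter> F = {0}" and L1P: "L1 \<inter> P = {0}"
    and L2P: "L2 \<inter> P = {0}" and FP: "F \<inter> P = {0}"
  shows "neg_index L2 (Qform L2 P F) + neg_index L1 (Qform L1 P L2)
           = neg_index L1 (Qform L1 F L2) + neg_index L1 (Qform L1 P F)"
proof -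
  note PF = FP[unfolded Int_commute[of F]] and PL2 = L2P[unfolded Int_commute[of L2]]
    and FL1 = L1F[unfolded Int_commute[of L1]] and FL2 = L2F[unfolded Int_commute[of L2]]
  obtain T :: "('k \<times> 'k) set" where T: "finite T" "cspan T = UNIV"
    by (rule finite_span_prod_UNIV[OF dim])
  have sub: "X \<subseteq> cspan T" for X using T by simp
  have s1: "csubspace L1" and s2: "csubspace L2" and sF: "csubspace F" and sP: "csubspace P"
    using L1 L2 F P by (simp_all add: lagrangian_subspace)
  let ?w = "graph_map L1 P L2" and ?v = "graph_map L1 F L2" and ?s = "graph_map L2 P F"
    and ?t = "graph_map L1 P F" and ?p = "graph_map L2 F L1"
  \<comment> \<open>For \<open>u\<close> in L2 x L1: remove from the first component the lift of the
    second into L2 along P, then carry the rest to L1 along F. The second slot of \<open>f\<close>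
    is the vector x + y at which the form of F over L1 is to be evaluated.\<close>
  define z where "z u = fst u - (snd u + ?w (snd u))" for u
  define y where "y u = z u + ?p (z u)" for u
  define f where "f u = (y u, snd u + y u)" for u
  let ?h = "\<lambda>u v. Qform L2 P F (fst u) (fst v) + Qform L1 P L2 (snd u) (snd v)"
  let ?k = "\<lambda>u v. Qform L1 F L2 (fst u) (fst v) + Qform L1 P F (snd u) (snd v)"
  have linw: "clinear_on UNIV ?w" by (rule graph_map_linear[OF P L2 PL2])
  have linp: "clinear_on UNIV ?p" by (rule graph_map_linear[OF F L1 FL1])
  have zlin: "z (u + v) = z u + z v" "z (c *\<^sub>C u) = c *\<^sub>C z u" for u v c
    using clinear_on_add[OF linw, of "snd u" "snd v"] clinear_on_scale[OF linw, of "snd u" c]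
    by (simp_all add: z_def complex_vector.scale_right_distrib
        complex_vector.scale_right_diff_distrib)
  have ylin: "y (u + v) = y u + y v" "y (c *\<^sub>C u) = c *\<^sub>C y u" for u v c
    using clinear_on_add[OF linp, of "z u" "z v"] clinear_on_scale[OF linp, of "z u" c]
    by (simp_all add: y_def zlin complex_vector.scale_right_distrib)
  have lin: "clinear_on (L2 \<times> L1) f"
    unfolding clinear_on_def f_def by (simp add: ylin prod_eq_iff[where 'a = "'k \<times> 'k"] scaleC_add_right)
  have y1: "y u \<in> L1" for u
    unfolding y_def by (rule graph_map_graph[OF F L1 FL1])
  have "f ` (L2 \<times> L1) = L1 \<times> L1"
  proof (intro equalityI subsetI)
    fix u assume "u \<in> f ` (L2 \<times> L1)"
    then obtain u' where u': "u' \<in> L2 \<times> L1" "u = f u'" by (rule imageE) simp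
    then have "snd u' \<in> L1" by (rule_tac mem_Times_iff[THEN iffD1, THEN conjunct2])
    then show "u \<in> L1 \<times> L1"
      unfolding u'(2) f_def using y1 complex_vector.subspace_add[OF s1] by (simp add: mem_Times_iff)
  next
    fix u assume u: "u \<in> L1 \<times> L1"
    define x where "x = snd u - fst u"
    \<comment> \<open>Inverse of \<open>f\<close>: the lift of \<open>fst u\<close> into L2 along F
      projects back to \<open>fst u\<close>, and the lift of \<open>x\<close> along P undoes the
      subtraction in \<open>z\<close>.\<close>
    define z1 where "z1 = x + ?w x + (fst u + ?v (fst u))"
    have x: "x \<in> L1" unfolding x_def using u csubspace_diff[OF s1] by (simp add: mem_Times_iff)
    have "z1 \<in> L2"
      unfolding z1_def
      by (intro complex_vector.subspace_add s2 graph_map_graph[OF P L2 PL2] graph_map_graph[OF F L2 FL2])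
    have "?p (fst u + ?v (fst u)) = - ?v (fst u)"
      using u graph_map_in[OF F L2 FL2, of L1 "fst u"]
      by (intro graph_map_eq[OF F L1 FL1]) (auto intro: complex_vector.subspace_neg[OF sF])
    then have "y (z1, x) = fst u" by (simp add: y_def z_def z1_def)
    then have "f (z1, x) = u" by (simp add: f_def x_def prod_eq_iff)
    then show "u \<in> f ` (L2 \<times> L1)"
      using x \<open>z1 \<in> L2\<close> by (intro rev_image_eqI[of "(z1, x)"]) (simp_all add: mem_Times_iff)
  qed
  moreover have "inj_on f (L2 \<times> L1)"
  proof (rule clinear_on_inj[OF lin csubspace_Times[OF s2 s1]])
    fix u assume u: "u \<in> L2 \<times> L1" "f u = 0"
    then have "fst (f u) = 0" "snd (f u) = 0" by simp_all
    then have "y u = 0" "snd u = 0" by (simp_all add: f_def)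
    then have "fst u + ?p (fst u) = 0"
      using clinear_on_zero[OF linw] by (simp add: y_def z_def)
    then have "fst u = - ?p (fst u)" by (simp add: eq_neg_iff_add_eq_0)
    then have "fst u \<in> F"
      using complex_vector.subspace_neg[OF sF graph_map_in[OF F L1 FL1]] by metis
    moreover have "fst u \<in> L2" using u by (simp add: mem_Times_iff)
    ultimately have "fst u \<in> L2 \<inter> F" by blast
    then have "fst u = 0" unfolding L2F by simp
    then show "u = 0" using \<open>snd u = 0\<close> by (simp add: prod_eq_iff)
  qed
  moreover have "Re (?k (f u) (f u)) = Re (?h u u)" if u: "u \<in> L2 \<times> L1" for u
  proof -
    obtain z1 x where zx: "u = (z1, x)" "z1 \<in> L2" "x \<in> L1" using u by (rule SigmaE) simp
    define yy where "yy = y u"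
    define w where "w = ?w x"
    define v where "v = ?v yy"
    define s where "s = ?s (x + w)"
    define t where "t = ?t yy"
    have m: "x \<in> L1" "yy \<in> L1" "w \<in> P" "x + w \<in> L2" "v \<in> F" "yy + v \<in> L2" "s \<in> P" "x + w + s \<in> F"
      "t \<in> P" "yy + t \<in> F"
      unfolding w_def v_def s_def t_def yy_def using zx y1
      by (auto intro: graph_map_in[OF P L2 PL2] graph_map_graph[OF P L2 PL2]
          graph_map_in[OF F L2 FL2] graph_map_graph[OF F L2 FL2]
          graph_map_in[OF P F PF] graph_map_graph[OF P F PF])
    have z1: "z1 = x + w + (yy + v)"
    proof -
      let ?z = "z1 - (x + w)"
      have "?z \<in> L2" using zx m csubspace_diff[OF s2] by blast
      have "yy = ?z + ?p ?z" by (simp add: yy_def y_def z_def zx w_def)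
      moreover from this have "?v yy = - ?p ?z"
        using \<open>?z \<in> L2\<close> graph_map_in[OF F L1 FL1, of L2 ?z]
        by (intro graph_map_eq[OF F L2 FL2]) (auto intro: complex_vector.subspace_neg[OF sF])
      ultimately show ?thesis by (simp add: v_def)
    qed
    have sz: "?s z1 = s + t"
      using complex_vector.subspace_add[OF sF complex_vector.subspace_add[OF sF m(8) m(10)] m(5)]
        complex_vector.subspace_add[OF sP m(7,9)]
      by (intro graph_map_eq[OF P F PF]) (simp_all add: z1 algebra_simps)
    have tz: "?t (x + yy) = w + s + t"
      using complex_vector.subspace_add[OF sF m(8) m(10)]
        complex_vector.subspace_add[OF sP complex_vector.subspace_add[OF sP m(3,7)] m(9)]
      by (intro graph_map_eq[OF P F PF]) (simp_all add: algebra_simps)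
    \<comment> \<open>The real part of the symplectic form is antisymmetric, so the identity reduces
      to bilinear bookkeeping with the isotropy relations of P, F, L1 and L2.\<close>
    define W where "W a b = Re (symp a b)" for a b :: "'k \<times> 'k"
    have Oa: "W a b = - W b a" for a b
      unfolding W_def using symp_cnj[of a b] by simp
    have Op: "W (a + b) c = W a c + W b c" "W c (a + b) = W c a + W c b" for a b c
      unfolding W_def by (simp_all add: symp_simps)
    have "W w s = 0" "W w t = 0" "W v (x + w + s) = 0" "W v (yy + t) = 0" "W (x + w) (yy + v) = 0"
      "W x yy = 0"
      unfolding W_def using m lagrangian_symp[OF P] lagrangian_symp[OF F] lagrangian_symp[OF L1]
        lagrangian_symp[OF L2] by simp_all
    then have "W yy v + W (x + yy) (w + s + t) = W (x + w + (yy + v)) (s + t) + W x w"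
      using Oa[of v x] Oa[of v w] Oa[of v yy] Oa[of w yy] by (simp add: Op)
    moreover have "?k (f u) (f u) = symp yy v + symp (x + yy) (w + s + t)"
      by (simp only: f_def zx(1) yy_def[symmetric, unfolded zx(1)] fst_conv snd_conv Qform_def tz v_def)
    moreover have "?h u u = symp z1 (s + t) + symp x w"
      by (simp only: zx(1) fst_conv snd_conv Qform_def sz w_def)
    ultimately show ?thesis by (simp add: W_def z1)
  qed
  ultimately have "neg_index (L1 \<times> L1) ?k = neg_index (L2 \<times> L1) ?h"
    using lin finite_span_Times[OF sub sub, of L2 L1] T(1)
    by (intro neg_index_transport[where f = f and T = "(\<lambda>x. (x, 0)) ` T \<union> (\<lambda>x. (0, x)) ` T"])
      (auto intro: csubspace_Times s1 s2)
  then show ?thesis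
    using neg_index_Times[OF Qform_herm[OF P F PF L2] T(1) sub Qform_herm[OF P L2 PL2 L1] T(1) sub]
      neg_index_Times[OF Qform_herm[OF F L2 FL2 L1] T(1) sub Qform_herm[OF P F PF L1] T(1) sub]
    by simp
qed

text \<open>The four-plane identity cancels the chosen plane. Existence of some admissible plane is
  assumed because the choice operator says nothing otherwise.\<close>

lemma duistermaat_eq_neg_index:
  fixes L1 L2 F :: "('k \<times> 'k) set"
  assumes "lagrangian L1" "lagrangian L2" "lagrangian F" "transversal L1 F" "transversal L2 F"
    and "\<exists>P. lagrangian P \<and> transversal L1 P \<and> transversal L2 P \<and> transversal F P"
  shows "duistermaat L1 L2 F = int (neg_index L1 (Qform L1 F L2))"
proof -
  define P where
    "P = (SOME P. lagrangian P \<and> transversal L1 P \<and> transversal L2 P \<and> transversal F P)"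
  have "lagrangian P \<and> transversal L1 P \<and> transversal L2 P \<and> transversal F P"
    unfolding P_def by (rule someI_ex[OF assms(6)])
  then show ?thesis
    using neg_index_four_planes[of L1 L2 F P] assms
    unfolding duistermaat_def transversal_def Let_def P_def by linarith
qed

end

text \<open>The number \<open>n\<close> of pairs is kept apart from the dimension
  \<open>dimK\<close>: the basis constructed later has the size of an orthonormal set, which is
  compared with the dimension only afterwards.\<close>

locale symplectic_basis =
  fixes dimK n :: nat and m f :: "nat \<Rightarrow> 'k::chilbert \<times> 'k"
  assumes dim: "has_cdim (UNIV :: 'k set) dimK"
    and symp_m_m: "i < n \<Longrightarrow> j < n \<Longrightarrow> symp (m i) (m j) = 0"
    and symp_f_f: "i < n \<Longrightarrow> j < n \<Longrightarrow> symp (f i) (f j) = 0"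
    and symp_m_f: "i < n \<Longrightarrow> j < n \<Longrightarrow> symp (m i) (f j) = (if i = j then 1 else 0)"
    and expansion: "u = (\<Sum>i<n. - symp (f i) u *\<^sub>C m i + symp (m i) u *\<^sub>C f i)"
begin

text \<open>Coordinate along \<open>m i\<close>; the sign compensates for
  \<open>symp (f i) (m i) = - 1\<close>.\<close>

definition X :: "nat \<Rightarrow> 'k \<times> 'k \<Rightarrow> complex" where "X i u = - symp (f i) u"

definition Y :: "nat \<Rightarrow> 'k \<times> 'k \<Rightarrow> complex" where "Y i u = symp (m i) u"

definition diagonal_plane :: "(nat \<Rightarrow> real) \<Rightarrow> ('k \<times> 'k) set" where
  "diagonal_plane d = {u. \<forall>i<n. Y i u = complex_of_real (d i) * X i u}"

definition vertical_plane :: "('k \<times> 'k) set" where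
  "vertical_plane = {u. \<forall>i<n. X i u = 0}"

lemma XY_linear:
  "X i (u + v) = X i u + X i v" "X i (c *\<^sub>C u) = c * X i u" "X i 0 = 0"
  "X i (u - v) = X i u - X i v"
  "Y i (u + v) = Y i u + Y i v" "Y i (c *\<^sub>C u) = c * Y i u" "Y i 0 = 0"
  "Y i (u - v) = Y i u - Y i v"
  by (simp_all add: X_def Y_def symp_simps)

lemma X_sum: "X i (\<Sum>j\<in>J. c j *\<^sub>C v j) = (\<Sum>j\<in>J. c j * X i (v j))"
  by (simp add: X_def symp_sum_right sum_negf)

lemma Y_sum: "Y i (\<Sum>j\<in>J. c j *\<^sub>C v j) = (\<Sum>j\<in>J. c j * Y i (v j))"
  by (simp add: Y_def symp_sum_right)

lemma symp_f_m: "i < n \<Longrightarrow> j < n \<Longrightarrow> symp (f i) (m j) = (if i = j then - 1 else 0)"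
  using symp_cnj[of "f i" "m j"] symp_m_f[of j i] by auto

lemma XY_basis:
  assumes "i < n" "j < n"
  shows "X i (m j) = (if i = j then 1 else 0)" "X i (f j) = 0"
    "Y i (m j) = 0" "Y i (f j) = (if i = j then 1 else 0)"
  using assms by (auto simp: X_def Y_def symp_f_m symp_m_m symp_f_f symp_m_f)

lemma XY_expansion: "u = (\<Sum>i<n. X i u *\<^sub>C m i) + (\<Sum>i<n. Y i u *\<^sub>C f i)"
  unfolding X_def Y_def sum.distrib[symmetric] by (rule expansion)

lemma XY_eqI:
  assumes "\<And>i. i < n \<Longrightarrow> X i u = X i v" "\<And>i. i < n \<Longrightarrow> Y i u = Y i v"
  shows "u = v"
proof -
  have "u = (\<Sum>i<n. X i u *\<^sub>C m i) + (\<Sum>i<n. Y i u *\<^sub>C f i)" by (rule XY_expansion)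
  also have "\<dots> = (\<Sum>i<n. X i v *\<^sub>C m i) + (\<Sum>i<n. Y i v *\<^sub>C f i)" using assms by simp
  also have "\<dots> = v" by (rule XY_expansion[symmetric])
  finally show ?thesis .
qed

lemma symp_coordinates: "symp u v = (\<Sum>i<n. cnj (X i u) * Y i v - cnj (Y i u) * X i v)"
proof -
  have "symp u v = symp ((\<Sum>i<n. X i u *\<^sub>C m i) + (\<Sum>i<n. Y i u *\<^sub>C f i)) v"
    by (rule arg_cong[where f = "\<lambda>x. symp x v"]) (rule XY_expansion)
  also have "\<dots> = (\<Sum>i<n. cnj (X i u) * Y i v) + (\<Sum>i<n. cnj (Y i u) * - X i v)"
    by (simp only: symp_add_left symp_sum_left X_def Y_def minus_minus)
  also have "\<dots> = (\<Sum>i<n. cnj (X i u) * Y i v - cnj (Y i u) * X i v)"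
    by (simp add: sum_subtractf sum_negf)
  finally show ?thesis .
qed

lemma csubspace_planes: "csubspace (diagonal_plane d)" "csubspace vertical_plane"
  unfolding complex_vector.subspace_def diagonal_plane_def vertical_plane_def
  by (auto simp: XY_linear algebra_simps)

text \<open>Real slopes make the summands of \<open>symp_coordinates\<close> cancel. For maximality,
  pairing with \<open>m j + d j f j\<close> alone returns the j-th slope equation.\<close>

lemma lagrangian_diagonal: "lagrangian (diagonal_plane d)"
proof (rule lagrangianI)
  show "csubspace (diagonal_plane d)" by (rule csubspace_planes)
  show "symp u v = 0" if "u \<in> diagonal_plane d" "v \<in> diagonal_plane d" for u v
    using that by (simp add: symp_coordinates diagonal_plane_def)
  show "u \<in> diagonal_plane d" if u: "\<And>v. v \<in> diagonal_plane d \<Longrightarrow> symp u v = 0" for u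
    unfolding diagonal_plane_def
  proof (intro CollectI allI impI)
    fix j assume j: "j < n"
    let ?v = "m j + complex_of_real (d j) *\<^sub>C f j"
    have "?v \<in> diagonal_plane d"
      using j by (simp add: diagonal_plane_def XY_linear XY_basis)
    then have "symp u ?v = 0" by (rule u)
    then have "symp ?v u = 0" using symp_eq_0_commute by blast
    then show "Y j u = complex_of_real (d j) * X j u"
      by (simp add: symp_simps X_def Y_def add_eq_0_iff2)
  qed
qed

lemma lagrangian_vertical: "lagrangian vertical_plane"
proof (rule lagrangianI)
  show "csubspace vertical_plane" by (rule csubspace_planes)
  show "symp u v = 0" if "u \<in> vertical_plane" "v \<in> vertical_plane" for u v
    using that by (simp add: symp_coordinates vertical_plane_def)
  show "u \<in> vertical_plane" if u: "\<And>v. v \<in> vertical_plane \<Longrightarrow> symp u v = 0" for u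
    unfolding vertical_plane_def
  proof (intro CollectI allI impI)
    fix j assume j: "j < n"
    then have "f j \<in> vertical_plane" by (simp add: vertical_plane_def XY_basis)
    then have "symp u (f j) = 0" by (rule u)
    then show "X j u = 0" using symp_eq_0_commute[of u "f j"] by (simp add: X_def)
  qed
qed

lemma transversal_vertical: "transversal (diagonal_plane d) vertical_plane"
  unfolding transversal_def
proof (intro equalityI subsetI)
  fix u assume "u \<in> diagonal_plane d \<inter> vertical_plane"
  then show "u \<in> {0}"
    by (auto simp: diagonal_plane_def vertical_plane_def XY_linear intro: XY_eqI)
qed (simp add: complex_vector.subspace_0[OF csubspace_planes(1)]
    complex_vector.subspace_0[OF csubspace_planes(2)])

lemma transversal_diagonal:
  assumes "\<And>i. i < n \<Longrightarrow> d i \<noteq> e i"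
  shows "transversal (diagonal_plane d) (diagonal_plane e)"
  unfolding transversal_def
proof (intro equalityI subsetI)
  fix u assume u: "u \<in> diagonal_plane d \<inter> diagonal_plane e"
  have "X i u = 0" if "i < n" for i
  proof -
    have "Y i u = complex_of_real (d i) * X i u" "Y i u = complex_of_real (e i) * X i u"
      using u that by (auto simp: diagonal_plane_def)
    then show ?thesis using assms[OF that] by simp
  qed
  moreover from this have "Y i u = 0" if "i < n" for i
    using u that by (simp add: diagonal_plane_def)
  ultimately have "u = 0" by (intro XY_eqI) (simp_all add: XY_linear)
  then show "u \<in> {0}" by simp
qed (simp add: complex_vector.subspace_0[OF csubspace_planes(1)])

text \<open>Moving vertically from slope \<open>d i\<close> to slope \<open>e i\<close> adds
  \<open>(e i - d i) * X i u\<close> in the direction \<open>f i\<close>, so in the coordinates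
  \<open>X\<close> the form is diagonal with entries \<open>e i - d i\<close>.\<close>

lemma neg_index_diagonal:
  "neg_index (diagonal_plane d) (Qform (diagonal_plane d) vertical_plane (diagonal_plane e))
     = card {i. i < n \<and> e i < d i}"
proof -
  let ?A = "diagonal_plane d" and ?V = vertical_plane and ?C = "diagonal_plane e"
  let ?q = "Qform ?A ?V ?C"
  have VC: "?V \<inter> ?C = {0}" using transversal_vertical[of e] by (simp add: transversal_def Int_commute)
  have g: "graph_map ?A ?V ?C u = (\<Sum>i<n. (complex_of_real (e i - d i) * X i u) *\<^sub>C f i)"
    if u: "u \<in> ?A" for u
  proof (rule graph_map_eq[OF dim lagrangian_vertical lagrangian_diagonal VC])
    define w where "w = (\<Sum>i<n. (complex_of_real (e i - d i) * X i u) *\<^sub>C f i)"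
    have Xw: "X i w = 0" if "i < n" for i
      unfolding w_def X_sum using that by (auto simp: XY_basis intro!: sum.neutral)
    have Yw: "Y i w = complex_of_real (e i - d i) * X i u" if i: "i < n" for i
    proof -
      have "Y i w = (\<Sum>j<n. if j = i then complex_of_real (e i - d i) * X i u else 0)"
        unfolding w_def Y_sum using i by (intro sum.cong) (auto simp: XY_basis)
      then show ?thesis using i by simp
    qed
    have "w \<in> ?V" using Xw by (simp add: vertical_plane_def)
    then show "(\<Sum>i<n. (complex_of_real (e i - d i) * X i u) *\<^sub>C f i) \<in> ?V" by (simp only: w_def)
    have "u + w \<in> ?C"
      using u by (simp add: diagonal_plane_def XY_linear Xw Yw algebra_simps)
    then show "u + (\<Sum>i<n. (complex_of_real (e i - d i) * X i u) *\<^sub>C f i) \<in> ?C" by (simp only: w_def)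
  qed
  have q: "?q u v = (\<Sum>i<n. cnj (X i u) * complex_of_real (e i - d i) * X i v)"
    if "u \<in> ?A" "v \<in> ?A" for u v
  proof -
    have "?q u v = (\<Sum>i<n. (complex_of_real (e i - d i) * X i v) * symp u (f i))"
      by (simp only: Qform_def g[OF that(2)] symp_sum_right)
    also have "\<dots> = (\<Sum>i<n. cnj (X i u) * complex_of_real (e i - d i) * X i v)"
      by (intro sum.cong) (auto simp: symp_cnj[of u] X_def)
    finally show ?thesis .
  qed
  let ?I = "{i. i < n \<and> e i < d i}"
  \<comment> \<open>The factor normalises the value of the form on \<open>b i\<close> to -1 for
    indices in \<open>?I\<close>; only these enter the orthonormal set.\<close>
  define b where "b i = complex_of_real (1 / sqrt (d i - e i)) *\<^sub>C (m i + complex_of_real (d i) *\<^sub>C f i)" for i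
  have Xb: "X i (b j) = (if i = j then complex_of_real (1 / sqrt (d j - e j)) else 0)"
    if "i < n" "j < n" for i j
    using that by (simp add: b_def XY_linear XY_basis)
  have bA: "b i \<in> ?A" if "i < n" for i
    using that by (simp add: b_def diagonal_plane_def XY_linear XY_basis)
  have qb: "?q (b i) v = complex_of_real (- sqrt (d i - e i)) * X i v"
    if i: "i \<in> ?I" and v: "v \<in> ?A" for i v
  proof -
    have in_n: "i < n" using i by simp
    have "?q (b i) v = (\<Sum>j<n. if j = i then cnj (X i (b i)) * complex_of_real (e i - d i) * X i v else 0)"
      unfolding q[OF bA[OF in_n] v] by (rule sum.cong) (use in_n in \<open>auto simp: Xb\<close>)
    also have "\<dots> = complex_of_real (1 / sqrt (d i - e i) * (e i - d i)) * X i v"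
      using in_n by (simp add: Xb)
    also have "1 / sqrt (d i - e i) * (e i - d i) = - ((d i - e i) / sqrt (d i - e i))"
      by (simp add: diff_divide_distrib)
    also have "\<dots> = - sqrt (d i - e i)"
      using i real_div_sqrt[of "d i - e i"] by simp
    finally show ?thesis .
  qed
  have qbb: "- ?q (b i) (b j) = (if i = j then 1 else 0)" if "i \<in> ?I" "j \<in> ?I" for i j
  proof -
    have "sqrt (d j - e j) \<noteq> 0" using that by simp
    then show ?thesis using that by (simp add: qb bA Xb flip: of_real_mult)
  qed
  have inj: "inj_on b ?I"
  proof (rule inj_onI, rule ccontr)
    fix i j assume "i \<in> ?I" "j \<in> ?I" "b i = b j" "i \<noteq> j"
    then show False using qbb[of i i] qbb[of i j] by simp
  qed
  obtain T :: "('k \<times> 'k) set" where T: "finite T" "cspan T = UNIV"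
    by (rule finite_span_prod_UNIV[OF dim])
  have "neg_index ?A ?q = card (b ` ?I)"
  proof (rule neg_index_eq_card)
    show "herm_form ?A ?q"
      by (rule Qform_herm[OF dim lagrangian_vertical lagrangian_diagonal VC lagrangian_diagonal])
    show "finite T" "?A \<subseteq> cspan T" using T by auto
    show "b ` ?I \<subseteq> ?A" using bA by auto
    show "orthonormal_set (\<lambda>u v. - ?q u v) (b ` ?I)"
      unfolding orthonormal_set_def using qbb inj by (auto simp: inj_on_def)
    show "0 \<le> Re (?q v v)" if v: "v \<in> ?A" "\<forall>u\<in>b ` ?I. ?q u v = 0" for v
    proof -
      have X0: "X i v = 0" if "i \<in> ?I" for i
        using qb[OF that v(1)] v(2) that by auto
      have "0 \<le> Re (cnj (X i v) * complex_of_real (e i - d i) * X i v)" if "i < n" for i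
      proof (cases "i \<in> ?I")
        case False
        then have "0 \<le> e i - d i" using that by simp
        moreover have "cnj (X i v) * complex_of_real (e i - d i) * X i v
            = complex_of_real ((e i - d i) * (cmod (X i v))\<^sup>2)"
          by (simp only: of_real_mult complex_norm_square mult_ac)
        ultimately show ?thesis by (simp only: Re_complex_of_real) simp
      qed (simp add: X0)
      then show ?thesis unfolding q[OF v(1) v(1)] Re_sum by (intro sum_nonneg) simp
    qed
  qed
  then show ?thesis using card_image[OF inj] by simp
qed

lemma duistermaat_diagonal:
  "duistermaat (diagonal_plane d) (diagonal_plane e) vertical_plane = int (card {i. i < n \<and> e i < d i})"
proof -
  \<comment> \<open>Slopes exceeding all \<open>d i\<close> and \<open>e i\<close>: this plane is
    transversal to both diagonal planes and, being diagonal, to the vertical one.\<close>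
  let ?P = "diagonal_plane (\<lambda>i. \<bar>d i\<bar> + \<bar>e i\<bar> + 1)"
  have "transversal vertical_plane ?P"
    using transversal_vertical by (simp add: transversal_def Int_commute)
  moreover have "transversal (diagonal_plane d) ?P" "transversal (diagonal_plane e) ?P"
    by (intro transversal_diagonal; linarith)+
  ultimately show ?thesis
    using duistermaat_eq_neg_index[OF dim lagrangian_diagonal lagrangian_diagonal lagrangian_vertical
        transversal_vertical transversal_vertical, of d e] lagrangian_diagonal neg_index_diagonal
    by auto
qed

end

section \<open>The variational principle\<close>

text \<open>Here \<open>Z\<close> will be a squared modulus of the form. The choice t = 1/B is
  optimal; for B = 0, which occurs for degenerate forms, the expression is affine in t and can stay
  nonnegative only if Z = 0.\<close>

lemma nonneg_quadratic_bound:
  fixes A B Z :: real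
  assumes "\<And>t. 0 \<le> A - 2 * t * Z + t\<^sup>2 * Z * B" "0 \<le> Z" "0 \<le> B"
  shows "Z \<le> A * B"
proof (cases "B = 0")
  case True
  have "Z = 0"
  proof (rule ccontr)
    assume "Z \<noteq> 0"
    then show False using assms(1)[of "(A + 1) / (2 * Z)"] True by simp
  qed
  then show ?thesis using True by simp
next
  case False
  then have "B > 0" using assms(3) by simp
  then have "0 \<le> A - Z / B" using assms(1)[of "1 / B"] by (simp add: power2_eq_square)
  then show ?thesis using \<open>B > 0\<close> by (simp add: field_simps)
qed

lemma herm_form_Cauchy_Schwarz:
  assumes q: "herm_form V q" and pos: "\<And>v. v \<in> V \<Longrightarrow> 0 \<le> Re (q v v)" and u: "u \<in> V" and v: "v \<in> V"
  shows "(cmod (q u v))\<^sup>2 \<le> Re (q u u) * Re (q v v)"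
proof (rule nonneg_quadratic_bound)
  fix t :: real
  \<comment> \<open>The conjugate aligns phases: both cross terms become the real number
    \<open>- t * (cmod (q u v))\<^sup>2\<close>.\<close>
  define a where "a = - complex_of_real t * cnj (q u v)"
  have Re_mult: "Re (complex_of_real r * z) = r * Re z" for r z by simp
  have V: "csubspace V" by (rule herm_form_subspace[OF q])
  have av: "a *\<^sub>C v \<in> V" by (rule complex_vector.subspace_scale[OF V v])
  have uav: "u + a *\<^sub>C v \<in> V" by (rule complex_vector.subspace_add[OF V u av])
  have vu: "q v u = cnj (q u v)" by (rule herm_form_cnj[OF q v u])
  have "q (u + a *\<^sub>C v) (u + a *\<^sub>C v) = q u u + a * q u v + cnj a * q v u + a * cnj a * q v v"
    using u v av uav
    by (simp add: herm_form_add_left[OF q] herm_form_add_right[OF q] herm_form_scale_left[OF q]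
        herm_form_scale_right[OF q] algebra_simps)
  also have "\<dots> = q u u - complex_of_real (2 * t * (cmod (q u v))\<^sup>2)
      + complex_of_real (t\<^sup>2 * (cmod (q u v))\<^sup>2) * q v v"
    by (simp only: a_def vu of_real_mult complex_norm_square of_real_numeral
        complex_cnj_mult complex_cnj_minus complex_cnj_complex_of_real complex_cnj_cnj)
      (simp add: algebra_simps power2_eq_square)
  finally have "Re (q (u + a *\<^sub>C v) (u + a *\<^sub>C v))
      = Re (q u u) - 2 * t * (cmod (q u v))\<^sup>2 + t\<^sup>2 * (cmod (q u v))\<^sup>2 * Re (q v v)"
    by (simp only: plus_complex.sel minus_complex.sel Re_complex_of_real Re_mult)
  then show "0 \<le> Re (q u u) - 2 * t * (cmod (q u v))\<^sup>2 + t\<^sup>2 * (cmod (q u v))\<^sup>2 * Re (q v v)"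
    using pos[OF uav] by simp
qed (use pos v in auto)

lemma cinner_Cauchy_Schwarz: "cmod (cinner x y) \<le> norm x * norm y" for x y :: "'a::chilbert"
proof -
  have "(cmod (cinner x y))\<^sup>2 \<le> Re (cinner x x) * Re (cinner y y)"
    by (rule herm_form_Cauchy_Schwarz[OF herm_form_cinner[OF complex_vector.subspace_UNIV]])
      (auto simp: Re_cinner_self)
  then show ?thesis
    by (metis Re_cinner_self power_mult_distrib power2_le_imp_le norm_ge_zero mult_nonneg_nonneg)
qed

lemma bounded_bilinear_cinner: "bounded_bilinear (cinner :: 'a::chilbert \<Rightarrow> 'a \<Rightarrow> complex)"
proof
  show "\<exists>K. \<forall>a b. norm (cinner a b :: complex) \<le> norm (a::'a) * norm b * K"
    by (intro exI[of _ 1]) (simp add: cinner_Cauchy_Schwarz)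
qed (simp_all add: cinner_simps scaleR_eq_scaleC scaleC_complex_def)

lemmas tendsto_cinner = bounded_bilinear.tendsto[OF bounded_bilinear_cinner]

text \<open>Minimising \<open>B v v - 2 l v\<close>: a minimising sequence is Cauchy for \<open>B\<close> by the parallelogram law.\<close>

lemma variational_principle:
  fixes V :: "'a::real_vector set" and B :: "'a \<Rightarrow> 'a \<Rightarrow> real" and l :: "'a \<Rightarrow> real"
  assumes V: "subspace V"
    and B_add: "\<And>u v w. u \<in> V \<Longrightarrow> v \<in> V \<Longrightarrow> w \<in> V \<Longrightarrow> B u (v + w) = B u v + B u w"
    and B_scale: "\<And>r u v. u \<in> V \<Longrightarrow> v \<in> V \<Longrightarrow> B u (r *\<^sub>R v) = r * B u v"
    and B_commute: "\<And>u v. u \<in> V \<Longrightarrow> v \<in> V \<Longrightarrow> B u v = B v u"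
    and B_nonneg: "\<And>v. v \<in> V \<Longrightarrow> 0 \<le> B v v"
    and l_add: "\<And>u v. u \<in> V \<Longrightarrow> v \<in> V \<Longrightarrow> l (u + v) = l u + l v"
    and l_scale: "\<And>r v. v \<in> V \<Longrightarrow> l (r *\<^sub>R v) = r * l v"
    and C: "0 \<le> C" and l_bound: "\<And>v. v \<in> V \<Longrightarrow> (l v)\<^sup>2 \<le> C * B v v"
  obtains v :: "nat \<Rightarrow> 'a" where "\<And>n. v n \<in> V"
    "\<And>e. 0 < e \<Longrightarrow> \<exists>N. \<forall>m\<ge>N. \<forall>n\<ge>N. B (v m - v n) (v m - v n) < e"
    "\<And>w. w \<in> V \<Longrightarrow> (\<lambda>n. B w (v n)) \<longlonglongrightarrow> l w"
proof -
  define J where "J v = B v v - 2 * l v" for v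
  note sub = subspace_add[OF V] subspace_scale[OF V]
  have quad: "B (r *\<^sub>R u + s *\<^sub>R v) (r *\<^sub>R u + s *\<^sub>R v) = r * r * B u u + 2 * r * s * B u v + s * s * B v v"
    if u: "u \<in> V" and v: "v \<in> V" for r s u v
  proof -
    have m: "r *\<^sub>R u \<in> V" "s *\<^sub>R v \<in> V" "r *\<^sub>R u + s *\<^sub>R v \<in> V" using u v sub by auto
    have "B (r *\<^sub>R u + s *\<^sub>R v) x = r * B u x + s * B v x" if x: "x \<in> V" for x
      using B_commute[OF m(3) x] B_add[OF x m(1,2)] B_scale[OF x u] B_scale[OF x v]
        B_commute[OF x u] B_commute[OF x v] by simp
    then have "B (r *\<^sub>R u + s *\<^sub>R v) (r *\<^sub>R u + s *\<^sub>R v)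
        = r * B u (r *\<^sub>R u + s *\<^sub>R v) + s * B v (r *\<^sub>R u + s *\<^sub>R v)" using m(3) by blast
    also have "\<dots> = r * (r * B u u + s * B u v) + s * (r * B v u + s * B v v)"
      using B_add[OF u m(1,2)] B_add[OF v m(1,2)] B_scale[OF u u] B_scale[OF u v] B_scale[OF v u]
        B_scale[OF v v] by simp
    finally show ?thesis using B_commute[OF v u] by (simp add: algebra_simps)
  qed
  have lin: "l (r *\<^sub>R u + s *\<^sub>R v) = r * l u + s * l v" if "u \<in> V" "v \<in> V" for r s u v
    using that sub by (simp add: l_add l_scale)
  have J_lower: "- C \<le> J v" if v: "v \<in> V" for v
  proof -
    have "(2 * l v)\<^sup>2 \<le> 4 * (C * B v v)" using l_bound[OF v] by (simp add: power2_eq_square)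
    also have "\<dots> \<le> (B v v + C)\<^sup>2"
      using zero_le_power2[of "B v v - C"] by (simp add: power2_eq_square algebra_simps)
    finally have *: "(2 * l v)\<^sup>2 \<le> (B v v + C)\<^sup>2" .
    have "0 \<le> B v v + C" using B_nonneg[OF v] C by simp
    then have "2 * l v \<le> B v v + C" by (rule power2_le_imp_le[OF *])
    then show ?thesis by (simp add: J_def)
  qed
  define i where "i = Inf (J ` V)"
  have V0: "0 \<in> V" by (rule subspace_0[OF V])
  have bdd: "bdd_below (J ` V)" using J_lower by (intro bdd_belowI2)
  have i_le: "i \<le> J v" if "v \<in> V" for v
    unfolding i_def using bdd that by (intro cInf_lower) auto
  have "\<exists>v\<in>V. J v < i + 1 / real (Suc n)" for n
  proof -
    have "i < i + 1 / real (Suc n)" by simp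
    then show ?thesis unfolding i_def using cInf_lessD[of "J ` V"] V0 by blast
  qed
  then obtain v where v: "\<And>n. v n \<in> V" "\<And>n. J (v n) < i + 1 / real (Suc n)" by metis
  show ?thesis
  proof (rule that)
    show "v n \<in> V" for n by (rule v)
    fix e :: real assume e: "0 < e"
    obtain N where N: "1 / real (Suc N) < e / 4" using e nat_approx_posE[of "e / 4"] by auto
    have "B (v m - v n) (v m - v n) < e" if mn: "m \<ge> N" "n \<ge> N" for m n
    proof -
      have "1 / real (Suc m) \<le> 1 / real (Suc N)" "1 / real (Suc n) \<le> 1 / real (Suc N)"
        using mn by (auto simp: divide_simps)
      then have J: "J (v m) < i + e / 4" "J (v n) < i + e / 4" using v(2)[of m] v(2)[of n] N by linarith+
      have "i \<le> J ((1/2) *\<^sub>R v m + (1/2) *\<^sub>R v n)" by (intro i_le sub v)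
      then have "4 * i \<le> B (v m) (v m) + 2 * B (v m) (v n) + B (v n) (v n) - 4 * (l (v m) + l (v n))"
        by (simp add: J_def quad[OF v(1) v(1)] lin[OF v(1) v(1)])
      moreover have "B (v m - v n) (v m - v n) = B (v m) (v m) - 2 * B (v m) (v n) + B (v n) (v n)"
        using quad[OF v(1) v(1), of 1 m "-1" n] by simp
      ultimately show ?thesis using J by (simp add: J_def)
    qed
    then show "\<exists>N. \<forall>m\<ge>N. \<forall>n\<ge>N. B (v m - v n) (v m - v n) < e" by blast
  next
    fix w assume w: "w \<in> V"
    define d where "d n = B w (v n) - l w" for n
    have bound: "(d n)\<^sup>2 \<le> (B w w + 1) * (1 / real (Suc n))" for n
    proof -
      \<comment> \<open>Nearly the minimiser of \<open>J\<close> on the line through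
        \<open>v n\<close> in direction \<open>w\<close>. The added 1 avoids division by zero when
        \<open>B w w\<close> vanishes.\<close>
      define t where "t = - d n / (B w w + 1)"
      have b: "0 < B w w + 1" using B_nonneg[OF w] by simp
      then have dt: "d n = - t * (B w w + 1)" by (simp add: t_def)
      have dt': "(d n)\<^sup>2 / (B w w + 1) = t\<^sup>2 * (B w w + 1)"
        using b unfolding dt by (simp add: power2_eq_square)
      have "i \<le> J (1 *\<^sub>R v n + t *\<^sub>R w)" by (intro i_le sub v w)
      then have "i \<le> J (v n) + 2 * t * d n + t\<^sup>2 * B w w"
        using quad[OF v(1) w, of 1 n t] lin[OF v(1) w, of 1 n t] B_commute[OF w v(1), of n]
        by (simp add: J_def d_def algebra_simps power2_eq_square)
      also have "t\<^sup>2 * B w w \<le> t\<^sup>2 * (B w w + 1)" by (simp add: mult_left_mono)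
      also have "J (v n) + 2 * t * d n + t\<^sup>2 * (B w w + 1) = J (v n) - (d n)\<^sup>2 / (B w w + 1)"
        unfolding dt' unfolding dt by (simp add: algebra_simps power2_eq_square)
      finally have "(d n)\<^sup>2 / (B w w + 1) \<le> 1 / real (Suc n)" using v(2)[of n] by linarith
      then show ?thesis using b by (simp add: pos_divide_le_eq mult.commute)
    qed
    have "(\<lambda>n. (d n)\<^sup>2) \<longlonglongrightarrow> 0"
    proof (rule tendsto_sandwich[of "\<lambda>_. 0" _ _ "\<lambda>n. (B w w + 1) * (1 / real (Suc n))"])
      show "(\<lambda>n. (B w w + 1) * (1 / real (Suc n))) \<longlonglongrightarrow> 0"
        using tendsto_mult_right_zero[OF LIMSEQ_Suc[OF lim_1_over_n]] by simp
    qed (use bound in \<open>auto intro: always_eventually\<close>)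
    then have "d \<longlonglongrightarrow> 0"
      using tendsto_real_sqrt[of "\<lambda>n. (d n)\<^sup>2" 0] by (simp add: tendsto_rabs_zero_iff)
    then show "(\<lambda>n. B w (v n)) \<longlonglongrightarrow> l w"
      unfolding d_def by (rule LIM_zero_cancel)
  qed
qed

lemma csubspace_imp_subspace: "csubspace V \<Longrightarrow> subspace V"
  by (simp add: subspace_def complex_vector.subspace_0 complex_vector.subspace_add
      complex_vector.subspace_scale scaleR_eq_scaleC)

lemma complex_of_Re_multiples:
  "complex_of_real (Re z) - \<i> * complex_of_real (Re (\<i> * z)) = z"
  by (simp add: complex_eq_iff)

text \<open>The real principle applied to real parts; evaluating at \<open>-\<i> w\<close> recovers the imaginary parts.\<close>

lemma variational_principle_complex:
  assumes q: "herm_form V q" and pos: "\<And>v. v \<in> V \<Longrightarrow> 0 \<le> Re (q v v)"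
    and l_add: "\<And>u v. u \<in> V \<Longrightarrow> v \<in> V \<Longrightarrow> l (u + v) = l u + l v"
    and l_scale: "\<And>a v. v \<in> V \<Longrightarrow> l (a *\<^sub>C v) = cnj a * l v"
    and C: "0 \<le> C" and l_bound: "\<And>v. v \<in> V \<Longrightarrow> (cmod (l v))\<^sup>2 \<le> C * Re (q v v)"
  obtains v :: "nat \<Rightarrow> 'a::chilbert" where "\<And>n. v n \<in> V"
    "\<And>e. 0 < e \<Longrightarrow> \<exists>N. \<forall>m\<ge>N. \<forall>n\<ge>N. Re (q (v m - v n) (v m - v n)) < e"
    "\<And>w. w \<in> V \<Longrightarrow> (\<lambda>n. q w (v n)) \<longlonglongrightarrow> l w"
proof -
  have V: "csubspace V" by (rule herm_form_subspace[OF q])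
  have bnd: "(Re (l v))\<^sup>2 \<le> C * Re (q v v)" if "v \<in> V" for v
    using l_bound[OF that] by (simp add: cmod_power2) (smt (verit) zero_le_power2)
  have comm: "Re (q u v) = Re (q v u)" if "u \<in> V" "v \<in> V" for u v
    using herm_form_cnj[OF q that] by simp
  obtain v where v: "\<And>n. v n \<in> V"
    "\<And>e. 0 < e \<Longrightarrow> \<exists>N. \<forall>m\<ge>N. \<forall>n\<ge>N. Re (q (v m - v n) (v m - v n)) < e"
    "\<And>w. w \<in> V \<Longrightarrow> (\<lambda>n. Re (q w (v n))) \<longlonglongrightarrow> Re (l w)"
  proof (rule variational_principle[of V "\<lambda>u v. Re (q u v)" "\<lambda>v. Re (l v)" C])
    show "subspace V" by (rule csubspace_imp_subspace[OF V])
  qed (use pos C bnd comm in \<open>auto simp: herm_form_add_right[OF q] herm_form_scale_right[OF q] l_add l_scale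
      scaleR_eq_scaleC intro: that\<close>)
  have "(\<lambda>n. q w (v n)) \<longlonglongrightarrow> l w" if w: "w \<in> V" for w
  proof -
    have iw: "- \<i> *\<^sub>C w \<in> V" by (rule complex_vector.subspace_scale[OF V w])
    have 1: "q (- \<i> *\<^sub>C w) (v n) = \<i> * q w (v n)" for n
      using herm_form_scale_left[OF q v(1)[of n] w, of "- \<i>"] by simp
    have 2: "l (- \<i> *\<^sub>C w) = \<i> * l w"
      using l_scale[OF w, of "- \<i>"] by simp
    have "(\<lambda>n. complex_of_real (Re (q w (v n))) - \<i> * complex_of_real (Re (q (- \<i> *\<^sub>C w) (v n))))
        \<longlonglongrightarrow> complex_of_real (Re (l w)) - \<i> * complex_of_real (Re (l (- \<i> *\<^sub>C w)))"
      by (intro tendsto_intros v(3) w iw)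
    then show ?thesis unfolding 1 2 complex_of_Re_multiples .
  qed
  then show ?thesis using that v by blast
qed

text \<open>With the inner product as form and \<open>cinner w h\<close> as functional, the
  variational principle minimises the distance from \<open>h\<close> to \<open>R\<close>. Cauchy for
  the form now means Cauchy in norm, and closedness keeps the limit in \<open>R\<close>.\<close>

lemma orthogonal_projection:
  fixes R :: "'a::chilbert set"
  assumes R: "csubspace R" and closed: "closed R"
  obtains r where "r \<in> R" "\<And>w. w \<in> R \<Longrightarrow> cinner w (h - r) = 0"
proof -
  obtain v where v: "\<And>n. v n \<in> R"
    "\<And>e. 0 < e \<Longrightarrow> \<exists>N. \<forall>m\<ge>N. \<forall>n\<ge>N. Re (cinner (v m - v n) (v m - v n)) < e"
    "\<And>w. w \<in> R \<Longrightarrow> (\<lambda>n. cinner w (v n)) \<longlonglongrightarrow> cinner w h"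
  proof (rule variational_principle_complex[OF herm_form_cinner[OF R], of "\<lambda>w. cinner w h" "(norm h)\<^sup>2"])
    show "(cmod (cinner w h))\<^sup>2 \<le> (norm h)\<^sup>2 * Re (cinner w w)" for w
      using power_mono[OF cinner_Cauchy_Schwarz[of w h], of 2]
      by (simp add: Re_cinner_self power_mult_distrib mult.commute)
  qed (auto simp: cinner_simps Re_cinner_self intro: that)
  have "Cauchy v"
    unfolding Cauchy_def
  proof (intro allI impI)
    fix e :: real assume "0 < e"
    then obtain N where N: "\<forall>m\<ge>N. \<forall>n\<ge>N. Re (cinner (v m - v n) (v m - v n)) < e\<^sup>2"
      using v(2)[of "e\<^sup>2"] by auto
    have "dist (v m) (v n) < e" if "m \<ge> N" "n \<ge> N" for m n
    proof (rule power2_less_imp_less)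
      show "(dist (v m) (v n))\<^sup>2 < e\<^sup>2" using N that by (simp add: dist_norm Re_cinner_self)
    qed (use \<open>0 < e\<close> in simp)
    then show "\<exists>N. \<forall>m\<ge>N. \<forall>n\<ge>N. dist (v m) (v n) < e" by blast
  qed
  then obtain r where r: "v \<longlonglongrightarrow> r" using Cauchy_convergent_iff convergent_def by blast
  have "r \<in> R" using closed_sequentially[OF closed v(1) r] .
  moreover have "cinner w (h - r) = 0" if "w \<in> R" for w
    using LIMSEQ_unique[OF v(3)[OF that] tendsto_cinner[OF tendsto_const r]]
    by (simp add: cinner_diff_right)
  ultimately show ?thesis using that by blast
qed

section \<open>The Friedrichs extension\<close>

locale semibounded_operator =
  fixes S :: "('h::chilbert \<times> 'h) set" and c :: real
  assumes S_subspace: "csubspace S" and dense: "densely_defined S" and symmetric: "symmetric_op S"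
    and lower_bound: "(f, g) \<in> S \<Longrightarrow> c * (norm f)\<^sup>2 \<le> Re (cinner f g)"
begin

text \<open>A form on graph elements: each pair carries f along with S f, so the graph itself is the
  complex subspace to which results on Hermitian forms apply.\<close>

definition shifted_form :: "real \<Rightarrow> 'h \<times> 'h \<Rightarrow> 'h \<times> 'h \<Rightarrow> complex" where
  "shifted_form l u v = cinner (fst u) (snd v) - complex_of_real l * cinner (fst u) (fst v)"

lemma symmetricD: "u \<in> S \<Longrightarrow> v \<in> S \<Longrightarrow> cinner (fst u) (snd v) = cinner (snd u) (fst v)"
  using symmetric unfolding symmetric_op_def by (auto split: prod.splits)

lemma shifted_form_herm: "herm_form S (shifted_form l)"
  unfolding herm_form_def
proof (intro conjI ballI allI)
  show "csubspace S" by (rule S_subspace)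
  fix u v assume m: "u \<in> S" "v \<in> S"
  have "cinner (fst u) (snd v) = cnj (cinner (fst v) (snd u))"
    using symmetricD[OF m] cinner_commute[of "snd u" "fst v"] by simp
  then show "shifted_form l u v = cnj (shifted_form l v u)"
    using cinner_commute[of "fst u" "fst v"] by (simp add: shifted_form_def)
qed (simp_all add: shifted_form_def cinner_simps scaleC_prod_def algebra_simps)

lemma shifted_form_lower: "u \<in> S \<Longrightarrow> (c - l) * (norm (fst u))\<^sup>2 \<le> Re (shifted_form l u u)"
  using lower_bound[of "fst u" "snd u"] by (simp add: shifted_form_def cinner_self algebra_simps)

lemma form_self_real: "u \<in> S \<Longrightarrow> cmod (cinner (fst u) (snd u)) = \<bar>Re (cinner (fst u) (snd u))\<bar>"
proof -
  assume u: "u \<in> S"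
  have "cinner (fst u) (snd u) = cnj (cinner (fst u) (snd u))"
    using symmetricD[OF u u] cinner_commute[of "snd u" "fst u"] by simp
  then have "Im (cinner (fst u) (snd u)) = 0"
    by (metis complex_cnj_cancel_iff Reals_cnj_iff complex_is_Real_iff)
  then show ?thesis by (simp add: cmod_def)
qed

lemma S_diff: "u \<in> S \<Longrightarrow> v \<in> S \<Longrightarrow> u - v \<in> S"
  by (rule csubspace_diff[OF S_subspace])

section \<open>Closability and closure of the quadratic form\<close>

context
  fixes l :: real
  assumes l: "l < c"
begin

abbreviation "frm \<equiv> shifted_form l"

text \<open>No limit is demanded, in contrast to \<open>form_converges\<close>: for
  \<open>l < c\<close> the shifted form dominates the norm, so convergence of the first components
  is automatic.\<close>

definition b_Cauchy :: "(nat \<Rightarrow> 'h \<times> 'h) \<Rightarrow> bool" where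
  "b_Cauchy u \<longleftrightarrow> (\<forall>n. u n \<in> S) \<and> (\<forall>e>0. \<exists>N. \<forall>m\<ge>N. \<forall>n\<ge>N. Re (frm (u m - u n) (u m - u n)) < e)"

lemma b_nonneg: "u \<in> S \<Longrightarrow> 0 \<le> Re (frm u u)"
  using shifted_form_lower[of u l] l by (smt (verit) mult_nonneg_nonneg zero_le_power2)

lemma b_Cauchy_Schwarz: "u \<in> S \<Longrightarrow> v \<in> S \<Longrightarrow> (cmod (frm u v))\<^sup>2 \<le> Re (frm u u) * Re (frm v v)"
  by (rule herm_form_Cauchy_Schwarz[OF shifted_form_herm b_nonneg])

lemma b_diff: "frm u (v - w) = frm u v - frm u w" "frm (v - w) u = frm v u - frm w u"
  by (simp_all add: shifted_form_def cinner_simps algebra_simps)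

lemma b_add: "frm u (v + w) = frm u v + frm u w" "frm (v + w) u = frm v u + frm w u"
  by (simp_all add: shifted_form_def cinner_simps algebra_simps)

lemma form_converges_imp_b_Cauchy:
  assumes "form_converges S u f" shows "b_Cauchy u"
  unfolding b_Cauchy_def
proof (intro conjI allI impI)
  show S: "u n \<in> S" for n using assms by (simp add: form_converges_def)
  fix e :: real assume e: "0 < e"
  have "Cauchy (\<lambda>n. fst (u n))"
    using assms convergent_def convergent_Cauchy unfolding form_converges_def by blast
  moreover have "0 < sqrt (e / (2 * (\<bar>l\<bar> + 1)))" using e by simp
  ultimately obtain N1 where
    N1: "\<forall>m\<ge>N1. \<forall>n\<ge>N1. norm (fst (u m) - fst (u n)) < sqrt (e / (2 * (\<bar>l\<bar> + 1)))"
    unfolding Cauchy_def dist_norm by blast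
  have "0 < e / 2" using e by simp
  then obtain N2 where N2: "\<forall>m\<ge>N2. \<forall>n\<ge>N2.
      cmod (cinner (fst (u m) - fst (u n)) (snd (u m) - snd (u n))) < e / 2"
    using assms unfolding form_converges_def by blast
  have "Re (frm (u m - u n) (u m - u n)) < e" if mn: "m \<ge> max N1 N2" "n \<ge> max N1 N2" for m n
  proof -
    let ?f = "fst (u m) - fst (u n)" and ?g = "snd (u m) - snd (u n)"
    have "norm ?f < sqrt (e / (2 * (\<bar>l\<bar> + 1)))" using N1 mn by simp
    then have "(norm ?f)\<^sup>2 \<le> e / (2 * (\<bar>l\<bar> + 1))"
      by (metis less_imp_le norm_ge_zero real_le_rsqrt real_sqrt_le_iff real_sqrt_unique sqrt_ge_absD abs_of_nonneg)
    then have "\<bar>l\<bar> * (norm ?f)\<^sup>2 \<le> \<bar>l\<bar> * (e / (2 * (\<bar>l\<bar> + 1)))" by (intro mult_left_mono) auto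
    also have "\<dots> \<le> e / 2" using e by (simp add: field_simps)
    finally have "- l * (norm ?f)\<^sup>2 \<le> e / 2"
      by (smt (verit) mult_right_mono zero_le_power2)
    moreover have "Re (cinner ?f ?g) < e / 2"
      using N2 mn complex_Re_le_cmod[of "cinner ?f ?g"] by fastforce
    ultimately show ?thesis by (simp add: shifted_form_def Re_cinner_self)
  qed
  then show "\<exists>N. \<forall>m\<ge>N. \<forall>n\<ge>N. Re (frm (u m - u n) (u m - u n)) < e" by blast
qed

lemma b_Cauchy_imp_form_converges:
  assumes u: "b_Cauchy u" obtains f where "form_converges S u f"
proof -
  have S: "u n \<in> S" for n using u by (simp add: b_Cauchy_def)
  have low: "(c - l) * (norm (fst (u m) - fst (u n)))\<^sup>2 \<le> Re (frm (u m - u n) (u m - u n))" for m n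
    using shifted_form_lower[OF S_diff[OF S S], of l m n] by simp
  have "Cauchy (\<lambda>n. fst (u n))"
    unfolding Cauchy_def dist_norm
  proof (intro allI impI)
    fix e :: real assume e: "0 < e"
    then have "0 < (c - l) * e\<^sup>2" using l by simp
    then obtain N where N: "\<forall>m\<ge>N. \<forall>n\<ge>N. Re (frm (u m - u n) (u m - u n)) < (c - l) * e\<^sup>2"
      using u unfolding b_Cauchy_def by blast
    have "norm (fst (u m) - fst (u n)) < e" if "m \<ge> N" "n \<ge> N" for m n
    proof -
      have "(c - l) * (norm (fst (u m) - fst (u n)))\<^sup>2 < (c - l) * e\<^sup>2"
        using low[of m n] N that by (meson le_less_trans)
      then show ?thesis using l e by (simp add: power2_less_imp_less)
    qed
    then show "\<exists>N. \<forall>m\<ge>N. \<forall>n\<ge>N. norm (fst (u m) - fst (u n)) < e" by blast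
  qed
  then obtain f where f: "(\<lambda>n. fst (u n)) \<longlonglongrightarrow> f"
    using Cauchy_convergent_iff convergent_def by blast
  have "\<exists>N. \<forall>m\<ge>N. \<forall>n\<ge>N. cmod (cinner (fst (u m) - fst (u n)) (snd (u m) - snd (u n))) < e"
    if e: "0 < e" for e :: real
  proof -
    \<comment> \<open>The unshifted form differs from the shifted one by l times the squared norm,
      which is at most |l| / (c - l) times the shifted form.\<close>
    define K where "K = 1 + \<bar>l\<bar> / (c - l)"
    have K: "0 < K" using l by (simp add: K_def add_pos_nonneg)
    then have "0 < e / K" using e by simp
    then obtain N where N: "\<forall>m\<ge>N. \<forall>n\<ge>N. Re (frm (u m - u n) (u m - u n)) < e / K"
      using u unfolding b_Cauchy_def by blast
    have "cmod (cinner (fst (u m) - fst (u n)) (snd (u m) - snd (u n))) < e" if "m \<ge> N" "n \<ge> N" for m n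
    proof -
      let ?f = "fst (u m) - fst (u n)" and ?B = "Re (frm (u m - u n) (u m - u n))"
      have "(norm ?f)\<^sup>2 \<le> ?B / (c - l)"
        using low[of m n] l by (simp add: pos_le_divide_eq mult.commute)
      then have "\<bar>l\<bar> * (norm ?f)\<^sup>2 \<le> \<bar>l\<bar> * (?B / (c - l))" by (intro mult_left_mono) auto
      then have *: "\<bar>l * (norm ?f)\<^sup>2\<bar> \<le> \<bar>l\<bar> / (c - l) * ?B" by (simp add: abs_mult)
      have B0: "0 \<le> ?B" by (rule b_nonneg[OF S_diff[OF S S]])
      have "cmod (cinner ?f (snd (u m) - snd (u n))) = \<bar>Re (cinner ?f (snd (u m) - snd (u n)))\<bar>"
        using form_self_real[OF S_diff[OF S S], of m n] by simp
      also have "\<dots> = \<bar>?B + l * (norm ?f)\<^sup>2\<bar>" by (simp add: shifted_form_def Re_cinner_self)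
      also have "\<dots> \<le> K * ?B" using * B0 by (simp add: K_def algebra_simps)
      also have "\<dots> < e" using N that K by (simp add: pos_less_divide_eq mult.commute)
      finally show ?thesis .
    qed
    then show ?thesis by blast
  qed
  then have "form_converges S u f" unfolding form_converges_def using S f by blast
  then show ?thesis using that by blast
qed

lemma b_parallelogram: "Re (frm (u + v) (u + v)) \<le> 2 * Re (frm u u) + 2 * Re (frm v v)"
  if "u \<in> S" "v \<in> S"
  using b_nonneg[OF S_diff[OF that]] by (simp add: b_add b_diff)

lemma b_Cauchy_bounded:
  assumes u: "b_Cauchy u"
  obtains N K where "0 < K" "\<And>n. n \<ge> N \<Longrightarrow> Re (frm (u n) (u n)) \<le> K"
proof -
  have S: "u n \<in> S" for n using u by (simp add: b_Cauchy_def)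
  obtain N where N: "\<forall>m\<ge>N. \<forall>n\<ge>N. Re (frm (u m - u n) (u m - u n)) < 1"
    using u zero_less_one unfolding b_Cauchy_def by blast
  show ?thesis
  proof (rule that[of "2 + 2 * Re (frm (u N) (u N))" N])
    show "0 < 2 + 2 * Re (frm (u N) (u N))" using b_nonneg[OF S, of N] by simp
    show "Re (frm (u n) (u n)) \<le> 2 + 2 * Re (frm (u N) (u N))" if "n \<ge> N" for n
    proof -
      have "Re (frm (u n - u N) (u n - u N)) < 1" using N that by blast
      then show ?thesis using b_parallelogram[OF S_diff[OF S S] S, of n N N] by simp
    qed
  qed
qed

lemma b_small:
  assumes x: "\<And>n. x n \<in> S" "(\<lambda>n. Re (frm (x n) (x n))) \<longlonglongrightarrow> 0" and y: "b_Cauchy y"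
  shows "(\<lambda>n. frm (x n) (y n)) \<longlonglongrightarrow> 0" "(\<lambda>n. frm (y n) (x n)) \<longlonglongrightarrow> 0"
proof -
  have S: "y n \<in> S" for n using y by (simp add: b_Cauchy_def)
  obtain N K where K: "0 < K" "\<And>n. n \<ge> N \<Longrightarrow> Re (frm (y n) (y n)) \<le> K"
    by (rule b_Cauchy_bounded[OF y]) (rule that)
  have "(\<lambda>n. (cmod (frm (x n) (y n)))\<^sup>2) \<longlonglongrightarrow> 0"
  proof (rule tendsto_sandwich[of "\<lambda>_. 0" _ _ "\<lambda>n. Re (frm (x n) (x n)) * K"])
    show "\<forall>\<^sub>F n in sequentially. (cmod (frm (x n) (y n)))\<^sup>2 \<le> Re (frm (x n) (x n)) * K"
    proof (rule eventually_sequentiallyI)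
      fix n assume "n \<ge> N"
      then show "(cmod (frm (x n) (y n)))\<^sup>2 \<le> Re (frm (x n) (x n)) * K"
        using b_Cauchy_Schwarz[OF x(1) S, of n n] mult_left_mono[OF K(2) b_nonneg[OF x(1)], of n n]
        by linarith
    qed
    show "(\<lambda>n. Re (frm (x n) (x n)) * K) \<longlonglongrightarrow> 0" using tendsto_mult_left_zero[OF x(2)] .
  qed auto
  then have *: "(\<lambda>n. cmod (frm (x n) (y n))) \<longlonglongrightarrow> 0"
    using tendsto_real_sqrt[of "\<lambda>n. (cmod (frm (x n) (y n)))\<^sup>2" 0] by simp
  then show "(\<lambda>n. frm (x n) (y n)) \<longlonglongrightarrow> 0" by (rule tendsto_norm_zero_cancel)
  have "cmod (frm (y n) (x n)) = cmod (frm (x n) (y n))" for n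
    by (subst herm_form_cnj[OF shifted_form_herm S x(1)]) simp
  then have "(\<lambda>n. cmod (frm (y n) (x n))) \<longlonglongrightarrow> 0" using * by (simp only:)
  then show "(\<lambda>n. frm (y n) (x n)) \<longlonglongrightarrow> 0" by (rule tendsto_norm_zero_cancel)
qed

lemma b_Cauchy_diff:
  assumes u: "b_Cauchy u" and v: "b_Cauchy v" shows "b_Cauchy (\<lambda>n. u n - v n)"
  unfolding b_Cauchy_def
proof (intro conjI allI impI)
  have Su: "u n \<in> S" and Sv: "v n \<in> S" for n using u v by (simp_all add: b_Cauchy_def)
  show "u n - v n \<in> S" for n by (rule S_diff[OF Su Sv])
  fix e :: real assume "0 < e"
  then have e: "0 < e / 4" by simp
  obtain N1 where N1: "\<forall>m\<ge>N1. \<forall>n\<ge>N1. Re (frm (u m - u n) (u m - u n)) < e / 4"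
    using u e unfolding b_Cauchy_def by blast
  obtain N2 where N2: "\<forall>m\<ge>N2. \<forall>n\<ge>N2. Re (frm (v m - v n) (v m - v n)) < e / 4"
    using v e unfolding b_Cauchy_def by blast
  have "Re (frm (u m - v m - (u n - v n)) (u m - v m - (u n - v n))) < e"
    if "m \<ge> max N1 N2" "n \<ge> max N1 N2" for m n
  proof -
    have "Re (frm (u m - u n) (u m - u n)) < e / 4" "Re (frm (v n - v m) (v n - v m)) < e / 4"
      using N1 N2 that by simp_all
    moreover have "u m - v m - (u n - v n) = (u m - u n) + (v n - v m)" by simp
    ultimately show ?thesis
      using b_parallelogram[OF S_diff[OF Su Su] S_diff[OF Sv Sv], of m n n m] by (simp only:)
  qed
  then show "\<exists>N. \<forall>m\<ge>N. \<forall>n\<ge>N. Re (frm (u m - v m - (u n - v n)) (u m - v m - (u n - v n))) < e"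
    by blast
qed

text \<open>The form is closable: \<open>frm w\<^sub>n w\<^sub>m = \<langle>(S - l) w\<^sub>n, w\<^sub>m\<rangle>\<close> tends to 0 in \<open>m\<close>.\<close>

lemma b_closable:
  assumes w: "b_Cauchy w" and w0: "(\<lambda>n. fst (w n)) \<longlonglongrightarrow> 0"
  shows "(\<lambda>n. Re (frm (w n) (w n))) \<longlonglongrightarrow> 0"
proof (rule LIMSEQ_I)
  fix e :: real assume e: "0 < e"
  have S: "w n \<in> S" for n using w by (simp add: b_Cauchy_def)
  obtain N K where K: "0 < K" "\<And>n. n \<ge> N \<Longrightarrow> Re (frm (w n) (w n)) \<le> K"
    by (rule b_Cauchy_bounded[OF w]) (rule that)
  have "0 < (e / 2)\<^sup>2 / K" using e K by simp
  then obtain M where M: "\<forall>m\<ge>M. \<forall>n\<ge>M. Re (frm (w m - w n) (w m - w n)) < (e / 2)\<^sup>2 / K"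
    using w unfolding b_Cauchy_def by blast
  have "norm (Re (frm (w n) (w n)) - 0) < e" if n: "n \<ge> max N M" for n
  proof -
    have 1: "cmod (frm (w n) (w n)) \<le> e / 2 + cmod (frm (w n) (w m))" if m: "m \<ge> M" for m
    proof -
      have "(cmod (frm (w n) (w n - w m)))\<^sup>2 \<le> Re (frm (w n) (w n)) * Re (frm (w n - w m) (w n - w m))"
        by (rule b_Cauchy_Schwarz[OF S S_diff[OF S S]])
      also have "\<dots> \<le> K * ((e / 2)\<^sup>2 / K)"
        using K(2)[of n] M m n K(1) b_nonneg[OF S, of n] b_nonneg[OF S_diff[OF S S], of n m]
        by (intro mult_mono) (auto intro: less_imp_le)
      finally have "(cmod (frm (w n) (w n - w m)))\<^sup>2 \<le> (e / 2)\<^sup>2" using K by simp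
      then have "cmod (frm (w n) (w n - w m)) \<le> e / 2" by (rule power2_le_imp_le) (use e in simp)
      moreover have "frm (w n) (w n) = frm (w n) (w n - w m) + frm (w n) (w m)" by (simp add: b_diff)
      ultimately show ?thesis using norm_triangle_ineq[of "frm (w n) (w n - w m)" "frm (w n) (w m)"] by simp
    qed
    have "frm (w n) (w m) = cinner (snd (w n)) (fst (w m)) - complex_of_real l * cinner (fst (w n)) (fst (w m))" for m
      by (simp add: shifted_form_def symmetricD[OF S S])
    then have "(\<lambda>m. frm (w n) (w m)) \<longlonglongrightarrow> cinner (snd (w n)) 0 - complex_of_real l * cinner (fst (w n)) 0"
      by (simp only:) (intro tendsto_intros tendsto_cinner w0)
    then have "(\<lambda>m. e / 2 + cmod (frm (w n) (w m))) \<longlonglongrightarrow> e / 2 + 0"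
      by (intro tendsto_intros tendsto_norm_zero) simp
    then have "cmod (frm (w n) (w n)) \<le> e / 2 + 0"
      by (rule LIMSEQ_le_const) (use 1 in blast)
    then show ?thesis using e abs_Re_le_cmod[of "frm (w n) (w n)"] by simp
  qed
  then show "\<exists>N. \<forall>n\<ge>N. norm (Re (frm (w n) (w n)) - 0) < e" by blast
qed

lemma b_convergent:
  assumes v: "b_Cauchy v" and u: "b_Cauchy u"
  shows "convergent (\<lambda>n. frm (v n) (u n))"
proof -
  have Su: "u n \<in> S" and Sv: "v n \<in> S" for n using u v by (simp_all add: b_Cauchy_def)
  obtain N1 K1 where K1: "0 < K1" "\<And>n. n \<ge> N1 \<Longrightarrow> Re (frm (u n) (u n)) \<le> K1"
    by (rule b_Cauchy_bounded[OF u]) (rule that)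
  obtain N2 K2 where K2: "0 < K2" "\<And>n. n \<ge> N2 \<Longrightarrow> Re (frm (v n) (v n)) \<le> K2"
    by (rule b_Cauchy_bounded[OF v]) (rule that)
  have "Cauchy (\<lambda>n. frm (v n) (u n))"
    unfolding Cauchy_def dist_norm
  proof (intro allI impI)
    fix e :: real assume e: "0 < e"
    then have "0 < (e / 2)\<^sup>2 / K1" "0 < (e / 2)\<^sup>2 / K2" using K1 K2 by auto
    then obtain M1 M2 where M1: "\<forall>m\<ge>M1. \<forall>n\<ge>M1. Re (frm (v m - v n) (v m - v n)) < (e / 2)\<^sup>2 / K1"
      and M2: "\<forall>m\<ge>M2. \<forall>n\<ge>M2. Re (frm (u m - u n) (u m - u n)) < (e / 2)\<^sup>2 / K2"
      using u v unfolding b_Cauchy_def by meson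
    let ?N = "max (max N1 N2) (max M1 M2)"
    have "cmod (frm (v m) (u m) - frm (v n) (u n)) < e" if mn: "m \<ge> ?N" "n \<ge> ?N" for m n
    proof -
      have "(cmod (frm (v m - v n) (u m)))\<^sup>2 \<le> Re (frm (v m - v n) (v m - v n)) * Re (frm (u m) (u m))"
        by (rule b_Cauchy_Schwarz[OF S_diff[OF Sv Sv] Su])
      also have "\<dots> \<le> Re (frm (v m - v n) (v m - v n)) * K1"
        using K1(2)[of m] mn b_nonneg[OF S_diff[OF Sv Sv]] by (intro mult_left_mono) auto
      also have "\<dots> < (e / 2)\<^sup>2 / K1 * K1"
        using M1 mn K1(1) by (intro mult_strict_right_mono) auto
      finally have "(cmod (frm (v m - v n) (u m)))\<^sup>2 < (e / 2)\<^sup>2" using K1(1) by simp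
      then have 1: "cmod (frm (v m - v n) (u m)) < e / 2"
        by (rule power2_less_imp_less) (use e in simp)
      have "(cmod (frm (v n) (u m - u n)))\<^sup>2 \<le> Re (frm (v n) (v n)) * Re (frm (u m - u n) (u m - u n))"
        by (rule b_Cauchy_Schwarz[OF Sv S_diff[OF Su Su]])
      also have "\<dots> \<le> K2 * Re (frm (u m - u n) (u m - u n))"
        using K2(2)[of n] mn b_nonneg[OF S_diff[OF Su Su]] by (intro mult_right_mono) auto
      also have "\<dots> < K2 * ((e / 2)\<^sup>2 / K2)"
        using M2 mn K2(1) by (intro mult_strict_left_mono) auto
      finally have "(cmod (frm (v n) (u m - u n)))\<^sup>2 < (e / 2)\<^sup>2" using K2(1) by simp
      then have 2: "cmod (frm (v n) (u m - u n)) < e / 2"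
        by (rule power2_less_imp_less) (use e in simp)
      have "frm (v m) (u m) - frm (v n) (u n) = frm (v m - v n) (u m) + frm (v n) (u m - u n)"
        by (simp add: b_diff)
      then show ?thesis
        using 1 2 norm_triangle_ineq[of "frm (v m - v n) (u m)" "frm (v n) (u m - u n)"] by simp
    qed
    then show "\<exists>M. \<forall>m\<ge>M. \<forall>n\<ge>M. cmod (frm (v m) (u m) - frm (v n) (u n)) < e" by blast
  qed
  then show ?thesis using Cauchy_convergent_iff by blast
qed

text \<open>Two sequences representing the same vector differ by a \<open>b_Cauchy\<close> sequence
  whose first components tend to 0; closability makes it null in the form. The limit is therefore
  independent of the sequences, and the description in \<open>closed_form\<close> denotes
  it.\<close>

lemma closed_form_limit:
  assumes v: "form_converges S v g" and u: "form_converges S u f"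
  shows "(\<lambda>n. cinner (fst (v n)) (snd (u n))) \<longlonglongrightarrow> closed_form S g f"
proof -
  let ?a = "\<lambda>v u n. cinner (fst (v n)) (snd (u n))"
  have eq: "?a v u n = frm (v n) (u n) + complex_of_real l * cinner (fst (v n)) (fst (u n))" for v u n
    by (simp add: shifted_form_def)
  have lim: "(\<lambda>n. fst (u n)) \<longlonglongrightarrow> f" if "form_converges S u f" for u f
    using that by (simp add: form_converges_def)
  have inner: "(\<lambda>n. complex_of_real l * cinner (fst (v n)) (fst (u n))) \<longlonglongrightarrow> complex_of_real l * cinner g f"
    if "form_converges S v g" "form_converges S u f" for u v
    by (intro tendsto_intros tendsto_cinner lim that)
  obtain L where L: "(\<lambda>n. frm (v n) (u n)) \<longlonglongrightarrow> L"
    using b_convergent[OF form_converges_imp_b_Cauchy[OF v] form_converges_imp_b_Cauchy[OF u]]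
    unfolding convergent_def by blast
  let ?c = "L + complex_of_real l * cinner g f"
  have *: "?a v' u' \<longlonglongrightarrow> ?c" if v': "form_converges S v' g" and u': "form_converges S u' f" for v' u'
  proof -
    have S: "v n \<in> S" "v' n \<in> S" "u n \<in> S" "u' n \<in> S" for n
      using u v u' v' by (simp_all add: form_converges_def)
    note bc = form_converges_imp_b_Cauchy
    have du: "(\<lambda>n. Re (frm (u' n - u n) (u' n - u n))) \<longlonglongrightarrow> 0"
      using tendsto_diff[OF lim[OF u'] lim[OF u]]
      by (intro b_closable b_Cauchy_diff bc[OF u] bc[OF u']) simp
    have dv: "(\<lambda>n. Re (frm (v' n - v n) (v' n - v n))) \<longlonglongrightarrow> 0"
      using tendsto_diff[OF lim[OF v'] lim[OF v]]
      by (intro b_closable b_Cauchy_diff bc[OF v] bc[OF v']) simp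
    have "(\<lambda>n. frm (v n) (u n) + (frm (v' n - v n) (u n) + frm (v' n) (u' n - u n))) \<longlonglongrightarrow> L + (0 + 0)"
      by (intro tendsto_add L b_small S_diff S dv du bc[OF u] bc[OF v'])
    then have "(\<lambda>n. frm (v' n) (u' n)) \<longlonglongrightarrow> L" by (simp add: b_diff)
    then show ?thesis unfolding eq by (intro tendsto_add inner[OF v' u'])
  qed
  have "closed_form S g f = ?c"
    unfolding closed_form_def
    by (rule the_equality) (use * v u LIMSEQ_unique in blast)+
  then show ?thesis using *[OF v u] by simp
qed

end

section \<open>Self-adjointness and lower bound of the Friedrichs extension\<close>

abbreviation "T \<equiv> friedrichs S"

lemma closed_form_limit':
  "form_converges S v g \<Longrightarrow> form_converges S u f \<Longrightarrow>
    (\<lambda>n. cinner (fst (v n)) (snd (u n))) \<longlonglongrightarrow> closed_form S g f"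
  by (rule closed_form_limit[of "c - 1"]) simp_all

lemma form_converges_const: "u \<in> S \<Longrightarrow> form_converges S (\<lambda>_. u) (fst u)"
  by (simp add: form_converges_def)

text \<open>Constant sequences place dom S in the form domain; testing the form equation against
  them gives the adjoint relation.\<close>

lemma friedrichs_subset_adjoint: "T \<subseteq> op_adjoint S"
proof clarify
  fix f h assume fh: "(f, h) \<in> T"
  then obtain u where u: "form_converges S u f"
    and h: "\<And>g. g \<in> form_domain S \<Longrightarrow> closed_form S g f = cinner g h"
    unfolding friedrichs_def form_domain_def by blast
  have "cinner f k = cinner h g" if gk: "(g, k) \<in> S" for g k
  proof -
    have v: "form_converges S (\<lambda>_. (g, k)) g" using form_converges_const[OF gk] by simp
    have "closed_form S g f = cinner g h"
      using v by (intro h) (auto simp: form_domain_def)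
    then have "(\<lambda>n. cinner g (snd (u n))) \<longlonglongrightarrow> cinner g h"
      using closed_form_limit'[OF v u] by simp
    moreover have "cinner g (snd (u n)) = cinner k (fst (u n))" for n
      using symmetricD[OF gk, of "u n"] u by (simp add: form_converges_def)
    moreover have "(\<lambda>n. cinner k (fst (u n))) \<longlonglongrightarrow> cinner k f"
      using u by (intro tendsto_cinner tendsto_const) (simp add: form_converges_def)
    ultimately have "cinner k f = cinner g h" using LIMSEQ_unique by simp
    then show ?thesis using cinner_commute[of f k] cinner_commute[of h g] by simp
  qed
  then show "(f, h) \<in> op_adjoint S" by (auto simp: op_adjoint_def)
qed

lemma friedrichs_symmetric:
  assumes "(f, h) \<in> T" "(g, k) \<in> T" shows "cinner f k = cinner h g"
proof -
  obtain u v where u: "form_converges S u f" and v: "form_converges S v g"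
    using assms unfolding friedrichs_def form_domain_def by blast
  have "cnj (cinner (fst (v n)) (snd (u n))) = cinner (fst (u n)) (snd (v n))" for n
    using symmetricD[of "u n" "v n"] u v cinner_commute[of "snd (u n)" "fst (v n)"]
    by (simp add: form_converges_def)
  then have "(\<lambda>n. cinner (fst (u n)) (snd (v n))) \<longlonglongrightarrow> cnj (closed_form S g f)"
    using tendsto_cnj[OF closed_form_limit'[OF v u]] by simp
  then have "closed_form S f g = cnj (closed_form S g f)"
    using LIMSEQ_unique closed_form_limit'[OF u v] by blast
  moreover have "closed_form S f g = cinner f k" "closed_form S g f = cinner g h"
    using assms unfolding friedrichs_def by blast+
  ultimately show ?thesis using cinner_commute[of h g] by simp
qed

lemma friedrichs_lower_bound:
  assumes "(f, h) \<in> T" shows "c * (norm f)\<^sup>2 \<le> Re (cinner f h)"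
proof -
  obtain u where u: "form_converges S u f"
    using assms unfolding friedrichs_def form_domain_def by blast
  have "closed_form S f f = cinner f h" using assms unfolding friedrichs_def by blast
  then have "(\<lambda>n. Re (cinner (fst (u n)) (snd (u n)))) \<longlonglongrightarrow> Re (cinner f h)"
    using tendsto_Re[OF closed_form_limit'[OF u u]] by simp
  moreover have "(\<lambda>n. c * (norm (fst (u n)))\<^sup>2) \<longlonglongrightarrow> c * (norm f)\<^sup>2"
    using u by (intro tendsto_intros) (simp add: form_converges_def)
  moreover have "c * (norm (fst (u n)))\<^sup>2 \<le> Re (cinner (fst (u n)) (snd (u n)))" for n
    using lower_bound[of "fst (u n)" "snd (u n)"] u by (simp add: form_converges_def)
  ultimately show ?thesis by (meson LIMSEQ_le)
qed

text \<open>A Riesz representation carried out without building the completion of the form: the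
  variational principle solves the weak equation against the graph of \<open>S\<close> by a
  sequence, its limit is the solution, and form convergence extends the equation to all test vectors
  of the form domain.\<close>

lemma friedrichs_surjective:
  assumes l: "l < c" shows "\<exists>f. (f, h + complex_of_real l *\<^sub>C f) \<in> T"
proof -
  let ?b = "shifted_form l"
  obtain v where vS: "\<And>n. v n \<in> S"
    and vC: "\<And>e. 0 < e \<Longrightarrow> \<exists>N. \<forall>m\<ge>N. \<forall>n\<ge>N. Re (?b (v m - v n) (v m - v n)) < e"
    and vl: "\<And>w. w \<in> S \<Longrightarrow> (\<lambda>n. ?b w (v n)) \<longlonglongrightarrow> cinner (fst w) h"
  proof (rule variational_principle_complex[OF shifted_form_herm, of l "\<lambda>w. cinner (fst w) h"
        "(norm h)\<^sup>2 / (c - l)"])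
    show "0 \<le> Re (?b u u)" if "u \<in> S" for u by (rule b_nonneg[OF l that])
    show "(cmod (cinner (fst u) h))\<^sup>2 \<le> (norm h)\<^sup>2 / (c - l) * Re (?b u u)" if u: "u \<in> S" for u
    proof -
      have "(cmod (cinner (fst u) h))\<^sup>2 \<le> (norm (fst u) * norm h)\<^sup>2"
        using cinner_Cauchy_Schwarz by (intro power_mono) auto
      also have "\<dots> = (norm h)\<^sup>2 / (c - l) * ((c - l) * (norm (fst u))\<^sup>2)"
        using l by (simp add: power_mult_distrib)
      also have "\<dots> \<le> (norm h)\<^sup>2 / (c - l) * Re (?b u u)"
        using shifted_form_lower[OF u] l by (intro mult_left_mono) auto
      finally show ?thesis .
    qed
  qed (use l in \<open>auto simp: cinner_simps scaleC_prod_def intro: that\<close>)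
  have bv: "b_Cauchy l v" using vS vC by (simp add: b_Cauchy_def[OF l])
  obtain f where f: "form_converges S v f" by (rule b_Cauchy_imp_form_converges[OF l bv])
  have "closed_form S g f = cinner g (h + complex_of_real l *\<^sub>C f)" if g: "g \<in> form_domain S" for g
  proof -
    obtain u where u: "form_converges S u g" using g by (auto simp: form_domain_def)
    have uS: "u n \<in> S" for n using u by (simp add: form_converges_def)
    have v': "(\<lambda>n. fst (v n)) \<longlonglongrightarrow> f" using f by (simp add: form_converges_def)
    have lim: "closed_form S (fst w) f = cinner (fst w) (h + complex_of_real l *\<^sub>C f)" if w: "w \<in> S" for w
    proof -
      have "(\<lambda>n. ?b w (v n) + complex_of_real l * cinner (fst w) (fst (v n)))
          \<longlonglongrightarrow> cinner (fst w) h + complex_of_real l * cinner (fst w) f"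
        by (intro tendsto_intros tendsto_cinner vl w v')
      then have "(\<lambda>n. cinner (fst w) (snd (v n))) \<longlonglongrightarrow> cinner (fst w) (h + complex_of_real l *\<^sub>C f)"
        by (simp add: shifted_form_def cinner_simps)
      then show ?thesis
        using LIMSEQ_unique closed_form_limit'[OF form_converges_const[OF w] f] by blast
    qed
    have bu: "b_Cauchy l u" by (rule form_converges_imp_b_Cauchy[OF l u])
    obtain N K where K: "0 < K" "\<And>n. n \<ge> N \<Longrightarrow> Re (?b (v n) (v n)) \<le> K"
      by (rule b_Cauchy_bounded[OF l bv]) (rule that)
    let ?L = "closed_form S g f - complex_of_real l * cinner g f"
    let ?M = "\<lambda>m. cinner (fst (u m)) h"
    have L: "(\<lambda>n. ?b (u n) (v n)) \<longlonglongrightarrow> ?L"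
      unfolding shifted_form_def using u f
      by (intro tendsto_intros tendsto_cinner closed_form_limit'[OF u f]) (simp_all add: form_converges_def)
    \<comment> \<open>Interchange of limits for the double sequence \<open>?b (u m) (v n)\<close>:
      its limit in n is \<open>?M m\<close>, its diagonal tends to \<open>?L\<close>, and
      Cauchy-Schwarz with the bound on \<open>v\<close> makes the comparison uniform in n.\<close>
    have "?M \<longlonglongrightarrow> ?L"
    proof (rule LIMSEQ_I)
      fix e :: real assume e: "0 < e"
      then have "0 < (e / 2)\<^sup>2 / K" using K by simp
      then obtain M where M: "\<forall>m\<ge>M. \<forall>n\<ge>M. Re (?b (u m - u n) (u m - u n)) < (e / 2)\<^sup>2 / K"
        using bu unfolding b_Cauchy_def[OF l] by blast
      have "norm (?M m - ?L) < e" if m: "m \<ge> M" for m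
      proof -
        have "(\<lambda>n. norm (?b (u m) (v n) - ?b (u n) (v n))) \<longlonglongrightarrow> norm (?M m - ?L)"
          by (intro tendsto_intros L vl uS)
        moreover have "norm (?b (u m) (v n) - ?b (u n) (v n)) \<le> e / 2" if n: "n \<ge> max M N" for n
        proof -
          have "(cmod (?b (u m - u n) (v n)))\<^sup>2 \<le> Re (?b (u m - u n) (u m - u n)) * Re (?b (v n) (v n))"
            by (rule b_Cauchy_Schwarz[OF l S_diff[OF uS uS] vS])
          also have "\<dots> \<le> (e / 2)\<^sup>2 / K * K"
            using K(2)[of n] M m n K(1) b_nonneg[OF l vS, of n] b_nonneg[OF l S_diff[OF uS uS], of m n]
            by (intro mult_mono) (auto intro: less_imp_le)
          finally have "(cmod (?b (u m - u n) (v n)))\<^sup>2 \<le> (e / 2)\<^sup>2" using K(1) by simp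
          then have "cmod (?b (u m - u n) (v n)) \<le> e / 2"
            by (rule power2_le_imp_le) (use e in simp)
          then show ?thesis by (simp add: b_diff[OF l])
        qed
        ultimately have "norm (?M m - ?L) \<le> e / 2" by (meson LIMSEQ_le_const2)
        then show ?thesis using e by simp
      qed
      then show "\<exists>N. \<forall>m\<ge>N. norm (?M m - ?L) < e" by blast
    qed
    moreover have "?M \<longlonglongrightarrow> cinner g h"
      using u by (intro tendsto_cinner tendsto_const) (simp add: form_converges_def)
    ultimately have "?L = cinner g h" by (rule LIMSEQ_unique)
    then show ?thesis by (simp add: cinner_simps diff_eq_eq)
  qed
  moreover have "f \<in> form_domain S" using f by (auto simp: form_domain_def)
  ultimately show ?thesis unfolding friedrichs_def by blast
qed

text \<open>Symmetry together with surjectivity of \<open>T - l\<close> for a single real \<open>l\<close> gives self-adjointness.\<close>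

lemma friedrichs_self_adjoint: "(f, h) \<in> T \<longleftrightarrow> (\<forall>(g, k)\<in>T. cinner f k = cinner h g)"
proof
  assume "\<forall>(g, k)\<in>T. cinner f k = cinner h g"
  then have fh: "cinner f k = cinner h g" if "(g, k) \<in> T" for g k using that by blast
  define l where "l = complex_of_real (c - 1)"
  have cnj_l: "cnj l = l" by (simp only: l_def complex_cnj_complex_of_real)
  have surj: "\<exists>g. (g, x + l *\<^sub>C g) \<in> T" for x
    unfolding l_def by (rule friedrichs_surjective) simp
  obtain f0 where f0: "(f0, (h - l *\<^sub>C f) + l *\<^sub>C f0) \<in> T"
    using surj by blast
  have "cinner (f - f0) x = 0" for x
  proof -
    obtain g where g: "(g, x + l *\<^sub>C g) \<in> T"
      using surj by blast
    have "cinner f x = cinner h g - l * cinner f g" "cinner f0 x = cinner h g - l * cinner f g"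
      using fh[OF g] friedrichs_symmetric[OF f0 g]
      by (simp_all add: cinner_simps cnj_l eq_diff_eq)
    then show ?thesis by (simp add: cinner_diff_left)
  qed
  then have "f = f0" using cinner_orthogonal_UNIV[of "f - f0"] by simp
  then show "(f, h) \<in> T" using f0 by simp
qed (use friedrichs_symmetric in blast)

text \<open>Self-adjointness describes the graph by linear conditions, so linearity of the form
  closure need not be treated.\<close>

lemma friedrichs_subspace: "csubspace T"
  unfolding complex_vector.subspace_def
proof (intro conjI ballI allI)
  show "0 \<in> T" unfolding zero_prod_def friedrichs_self_adjoint[of 0 0] by auto
  fix x y assume "x \<in> T" "y \<in> T"
  then have "(fst x + fst y, snd x + snd y) \<in> T"
    using friedrichs_symmetric[of "fst x" "snd x"] friedrichs_symmetric[of "fst y" "snd y"]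
    by (intro friedrichs_self_adjoint[THEN iffD2]) (auto simp: cinner_simps)
  then show "x + y \<in> T" by (simp add: plus_prod_def)
next
  fix a x assume "x \<in> T"
  then have "(a *\<^sub>C fst x, a *\<^sub>C snd x) \<in> T"
    using friedrichs_symmetric[of "fst x" "snd x"]
    by (intro friedrichs_self_adjoint[THEN iffD2]) (auto simp: cinner_simps)
  then show "a *\<^sub>C x \<in> T" by (simp add: scaleC_prod_def)
qed

end

section \<open>Boundary triplets of semibounded operators\<close>

lemma eigenspace_iff: "f \<in> eigenspace H z \<longleftrightarrow> (f, z *\<^sub>C f) \<in> H"
  by (simp add: eigenspace_def)

lemma csubspace_eigenspace:
  assumes H: "csubspace H" shows "csubspace (eigenspace H z)"
  unfolding complex_vector.subspace_def
proof (intro conjI ballI allI)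
  show "0 \<in> eigenspace H z"
    using complex_vector.subspace_0[OF H] by (simp add: eigenspace_iff zero_prod_def)
  show "x + y \<in> eigenspace H z" if "x \<in> eigenspace H z" "y \<in> eigenspace H z" for x y
    using complex_vector.subspace_add[OF H] that by (fastforce simp: eigenspace_iff scaleC_add_right)
  show "a *\<^sub>C x \<in> eigenspace H z" if "x \<in> eigenspace H z" for a x
    using complex_vector.subspace_scale[OF H, of "(x, z *\<^sub>C x)" a] that
    by (simp add: eigenspace_iff scaleC_prod_def scaleC_scaleC mult.commute)
qed

lemma symp_nondegenerate:
  assumes "\<And>w. symp w v = 0" shows "v = 0"
proof -
  have "cinner (snd v) (snd v) + cinner (fst v) (fst v) = 0"
    using assms[of "(snd v, - fst v)"] by (simp add: symp_def cinner_simps)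
  then have "cinner v v = 0" by (simp add: cinner_prod_def add.commute)
  then show ?thesis by (simp add: cinner_self_eq_0)
qed

text \<open>Serves to show that a spanning symplectic basis has at least n pairs.\<close>

lemma cdim_prod_UNIV_le:
  fixes W :: "('k::chilbert \<times> 'k) set"
  assumes "has_cdim (UNIV :: 'k set) n" and W: "finite W" "cspan W = UNIV"
  shows "2 * n \<le> card W"
proof -
  obtain B :: "'k set" where B: "finite B" "cindependent B" "card B = n"
    using assms unfolding has_cdim_def by blast
  let ?T1 = "(\<lambda>x. (x, 0::'k)) ` B" and ?T2 = "(\<lambda>x. (0::'k, x)) ` B"
  have B0: "0 \<notin> B" using B(2) complex_vector.dependent_zero by blast
  then have disj: "?T1 \<inter> ?T2 = {}" by auto
  have ind: "cindependent (?T1 \<union> ?T2)"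
  proof (rule cindependentI)
    show "finite (?T1 \<union> ?T2)" using B by simp
    fix a and u :: "'k \<times> 'k" assume 0: "(\<Sum>u\<in>?T1 \<union> ?T2. a u *\<^sub>C u) = 0" and u: "u \<in> ?T1 \<union> ?T2"
    have "(\<Sum>u\<in>?T1 \<union> ?T2. a u *\<^sub>C u) = (\<Sum>x\<in>B. a (x, 0) *\<^sub>C (x, 0)) + (\<Sum>x\<in>B. a (0, x) *\<^sub>C (0, x))"
      using B disj by (simp add: sum.union_disjoint sum.reindex inj_on_def)
    then have eq: "(\<Sum>x\<in>B. a (x, 0) *\<^sub>C (x, 0)) + (\<Sum>x\<in>B. a (0, x) *\<^sub>C (0, x)) = (0 :: 'k \<times> 'k)"
      using 0 by simp
    have "(\<Sum>x\<in>B. a (x, 0) *\<^sub>C x) = 0" "(\<Sum>x\<in>B. a (0, x) *\<^sub>C x) = 0"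
      using arg_cong[OF eq, of fst] arg_cong[OF eq, of snd] by (simp_all add: fst_sum snd_sum)
    then have "a (x, 0) = 0" "a (0, x) = 0" if "x \<in> B" for x
      using complex_vector.independentD[OF B(2) B(1) subset_refl, of "\<lambda>x. a (x, 0)"]
        complex_vector.independentD[OF B(2) B(1) subset_refl, of "\<lambda>x. a (0, x)"] that by blast+
    then show "a u = 0" using u by auto
  qed
  have "card (?T1 \<union> ?T2) = 2 * n"
    using disj B by (simp add: card_Un_disjoint card_image inj_on_def)
  then show ?thesis
    using complex_vector.independent_span_bound[OF W(1) ind] W(2) by simp
qed

section \<open>Boundary values and kernels of the shifted adjoint\<close>

locale semibounded_triplet = semibounded_operator S c
  for S :: "('h::chilbert \<times> 'h) set" and c :: real +
  fixes n :: nat and G0 G1 :: "'h \<Rightarrow> 'k::chilbert"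
  assumes triplet: "boundary_triplet n S G0 G1"
begin

abbreviation "A \<equiv> op_adjoint S"

definition G :: "'h \<Rightarrow> 'k \<times> 'k" where "G f = (G0 f, G1 f)"

abbreviation "F \<equiv> friedrichs_plane S G0 G1"

definition N :: "complex \<Rightarrow> 'h set" where "N z = eigenspace A z"

lemma dimK: "has_cdim (UNIV :: 'k set) n"
  using triplet by (simp add: boundary_triplet_def)

lemma F_eq: "F = G ` Domain T"
  by (simp add: friedrichs_plane_def G_def)

lemma adjointI: "(\<And>g k. (g, k) \<in> S \<Longrightarrow> cinner f k = cinner h g) \<Longrightarrow> (f, h) \<in> A"
  by (auto simp: op_adjoint_def)

lemma adjointD: "(f, h) \<in> A \<Longrightarrow> (g, k) \<in> S \<Longrightarrow> cinner f k = cinner h g"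
  by (auto simp: op_adjoint_def)

lemma A_subspace: "csubspace A"
  unfolding complex_vector.subspace_def
proof (intro conjI ballI allI)
  show "0 \<in> A" by (simp add: op_adjoint_def zero_prod_def)
  fix x y assume "x \<in> A" "y \<in> A"
  then have "(fst x + fst y, snd x + snd y) \<in> A"
    using adjointD[of "fst x" "snd x"] adjointD[of "fst y" "snd y"]
    by (intro adjointI) (simp add: cinner_simps)
  then show "x + y \<in> A" by (simp add: plus_prod_def)
next
  fix a x assume "x \<in> A"
  then have "(a *\<^sub>C fst x, a *\<^sub>C snd x) \<in> A"
    using adjointD[of "fst x" "snd x"] by (intro adjointI) (simp add: cinner_simps)
  then show "a *\<^sub>C x \<in> A" by (simp add: scaleC_prod_def)
qed

lemma A_add: "(f, h) \<in> A \<Longrightarrow> (g, k) \<in> A \<Longrightarrow> (f + g, h + k) \<in> A"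
  using complex_vector.subspace_add[OF A_subspace, of "(f, h)" "(g, k)"] by simp

lemma A_diff: "(f, h) \<in> A \<Longrightarrow> (g, k) \<in> A \<Longrightarrow> (f - g, h - k) \<in> A"
  using csubspace_diff[OF A_subspace, of "(f, h)" "(g, k)"] by simp

lemma A_scale: "(f, h) \<in> A \<Longrightarrow> (a *\<^sub>C f, a *\<^sub>C h) \<in> A"
  using complex_vector.subspace_scale[OF A_subspace, of "(f, h)" a] by (simp add: scaleC_prod_def)

lemma A_single_valued:
  assumes "(f, h) \<in> A" "(f, h') \<in> A" shows "h = h'"
proof -
  have "closed {g. cinner (h - h') g = 0}"
    by (intro closed_Collect_eq continuous_intros
        bounded_bilinear.continuous_on[OF bounded_bilinear_cinner])
  moreover have "Domain S \<subseteq> {g. cinner (h - h') g = 0}"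
    using adjointD[OF assms(1)] adjointD[OF assms(2)] by (auto simp: cinner_simps)
  ultimately have "closure (Domain S) \<subseteq> {g. cinner (h - h') g = 0}"
    by (rule closure_minimal[rotated])
  then have "cinner (h - h') (h - h') = 0"
    using dense by (auto simp: densely_defined_def)
  then show ?thesis by (simp add: cinner_self_eq_0)
qed

lemma csubspace_Domain: "csubspace B \<Longrightarrow> csubspace (Domain B)"
  unfolding Domain_fst by (rule csubspace_image) (simp_all add: clinear_on_def)

lemma Domain_A: "csubspace (Domain A)"
  by (rule csubspace_Domain[OF A_subspace])

lemma T_subset_A: "(f, h) \<in> T \<Longrightarrow> (f, h) \<in> A"
  using friedrichs_subset_adjoint by blast

lemma G_linear: "clinear_on (Domain A) G"
  using triplet unfolding boundary_triplet_def clinear_on_def G_def by (simp add: scaleC_prod_def)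

lemma G_add: "f \<in> Domain A \<Longrightarrow> g \<in> Domain A \<Longrightarrow> G (f + g) = G f + G g"
  by (rule clinear_on_add[OF G_linear])

lemma G_diff: "f \<in> Domain A \<Longrightarrow> g \<in> Domain A \<Longrightarrow> G (f - g) = G f - G g"
  by (rule clinear_on_diff[OF G_linear Domain_A])

lemma G_surjective: obtains f h where "(f, h) \<in> A" "u = G f"
proof -
  have "u \<in> (\<lambda>f. (G0 f, G1 f)) ` Domain A"
    using triplet unfolding boundary_triplet_def by simp
  then show ?thesis using that unfolding G_def by blast
qed

lemma green: "(f, h) \<in> A \<Longrightarrow> (g, k) \<in> A \<Longrightarrow> cinner f k - cinner h g = symp (G f) (G g)"
  using triplet unfolding boundary_triplet_def symp_def G_def by auto

lemma F_subspace: "csubspace F"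
  unfolding F_eq
proof (rule csubspace_image)
  show "clinear_on (Domain T) G"
    using G_linear T_subset_A unfolding clinear_on_def by blast
qed (rule csubspace_Domain[OF friedrichs_subspace])

lemma F_isotropic: "u \<in> F \<Longrightarrow> v \<in> F \<Longrightarrow> symp u v = 0"
  unfolding F_eq using green[OF T_subset_A T_subset_A] friedrichs_symmetric by fastforce

text \<open>If the boundary value of f lies in \<open>F\<close>, isotropy of \<open>F\<close> kills
  the right side of Green's identity against every element of \<open>T\<close>; self-adjointness of
  \<open>T\<close> then admits f to its domain.\<close>

lemma friedrichs_iff: "(f, h) \<in> T \<longleftrightarrow> (f, h) \<in> A \<and> G f \<in> F"
proof
  assume "(f, h) \<in> A \<and> G f \<in> F"
  then have fh: "(f, h) \<in> A" "G f \<in> F" by auto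
  have "cinner f k = cinner h g" if gk: "(g, k) \<in> T" for g k
  proof -
    have "G g \<in> F" using gk F_eq by blast
    then show ?thesis using green[OF fh(1) T_subset_A[OF gk]] F_isotropic[OF fh(2)] by simp
  qed
  then show "(f, h) \<in> T" by (intro friedrichs_self_adjoint[THEN iffD2]) blast
qed (use T_subset_A F_eq in blast)

lemma N_subspace: "csubspace (N z)"
  unfolding N_def by (rule csubspace_eigenspace[OF A_subspace])

lemma N_A: "f \<in> N z \<Longrightarrow> (f, z *\<^sub>C f) \<in> A"
  by (simp add: N_def eigenspace_iff)

lemma N_Domain: "N z \<subseteq> Domain A"
  using N_A by blast

text \<open>Such a vector would be an eigenvector of the Friedrichs extension, contradicting its
  lower bound \<open>c\<close>.\<close>

lemma N_transversal:
  assumes f: "f \<in> N z" "G f \<in> F" and z: "Re z < c" shows "f = 0"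
proof -
  have "(f, z *\<^sub>C f) \<in> T" using f N_A friedrichs_iff by blast
  then have "c * (norm f)\<^sup>2 \<le> Re z * (norm f)\<^sup>2"
    using friedrichs_lower_bound by (fastforce simp: cinner_simps cinner_self)
  then have "(c - Re z) * (norm f)\<^sup>2 \<le> 0" by (simp add: algebra_simps)
  then have "(norm f)\<^sup>2 \<le> 0" using z by (simp add: mult_le_0_iff)
  then show ?thesis by simp
qed

lemma N_G_injective: assumes "Re z < c" shows "inj_on G (N z)"
proof (rule clinear_on_inj[OF _ N_subspace])
  show "clinear_on (N z) G"
    using G_linear N_Domain unfolding clinear_on_def by blast
  show "f = 0" if "f \<in> N z" "G f = 0" for f
    using N_transversal[OF that(1) _ assms] that(2) complex_vector.subspace_0[OF F_subspace] by simp
qed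

lemma N_finite_basis:
  assumes "Re z < c" obtains B where "finite B" "cspan B = N z"
proof -
  obtain W :: "('k \<times> 'k) set" where W: "finite W" "cspan W = UNIV"
    by (rule finite_span_prod_UNIV[OF dimK])
  have "clinear_on (N z) G"
    using G_linear N_Domain unfolding clinear_on_def by blast
  then show ?thesis
    using that W
    by (rule_tac finite_basis_of_injection[OF _ N_subspace N_G_injective[OF assms] W(1)]) auto
qed

text \<open>Below \<open>c\<close> the equation (T - l) g = (S* - l) f is solvable, and f - g is
  then annihilated by S* - l.\<close>

lemma decomposition:
  assumes f: "(f, h) \<in> A" and l: "l < c"
  obtains g where "g \<in> Domain T" "f - g \<in> N (complex_of_real l)"
proof -
  let ?l = "complex_of_real l"
  obtain g where g: "(g, (h - ?l *\<^sub>C f) + ?l *\<^sub>C g) \<in> T"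
    using friedrichs_surjective[OF l] by blast
  have "(f - g, h - ((h - ?l *\<^sub>C f) + ?l *\<^sub>C g)) \<in> A"
    by (rule A_diff[OF f T_subset_A[OF g]])
  then have "f - g \<in> N ?l"
    by (simp add: N_def eigenspace_iff complex_vector.scale_right_diff_distrib algebra_simps)
  then show ?thesis using that g by blast
qed

lemma N_isotropic:
  assumes "f \<in> N (complex_of_real l)" "g \<in> N (complex_of_real l)" shows "symp (G f) (G g) = 0"
  using green[OF N_A[OF assms(1)] N_A[OF assms(2)]] by (simp add: cinner_simps)

subsection \<open>A symplectic basis adapted to the Friedrichs extension\<close>

text \<open>An element \<open>k\<close> of the deficiency space at \<open>c - 1\<close> has a unique partner \<open>g\<close> in the domain of
  the Friedrichs extension such that \<open>k - g\<close> lies in the deficiency space at \<open>c - 2\<close>. The pairing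
  \<open>\<omega>(\<Gamma> k, \<Gamma> g)\<close> is a positive definite form on these pairs; an orthonormal basis of it is a
  symplectic basis.\<close>

definition l0 :: complex where "l0 = complex_of_real (c - 1)"

definition mu :: complex where "mu = complex_of_real (c - 2)"

lemma l0_mu [simp]: "cnj l0 = l0" "cnj mu = mu" "Re l0 = c - 1" "Re mu = c - 2" "l0 - mu = 1"
  by (simp_all add: l0_def mu_def)

text \<open>The graph of the linear correspondence k to g, kept as a set of pairs so that it is a
  complex subspace and no partner has to be chosen.\<close>

definition R :: "('h \<times> 'h) set" where
  "R = {(k, g). k \<in> N l0 \<and> g \<in> Domain T \<and> k - g \<in> N mu}"

text \<open>The boundary pairing of k with g' rewritten in the Hilbert space by
  \<open>symp_eq_Q\<close>, where the lower bound of the Friedrichs extension can be applied to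
  it.\<close>

definition Q :: "'h \<times> 'h \<Rightarrow> 'h \<times> 'h \<Rightarrow> complex" where
  "Q r r' = cinner (fst r) (fst r' - snd r')"

lemma R_iff: "r \<in> R \<longleftrightarrow> fst r \<in> N l0 \<and> snd r \<in> Domain T \<and> fst r - snd r \<in> N mu"
  by (simp add: R_def case_prod_beta)

lemma R_subspace: "csubspace R"
proof -
  note sub = N_subspace csubspace_Domain[OF friedrichs_subspace]
  show ?thesis
    unfolding complex_vector.subspace_def
  proof (intro conjI ballI allI)
    show "0 \<in> R"
      using sub[THEN complex_vector.subspace_0] by (simp add: R_def zero_prod_def)
    show "x + y \<in> R" if "x \<in> R" "y \<in> R" for x y
      using that complex_vector.subspace_add[OF N_subspace, of "fst x" l0 "fst y"]
        complex_vector.subspace_add[OF N_subspace, of "fst x - snd x" mu "fst y - snd y"]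
        complex_vector.subspace_add[OF sub(2), of "snd x" "snd y"]
      by (simp add: R_iff add_diff_add)
    show "a *\<^sub>C x \<in> R" if "x \<in> R" for a x
    proof -
      have "a *\<^sub>C fst x - a *\<^sub>C snd x = a *\<^sub>C (fst x - snd x)"
        by (simp add: complex_vector.scale_right_diff_distrib)
      then show ?thesis
        using that complex_vector.subspace_scale[OF N_subspace] complex_vector.subspace_scale[OF sub(2)]
        by (simp add: R_iff)
    qed
  qed
qed

text \<open>Applying S* - l0 to g = k - (k - g) leaves (l0 - mu)(k - g). The two points were taken
  at distance 1 so that no factor remains.\<close>

lemma R_T: assumes "(k, g) \<in> R" shows "(g, (k - g) + l0 *\<^sub>C g) \<in> T"
proof -
  have kg: "k \<in> N l0" "k - g \<in> N mu" "g \<in> Domain T" using assms by (auto simp: R_def)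
  then obtain h where h: "(g, h) \<in> T" by blast
  have "(k - (k - g), l0 *\<^sub>C k - mu *\<^sub>C (k - g)) \<in> A"
    by (intro A_diff N_A kg)
  moreover have "l0 *\<^sub>C k - mu *\<^sub>C (k - g) = (k - g) + l0 *\<^sub>C g"
  proof -
    have "l0 *\<^sub>C k - mu *\<^sub>C (k - g) = l0 *\<^sub>C (k - g) - mu *\<^sub>C (k - g) + l0 *\<^sub>C g"
      by (simp add: complex_vector.scale_right_diff_distrib)
    also have "l0 *\<^sub>C (k - g) - mu *\<^sub>C (k - g) = (l0 - mu) *\<^sub>C (k - g)"
      by (rule complex_vector.scale_left_diff_distrib[symmetric])
    finally show ?thesis by (simp only: l0_mu scaleC_one)
  qed
  ultimately have "(g, (k - g) + l0 *\<^sub>C g) \<in> A" by simp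
  then show ?thesis using h A_single_valued[OF _ T_subset_A[OF h]] by blast
qed

lemma symp_eq_Q:
  assumes "r \<in> R" "r' \<in> R" shows "symp (G (fst r)) (G (snd r')) = Q r r'"
proof -
  have "fst r \<in> N l0" using assms by (auto simp: R_def)
  moreover have "(snd r', (fst r' - snd r') + l0 *\<^sub>C snd r') \<in> T"
    using R_T[of "fst r'" "snd r'"] assms by simp
  ultimately show ?thesis
    using green[OF N_A T_subset_A, of "fst r" l0 "snd r'" "(fst r' - snd r') + l0 *\<^sub>C snd r'"]
    by (simp add: Q_def cinner_simps)
qed

lemma Q_alt:
  assumes "r \<in> R" "r' \<in> R"
  shows "Q r r' = cinner (fst r - snd r) (fst r' - snd r') + cinner (fst r - snd r) (snd r')"
proof -
  have T: "(snd r, (fst r - snd r) + l0 *\<^sub>C snd r) \<in> T" "(snd r', (fst r' - snd r') + l0 *\<^sub>C snd r') \<in> T"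
    using R_T[of "fst r" "snd r"] R_T[of "fst r'" "snd r'"] assms by simp_all
  have "cinner (snd r) (fst r' - snd r') = cinner (fst r - snd r) (snd r')"
    using friedrichs_symmetric[OF T] by (simp add: cinner_simps)
  then show ?thesis by (simp add: Q_def cinner_simps)
qed

lemma Q_herm: "herm_form R Q"
  unfolding herm_form_def
proof (intro conjI ballI allI)
  show "csubspace R" by (rule R_subspace)
  fix r r' assume r: "r \<in> R" "r' \<in> R"
  have "Q r' r = cinner (fst r') (fst r - snd r)" by (simp add: Q_def)
  also have "\<dots> = cnj (cinner (fst r - snd r) (fst r'))" by (rule cinner_commute)
  also have "cinner (fst r - snd r) (fst r') = Q r r'"
    unfolding Q_alt[OF r] by (simp add: cinner_simps)
  finally show "Q r r' = cnj (Q r' r)" by simp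
qed (simp_all add: Q_def cinner_simps algebra_simps)

text \<open>The diagonal value is the squared norm of k - g plus the pairing of g with (T - l0) g,
  and T - l0 is at least 1 because l0 = c - 1. The factor 1/2 comes from the triangle inequality for
  k = (k - g) + g.\<close>

lemma Q_lower:
  assumes r: "r \<in> R"
  shows "(norm (fst r - snd r))\<^sup>2 + (norm (snd r))\<^sup>2 \<le> Re (Q r r)"
    and "(norm (fst r))\<^sup>2 / 2 \<le> Re (Q r r)"
proof -
  let ?k = "fst r - snd r" and ?g = "snd r"
  have "(?g, ?k + l0 *\<^sub>C ?g) \<in> T" using R_T[of "fst r" ?g] r by simp
  then have "c * (norm ?g)\<^sup>2 \<le> Re (cinner ?g (?k + l0 *\<^sub>C ?g))" by (rule friedrichs_lower_bound)
  also have "\<dots> = Re (cinner ?g ?k) + (c - 1) * (norm ?g)\<^sup>2"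
    by (simp add: cinner_add_right cinner_scaleC_right cinner_self)
  finally have *: "(norm ?g)\<^sup>2 \<le> Re (cinner ?g ?k)" by (simp add: algebra_simps)
  have "Q r r = cinner ?k ?k + cinner ?g ?k" by (simp add: Q_def cinner_diff_left)
  then show 1: "(norm ?k)\<^sup>2 + (norm ?g)\<^sup>2 \<le> Re (Q r r)" using * by (simp add: Re_cinner_self)
  have "norm (fst r) \<le> norm ?k + norm ?g" using norm_triangle_ineq[of ?k ?g] by simp
  then have "(norm (fst r))\<^sup>2 \<le> (norm ?k + norm ?g)\<^sup>2" by (intro power_mono) auto
  also have "\<dots> \<le> 2 * ((norm ?k)\<^sup>2 + (norm ?g)\<^sup>2)"
    using zero_le_power2[of "norm ?k - norm ?g"] by (simp add: power2_eq_square algebra_simps)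
  finally show "(norm (fst r))\<^sup>2 / 2 \<le> Re (Q r r)" using 1 by simp
qed

lemma Q_pos: assumes r: "r \<in> R" "r \<noteq> 0" shows "0 < Re (Q r r)"
proof (rule ccontr)
  assume "\<not> 0 < Re (Q r r)"
  then have "(norm (fst r - snd r))\<^sup>2 + (norm (snd r))\<^sup>2 \<le> 0" using Q_lower(1)[OF r(1)] by simp
  then have "fst r - snd r = 0" "snd r = 0" by (auto simp: sum_power2_le_zero_iff)
  then show False using r(2) by (simp add: prod_eq_iff)
qed

lemma R_finite_basis: obtains B where "finite B" "cspan B = R"
proof -
  obtain W :: "('k \<times> 'k) set" where W: "finite W" "cspan W = UNIV"
    by (rule finite_span_prod_UNIV[OF dimK])
  let ?f = "\<lambda>r. G (fst r)"
  have dom: "fst r \<in> Domain A" if "r \<in> R" for r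
    using that N_Domain unfolding R_iff by blast
  have lin: "clinear_on R ?f"
    using dom clinear_on_add[OF G_linear] clinear_on_scale[OF G_linear] by (simp add: clinear_on_def)
  have "inj_on ?f R"
  proof (rule clinear_on_inj[OF lin R_subspace])
    fix r assume r: "r \<in> R" "G (fst r) = 0"
    then have "fst r \<in> N l0" by (auto simp: R_def)
    then have "fst r = 0"
      using N_transversal[of "fst r" l0] r complex_vector.subspace_0[OF F_subspace] by simp
    then have "Q r r = 0" by (simp add: Q_def)
    then show "r = 0" using Q_pos[OF r(1)] by fastforce
  qed
  then show ?thesis
    using that W by (rule_tac finite_basis_of_injection[OF lin R_subspace _ W(1)]) auto
qed

text \<open>Kernel at \<open>l0\<close> and Friedrichs plane are isotropic, and
  \<open>Q\<close>-orthonormality makes their mutual pairing the identity. Completeness holds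
  because dom S* is the sum of N(l0) and dom T: a boundary vector symplectically orthogonal to the
  values of both is zero.\<close>

lemma symplectic_basis_exists:
  obtains d and r :: "nat \<Rightarrow> 'h \<times> 'h" where "n \<le> d" "\<And>i. i < d \<Longrightarrow> r i \<in> R"
    "symplectic_basis n d (\<lambda>i. G (fst (r i))) (\<lambda>i. G (snd (r i)))"
proof -
  obtain B where B: "finite B" "cspan B = R" by (rule R_finite_basis)
  obtain E where E: "E \<subseteq> R" "orthonormal_set Q E" "cindependent E"
    "\<And>x. x \<in> R \<Longrightarrow> x = (\<Sum>e\<in>E. Q e x *\<^sub>C e)"
    by (rule orthonormal_basis[OF Q_herm B(1) _ Q_pos]) (use B(2) in \<open>auto intro: that\<close>)
  have finE: "finite E" using E(2) by (simp add: orthonormal_set_def)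
  define d where "d = card E"
  obtain r where r: "bij_betw r {..<d} E"
    using ex_bij_betw_nat_finite[OF finE] by (auto simp: d_def atLeast0LessThan)
  have rE: "r i \<in> E" if "i < d" for i using r that by (auto simp: bij_betw_def)
  have rR: "r i \<in> R" if "i < d" for i using rE[OF that] E(1) by blast
  have Qr: "Q (r i) (r j) = (if i = j then 1 else 0)" if "i < d" "j < d" for i j
    using E(2) rE[OF that(1)] rE[OF that(2)] r that
    by (auto simp: orthonormal_set_def bij_betw_def inj_on_def)
  let ?m = "\<lambda>i. G (fst (r i))" and ?f = "\<lambda>i. G (snd (r i))"
  have fN: "fst (r i) \<in> N l0" and gT: "snd (r i) \<in> Domain T" if "i < d" for i
    using rR[OF that] by (auto simp: R_def)
  have mm: "symp (?m i) (?m j) = 0" if "i < d" "j < d" for i j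
    using N_isotropic[of _ "c - 1"] fN that unfolding l0_def by blast
  have fF: "?f i \<in> F" if "i < d" for i using gT[OF that] F_eq by blast
  have ff: "symp (?f i) (?f j) = 0" if "i < d" "j < d" for i j
    using F_isotropic fF that by blast
  have mf: "symp (?m i) (?f j) = (if i = j then 1 else 0)" if "i < d" "j < d" for i j
    using symp_eq_Q[OF rR rR, of i j] Qr that by simp
  have fm: "symp (?f i) (?m j) = (if i = j then - 1 else 0)" if "i < d" "j < d" for i j
    using symp_cnj[of "?f i" "?m j"] mf[OF that(2,1)] by auto
  \<comment> \<open>Each k in N(l0) has a partner, so the expansion of the pair in \<open>E\<close>
    writes G k as a combination of the \<open>?m i\<close>.\<close>
  have N_orth: "symp (G k) v = 0" if k: "k \<in> N l0" and v: "\<And>i. i < d \<Longrightarrow> symp (?m i) v = 0" for k v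
  proof -
    obtain g where g: "g \<in> Domain T" "k - g \<in> N mu"
      by (rule decomposition[OF N_A[OF k], of "c - 2"]) (simp_all add: mu_def that)
    have "(k, g) \<in> R" using k g by (simp add: R_def)
    then have "(k, g) = (\<Sum>e\<in>E. Q e (k, g) *\<^sub>C e)" by (rule E(4))
    also have "\<dots> = (\<Sum>i<d. Q (r i) (k, g) *\<^sub>C r i)"
      by (rule sum.reindex_bij_betw[OF r, symmetric])
    finally have "fst (k, g) = fst (\<Sum>i<d. Q (r i) (k, g) *\<^sub>C r i)" by (rule arg_cong)
    then have "k = (\<Sum>i<d. Q (r i) (k, g) *\<^sub>C fst (r i))" by (simp add: fst_sum)
    then have "G k = G (\<Sum>i<d. Q (r i) (k, g) *\<^sub>C fst (r i))" by (rule arg_cong)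
    then have "G k = (\<Sum>i<d. Q (r i) (k, g) *\<^sub>C ?m i)"
      using clinear_on_combination[OF G_linear Domain_A, of "{..<d}" "\<lambda>i. fst (r i)"]
        subsetD[OF N_Domain fN] by simp
    then show ?thesis using v by (simp add: symp_sum_left)
  qed
  have nondeg: "v = 0" if "\<And>k. k \<in> N l0 \<Longrightarrow> symp (G k) v = 0" "\<And>w. w \<in> F \<Longrightarrow> symp w v = 0" for v
  proof (rule symp_nondegenerate)
    fix w
    obtain f h where fh: "(f, h) \<in> A" "w = G f" by (rule G_surjective)
    obtain g where g: "g \<in> Domain T" "f - g \<in> N l0"
      by (rule decomposition[OF fh(1), of "c - 1"]) (simp_all add: l0_def that)
    have "f - g \<in> Domain A" "g \<in> Domain A" using g N_Domain T_subset_A by blast+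
    then have "w = G (f - g) + G g" using fh(2) G_add[of "f - g" g] by simp
    moreover have "G g \<in> F" using g(1) F_eq by blast
    ultimately show "symp w v = 0" using that(1)[OF g(2)] that(2) by (simp add: symp_add_left)
  qed
  \<comment> \<open>The remainder is orthogonal to all \<open>?m i\<close> by the choice of
    coefficients and to \<open>F\<close> by isotropy, so \<open>nondeg\<close> applies.\<close>
  have F_expand: "w = (\<Sum>i<d. symp (?m i) w *\<^sub>C ?f i)" if w: "w \<in> F" for w
  proof -
    let ?s = "\<Sum>i<d. symp (?m i) w *\<^sub>C ?f i"
    have sF: "?s \<in> F"
      using fF by (intro complex_vector.subspace_sum[OF F_subspace] complex_vector.subspace_scale[OF F_subspace]) auto
    have "symp (?m j) ?s = symp (?m j) w" if j: "j < d" for j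
    proof -
      have "symp (?m j) ?s = (\<Sum>i<d. if i = j then symp (?m i) w else 0)"
        unfolding symp_sum_right by (rule sum.cong) (use j in \<open>auto simp: mf\<close>)
      then show ?thesis using j by simp
    qed
    then have 0: "symp (?m j) (w - ?s) = 0" if "j < d" for j
      using that by (simp add: symp_diff_right)
    have "w - ?s = 0"
    proof (rule nondeg)
      show "symp (G k) (w - ?s) = 0" if "k \<in> N l0" for k
        by (rule N_orth[OF that 0])
      show "symp v (w - ?s) = 0" if "v \<in> F" for v
        by (rule F_isotropic[OF that csubspace_diff[OF F_subspace w sF]])
    qed
    then show ?thesis by (rule eq_iff_diff_eq_0[THEN iffD2])
  qed
  have expansion: "u = (\<Sum>i<d. - symp (?f i) u *\<^sub>C ?m i + symp (?m i) u *\<^sub>C ?f i)" for u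
  proof -
    let ?s = "(\<Sum>i<d. (- symp (?f i) u) *\<^sub>C ?m i) + (\<Sum>i<d. symp (?m i) u *\<^sub>C ?f i)"
    have s1: "symp (?m j) ?s = symp (?m j) u" if j: "j < d" for j
    proof -
      have "symp (?m j) ?s = (\<Sum>i<d. 0) + (\<Sum>i<d. if i = j then symp (?m i) u else 0)"
        unfolding symp_add_right symp_sum_right
        by (intro arg_cong2[where f = plus] sum.cong) (use j in \<open>auto simp: mf mm\<close>)
      then show ?thesis using j by simp
    qed
    have s2: "symp (?f j) ?s = symp (?f j) u" if j: "j < d" for j
    proof -
      have "symp (?f j) ?s = (\<Sum>i<d. if i = j then symp (?f i) u else 0) + (\<Sum>i<d. 0)"
        unfolding symp_add_right symp_sum_right
        by (intro arg_cong2[where f = plus] sum.cong) (use j in \<open>auto simp: fm ff\<close>)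
      then show ?thesis using j by simp
    qed
    have "u - ?s = 0"
    proof (rule nondeg)
      show "symp (G k) (u - ?s) = 0" if "k \<in> N l0" for k
        by (rule N_orth[OF that]) (simp only: symp_diff_right s1 diff_self)
      fix w assume "w \<in> F"
      have "symp w (u - ?s) = symp (\<Sum>i<d. symp (?m i) w *\<^sub>C ?f i) (u - ?s)"
        by (rule arg_cong[where f = "\<lambda>w. symp w (u - ?s)"]) (rule F_expand[OF \<open>w \<in> F\<close>])
      also have "\<dots> = 0" using s2 by (simp add: symp_sum_left symp_diff_right)
      finally show "symp w (u - ?s) = 0" .
    qed
    then have "u = ?s" by (rule eq_iff_diff_eq_0[THEN iffD2])
    then show ?thesis unfolding sum.distrib .
  qed
  have "symplectic_basis n d ?m ?f"
    by unfold_locales (use dimK mm ff mf expansion in blast)+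
  moreover have "n \<le> d"
  proof -
    \<comment> \<open>At most 2d vectors span the boundary space, whose dimension is 2n.\<close>
    let ?W = "?m ` {..<d} \<union> ?f ` {..<d}"
    have "u \<in> cspan ?W" for u
      by (subst expansion[of u])
        (intro complex_vector.span_sum complex_vector.span_add complex_vector.span_scale
          complex_vector.span_base; auto)
    then have "2 * n \<le> card ?W" by (intro cdim_prod_UNIV_le[OF dimK]) auto
    also have "\<dots> \<le> card (?m ` {..<d}) + card (?f ` {..<d})" by (rule card_Un_le)
    also have "\<dots> \<le> d + d" by (intro add_mono order_trans[OF card_image_le]) auto
    finally show ?thesis by simp
  qed
  ultimately show ?thesis using that rR by blast
qed

end

section \<open>Extensions belonging to diagonal planes\<close>

locale triplet_basis = semibounded_triplet +
  fixes d :: nat and r :: "nat \<Rightarrow> 'a \<times> 'a"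
  assumes r_R: "i < d \<Longrightarrow> r i \<in> R"
    and basis: "symplectic_basis n d (\<lambda>i. G (fst (r i))) (\<lambda>i. G (snd (r i)))"
begin

sublocale sb: symplectic_basis n d "\<lambda>i. G (fst (r i))" "\<lambda>i. G (snd (r i))"
  by (rule basis)

definition x :: "nat \<Rightarrow> 'a \<Rightarrow> complex" where "x i f = sb.X i (G f)"

definition H :: "(nat \<Rightarrow> real) \<Rightarrow> ('a \<times> 'a) set" where
  "H p = extension_of S G0 G1 (sb.diagonal_plane p)"

lemma H_iff:
  "(f, h) \<in> H p \<longleftrightarrow> (f, h) \<in> A \<and> (\<forall>i<d. sb.Y i (G f) = complex_of_real (p i) * x i f)"
  by (simp add: H_def extension_of_def sb.diagonal_plane_def x_def flip: G_def)

lemma H_A: "(f, h) \<in> H p \<Longrightarrow> (f, h) \<in> A"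
  by (simp add: H_iff)

lemma H_symmetric: "(f, h) \<in> H p \<Longrightarrow> (g, k) \<in> H p \<Longrightarrow> cinner f k = cinner h g"
  using green[OF H_A H_A, of f h p g k p] lagrangian_symp[OF sb.lagrangian_diagonal, of "G f" p "G g"]
  by (simp add: H_def extension_of_def G_def)

lemma r_in: assumes "i < d"
  shows "fst (r i) \<in> N l0" "snd (r i) \<in> Domain T" "fst (r i) - snd (r i) \<in> N mu"
    "fst (r i) \<in> Domain A" "snd (r i) \<in> Domain A"
  using r_R[OF assms] N_Domain T_subset_A unfolding R_iff by blast+

lemma F_eq_vertical: "F = sb.vertical_plane"
proof (intro equalityI subsetI)
  fix u assume "u \<in> F"
  then have "symp (G (snd (r i))) u = 0" if "i < d" for i
    using F_isotropic r_in(2)[OF that] F_eq by blast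
  then show "u \<in> sb.vertical_plane" by (simp add: sb.vertical_plane_def sb.X_def)
next
  fix u assume "u \<in> sb.vertical_plane"
  then have "u = (\<Sum>i<d. sb.Y i u *\<^sub>C G (snd (r i)))"
    using sb.XY_expansion[of u] by (simp add: sb.vertical_plane_def)
  also have "\<dots> \<in> F"
    using r_in(2) F_eq
    by (intro complex_vector.subspace_sum[OF F_subspace] complex_vector.subspace_scale[OF F_subspace]) auto
  finally show "u \<in> F" .
qed

lemma x_linear:
  assumes "f \<in> Domain A" "g \<in> Domain A"
  shows "x i (f + g) = x i f + x i g" "x i (f - g) = x i f - x i g"
  using assms by (simp_all add: x_def G_add G_diff sb.XY_linear)

lemma x_combination:
  assumes "\<And>j. j \<in> J \<Longrightarrow> v j \<in> Domain A"
  shows "x i (\<Sum>j\<in>J. a j *\<^sub>C v j) = (\<Sum>j\<in>J. a j * x i (v j))"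
  using clinear_on_combination[OF G_linear Domain_A, of J v a] assms by (simp add: x_def sb.X_sum)

lemma x_fst: "i < d \<Longrightarrow> j < d \<Longrightarrow> x i (fst (r j)) = (if i = j then 1 else 0)"
  by (simp add: x_def sb.XY_basis)

lemma x_diff: "i < d \<Longrightarrow> j < d \<Longrightarrow> x i (fst (r j) - snd (r j)) = (if i = j then 1 else 0)"
  by (simp add: x_def G_diff r_in sb.XY_linear sb.XY_basis)

text \<open>On vectors without components along the directions with \<open>p i \<le> 0\<close> the form of \<open>H p - (c - 1)\<close>
  is the sum of the Friedrichs part and of the form \<open>Q\<close>, hence coercive.\<close>

lemma H_coercive:
  assumes w: "(w, h) \<in> H p" and p: "\<And>i. i < d \<Longrightarrow> p i \<in> {-1, 0, 1}"
    and xw: "\<And>i. i < d \<Longrightarrow> p i \<le> 0 \<Longrightarrow> x i w = 0"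
  shows "(norm w)\<^sup>2 / 3 \<le> Re (cinner w h) - (c - 1) * (norm w)\<^sup>2"
proof -
  \<comment> \<open>The combination of basis pairs with the X-coordinates of \<open>w\<close>.
    Subtracting its first component k cancels these coordinates, so w - k has boundary value in
    \<open>F\<close> and belongs to the Friedrichs domain.\<close>
  define rr where "rr = (\<Sum>i<d. x i w *\<^sub>C r i)"
  define k where "k = fst rr"
  have rrR: "rr \<in> R"
    unfolding rr_def using r_R
    by (intro complex_vector.subspace_sum[OF R_subspace] complex_vector.subspace_scale[OF R_subspace]) auto
  have kN: "k \<in> N l0" using rrR by (simp add: R_iff k_def)
  have wA: "(w, h) \<in> A" using H_A[OF w] .
  have kA: "k \<in> Domain A" "w \<in> Domain A" using kN N_Domain wA by blast+
  have srA: "snd rr \<in> Domain A" using rrR T_subset_A unfolding R_iff by blast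
  have k: "k = (\<Sum>i<d. x i w *\<^sub>C fst (r i))" by (simp add: k_def rr_def fst_sum)
  have s: "snd rr = (\<Sum>i<d. x i w *\<^sub>C snd (r i))" by (simp add: rr_def snd_sum)
  have Gk: "G k = (\<Sum>i<d. x i w *\<^sub>C G (fst (r i)))"
    unfolding k using r_in(4) by (intro clinear_on_combination[OF G_linear Domain_A]) auto
  have Gs: "G (snd rr) = (\<Sum>i<d. x i w *\<^sub>C G (snd (r i)))"
    unfolding s using r_in(5) by (intro clinear_on_combination[OF G_linear Domain_A]) auto
  have delta: "(\<Sum>j<d. a j * (if i = j then 1 else 0)) = a i" if "i < d" for i and a :: "nat \<Rightarrow> complex"
    using that by (simp add: if_distrib[of "(*) _"] cong: if_cong)
  have Xk: "sb.X i (G k) = x i w" if i: "i < d" for i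
  proof -
    have "sb.X i (G k) = (\<Sum>j<d. x j w * (if i = j then 1 else 0))"
      unfolding Gk sb.X_sum by (rule sum.cong) (use i in \<open>auto simp: sb.XY_basis\<close>)
    then show ?thesis using delta[OF i] by simp
  qed
  have Yk: "sb.Y i (G k) = 0" if i: "i < d" for i
    unfolding Gk sb.Y_sum by (rule sum.neutral) (use i in \<open>auto simp: sb.XY_basis\<close>)
  have Ys: "sb.Y i (G (snd rr)) = x i w" if i: "i < d" for i
  proof -
    have "sb.Y i (G (snd rr)) = (\<Sum>j<d. x j w * (if i = j then 1 else 0))"
      unfolding Gs sb.Y_sum by (rule sum.cong) (use i in \<open>auto simp: sb.XY_basis\<close>)
    then show ?thesis using delta[OF i] by simp
  qed
  define g where "g = w - k"
  define hg where "hg = h - l0 *\<^sub>C k"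
  have gA: "(g, hg) \<in> A" unfolding g_def hg_def by (rule A_diff[OF wA N_A[OF kN]])
  have Gg: "G g = G w - G k" unfolding g_def by (rule G_diff[OF kA(2,1)])
  have "G g \<in> F"
    unfolding F_eq_vertical sb.vertical_plane_def Gg
    by (simp add: sb.XY_linear Xk) (simp add: x_def)
  then have gT: "(g, hg) \<in> T" using gA friedrichs_iff by blast
  have "symp (G k) (G g) = (\<Sum>i<d. cnj (x i w) * x i w)"
    unfolding sb.symp_coordinates
  proof (rule sum.cong)
    fix i assume "i \<in> {..<d}"
    then have i: "i < d" by simp
    have "sb.Y i (G g) = complex_of_real (p i) * x i w"
      using w i by (simp add: Gg sb.XY_linear Yk H_iff)
    \<comment> \<open>Only slope 1 contributes: where \<open>p i\<close> is 0 or -1 the coordinate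
      vanishes by hypothesis.\<close>
    also have "\<dots> = x i w" using p[OF i] xw[OF i] by auto
    finally show "cnj (sb.X i (G k)) * sb.Y i (G g) - cnj (sb.Y i (G k)) * sb.X i (G g)
        = cnj (x i w) * x i w"
      using i by (simp add: Xk Yk)
  qed simp
  also have "\<dots> = symp (G k) (G (snd rr))"
    unfolding sb.symp_coordinates by (rule sum.cong) (simp_all add: Xk Yk Ys)
  also have "\<dots> = Q rr rr" unfolding k_def by (rule symp_eq_Q[OF rrR rrR])
  finally have "symp (G k) (G g) = Q rr rr" .
  then have kg: "cinner k hg - cinner (l0 *\<^sub>C k) g = Q rr rr"
    using green[OF N_A[OF kN] gA] by simp
  have "cinner w h - l0 * cinner w w = (cinner g hg - l0 * cinner g g) + (cinner k hg - cinner (l0 *\<^sub>C k) g)"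
  proof -
    have "w = g + k" "h = hg + l0 *\<^sub>C k" by (simp_all add: g_def hg_def)
    then show ?thesis by (simp add: cinner_simps algebra_simps)
  qed
  then have "Re (cinner w h - l0 * cinner w w) = Re (cinner g hg - l0 * cinner g g) + Re (Q rr rr)"
    unfolding kg by simp
  then have eq: "Re (cinner w h) - (c - 1) * (norm w)\<^sup>2
      = Re (cinner g hg) - (c - 1) * (norm g)\<^sup>2 + Re (Q rr rr)"
    by (simp add: cinner_self)
  have "(norm g)\<^sup>2 \<le> Re (cinner g hg) - (c - 1) * (norm g)\<^sup>2"
    using friedrichs_lower_bound[OF gT] by (simp add: algebra_simps)
  moreover have "(norm k)\<^sup>2 / 2 \<le> Re (Q rr rr)" using Q_lower(2)[OF rrR] by (simp add: k_def)
  \<comment> \<open>The difference of the two sides is at least half the square of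
    \<open>2 * norm g - norm k\<close>; this is where the constant 1/3 originates.\<close>
  moreover have "(norm w)\<^sup>2 \<le> 3 * ((norm g)\<^sup>2 + (norm k)\<^sup>2 / 2)"
  proof -
    have "norm w \<le> norm g + norm k" using norm_triangle_ineq[of g k] by (simp add: g_def)
    then have "(norm w)\<^sup>2 \<le> (norm g + norm k)\<^sup>2" by (intro power_mono) auto
    also have "\<dots> \<le> 3 * ((norm g)\<^sup>2 + (norm k)\<^sup>2 / 2)"
      using zero_le_power2[of "2 * norm g - norm k"] by (simp add: power2_eq_square algebra_simps)
    finally show ?thesis .
  qed
  ultimately show ?thesis using eq by simp
qed

subsection \<open>The lowest eigenvalues\<close>

definition E :: "(nat \<Rightarrow> real) \<Rightarrow> complex \<Rightarrow> 'a set" where "E p z = eigenspace (H p) z"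

lemma H_subspace: "csubspace (H p)"
  unfolding complex_vector.subspace_def
proof (intro conjI ballI allI)
  have "G 0 = 0" by (rule clinear_on_zero[OF G_linear Domain_A])
  moreover have "(0, 0) \<in> A" using complex_vector.subspace_0[OF A_subspace] by (simp add: zero_prod_def)
  ultimately have "(0, 0) \<in> H p" by (simp add: H_iff x_def sb.XY_linear)
  then show "0 \<in> H p" by (simp only: zero_prod_def)
  fix u v assume uv: "u \<in> H p" "v \<in> H p"
  obtain f h g k where eq: "u = (f, h)" "v = (g, k)" by (cases u, cases v)
  have m: "(f, h) \<in> H p" "(g, k) \<in> H p" using uv eq by simp_all
  have "(f + g, h + k) \<in> A" by (rule A_add[OF H_A[OF m(1)] H_A[OF m(2)]])
  moreover have "G (f + g) = G f + G g" using m H_A by (intro G_add) blast+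
  ultimately have "(f + g, h + k) \<in> H p"
    using m by (simp add: H_iff x_def sb.XY_linear distrib_left)
  then show "u + v \<in> H p" by (simp add: eq)
next
  fix a u assume u: "u \<in> H p"
  obtain f h where eq: "u = (f, h)" by (cases u)
  have m: "(f, h) \<in> H p" using u eq by simp
  have "(a *\<^sub>C f, a *\<^sub>C h) \<in> A" by (rule A_scale[OF H_A[OF m]])
  moreover have "G (a *\<^sub>C f) = a *\<^sub>C G f"
    using m H_A by (intro clinear_on_scale[OF G_linear]) blast
  ultimately have "(a *\<^sub>C f, a *\<^sub>C h) \<in> H p"
    using m by (simp add: H_iff x_def sb.XY_linear)
  then show "a *\<^sub>C u \<in> H p" by (simp add: eq scaleC_prod_def)
qed

lemma E_subspace: "csubspace (E p z)"
  unfolding E_def by (rule csubspace_eigenspace[OF H_subspace])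

lemma E_H: "f \<in> E p z \<longleftrightarrow> (f, z *\<^sub>C f) \<in> H p"
  by (simp add: E_def eigenspace_iff)

lemma E_Domain: "f \<in> E p z \<Longrightarrow> f \<in> Domain A"
  unfolding E_H using H_A by blast

lemma E_orthogonal:
  assumes "f \<in> E p (complex_of_real a)" "g \<in> E p (complex_of_real b)" "a \<noteq> b"
  shows "cinner f g = 0" "cinner g f = 0"
proof -
  have "complex_of_real b * cinner f g = complex_of_real a * cinner f g"
    using H_symmetric assms(1,2) unfolding E_H by (fastforce simp: cinner_simps)
  then show "cinner f g = 0" using assms(3) by simp
  then show "cinner g f = 0" using cinner_commute[of g f] by simp
qed

text \<open>Eigenvectors at different eigenvalues are orthogonal, so on a + b + e the form shifted
  by c - 1 equals (l - (c - 1)) |e|^2 - |a|^2. Coercivity bounds it below by a third of |a|^2 +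
  |b|^2 + |e|^2, while l - (c - 1) is at most 1/4. The threshold c - 3/4 only has to leave a
  coefficient smaller than 1/3.\<close>

lemma eigenvectors_vanish:
  assumes p: "\<And>i. i < d \<Longrightarrow> p i \<in> {-1, 0, 1}"
    and a: "a \<in> E p mu" and b: "b \<in> E p l0" and e: "e \<in> E p (complex_of_real l)"
    and l: "l \<noteq> c - 1" "l \<noteq> c - 2" "l \<le> c - 3 / 4"
    and x0: "\<And>i. i < d \<Longrightarrow> p i \<le> 0 \<Longrightarrow> x i (a + b + e) = 0"
  shows "a = 0" "b = 0" "e = 0"
proof -
  let ?w = "a + b + e" and ?l = "complex_of_real l"
  let ?h = "mu *\<^sub>C a + l0 *\<^sub>C b + ?l *\<^sub>C e"
  have wH: "(?w, ?h) \<in> H p"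
    using complex_vector.subspace_add[OF H_subspace complex_vector.subspace_add[OF H_subspace]]
      a b e unfolding E_H by fastforce
  have orth: "cinner a b = 0" "cinner b a = 0" "cinner a e = 0" "cinner e a = 0" "cinner b e = 0"
    "cinner e b = 0"
    using E_orthogonal[OF a[unfolded mu_def] b[unfolded l0_def]] E_orthogonal[OF a[unfolded mu_def] e]
      E_orthogonal[OF b[unfolded l0_def] e] l by auto
  have "cinner ?w ?w = cinner a a + cinner b b + cinner e e"
    by (simp add: cinner_add_left cinner_add_right orth)
  then have nw: "(norm ?w)\<^sup>2 = (norm a)\<^sup>2 + (norm b)\<^sup>2 + (norm e)\<^sup>2"
    by (metis Re_cinner_self plus_complex.sel(1))
  have "cinner ?w ?h = mu * cinner a a + l0 * cinner b b + ?l * cinner e e"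
    by (simp add: cinner_add_left cinner_add_right cinner_scaleC_right orth)
  then have "Re (cinner ?w ?h) = (c - 2) * (norm a)\<^sup>2 + (c - 1) * (norm b)\<^sup>2 + l * (norm e)\<^sup>2"
    by (simp add: cinner_self)
  then have "Re (cinner ?w ?h) - (c - 1) * (norm ?w)\<^sup>2 = (l - (c - 1)) * (norm e)\<^sup>2 - (norm a)\<^sup>2"
    unfolding nw by (simp add: algebra_simps)
  moreover have "(norm ?w)\<^sup>2 / 3 \<le> Re (cinner ?w ?h) - (c - 1) * (norm ?w)\<^sup>2"
    by (rule H_coercive[OF wH p x0])
  moreover have "(l - (c - 1)) * (norm e)\<^sup>2 \<le> 1 / 4 * (norm e)\<^sup>2"
    using l by (intro mult_right_mono) auto
  ultimately have "(norm a)\<^sup>2 + (norm b)\<^sup>2 + (norm e)\<^sup>2 \<le> 3 / 4 * (norm e)\<^sup>2 - 3 * (norm a)\<^sup>2"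
    using nw by linarith
  moreover have "0 \<le> (norm a)\<^sup>2" "0 \<le> (norm b)\<^sup>2" "0 \<le> (norm e)\<^sup>2" by simp_all
  ultimately have "(norm a)\<^sup>2 = 0" "(norm b)\<^sup>2 = 0" "(norm e)\<^sup>2 = 0" by linarith+
  then show "a = 0" "b = 0" "e = 0" by simp_all
qed

definition zeros :: "(nat \<Rightarrow> real) \<Rightarrow> nat set" where "zeros p = {i. i < d \<and> p i = 0}"

definition negs :: "(nat \<Rightarrow> real) \<Rightarrow> nat set" where "negs p = {i. i < d \<and> p i = -1}"

lemma zeros_E: "i \<in> zeros p \<Longrightarrow> fst (r i) \<in> E p l0"
  unfolding E_H H_iff using r_in[of i] N_A by (auto simp: zeros_def x_fst sb.XY_basis)

lemma negs_E: "i \<in> negs p \<Longrightarrow> fst (r i) - snd (r i) \<in> E p mu"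
  unfolding E_H H_iff using r_in[of i] N_A[OF r_in(3), of i]
  by (auto simp: negs_def x_diff G_diff sb.XY_linear sb.XY_basis)

lemma finite_zeros_negs: "finite (zeros p)" "finite (negs p)"
  by (simp_all add: zeros_def negs_def)

text \<open>Combination of the known eigenvectors at \<open>l0\<close> with the matching coordinates
  of f. Subtracting it together with \<open>neg_part\<close> produces a vector satisfying the
  vanishing condition of \<open>H_coercive\<close>.\<close>

definition zero_part :: "(nat \<Rightarrow> real) \<Rightarrow> 'a \<Rightarrow> 'a" where
  "zero_part p f = (\<Sum>i\<in>zeros p. x i f *\<^sub>C fst (r i))"

definition neg_part :: "(nat \<Rightarrow> real) \<Rightarrow> 'a \<Rightarrow> 'a" where
  "neg_part p f = (\<Sum>i\<in>negs p. x i f *\<^sub>C (fst (r i) - snd (r i)))"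

lemma parts_E: "zero_part p f \<in> E p l0" "neg_part p f \<in> E p mu"
  unfolding zero_part_def neg_part_def using zeros_E negs_E
  by (auto intro!: complex_vector.subspace_sum[OF E_subspace] complex_vector.subspace_scale[OF E_subspace])

lemma parts_x:
  assumes "i < d" "p i \<in> {-1, 0, 1}" "p i \<le> 0" "f \<in> Domain A"
  shows "x i (f - zero_part p f - neg_part p f) = 0"
proof -
  have "x i (zero_part p f) = (\<Sum>j\<in>zeros p. x j f * (if i = j then 1 else 0))"
    unfolding zero_part_def using assms(1)
    by (subst x_combination) (auto simp: zeros_def x_fst r_in intro!: sum.cong)
  also have "\<dots> = (if i \<in> zeros p then x i f else 0)"
    using finite_zeros_negs by (simp add: if_distrib[of "(*) _"] cong: if_cong)
  finally have 0: "x i (zero_part p f) = (if i \<in> zeros p then x i f else 0)" .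
  have dom: "fst (r j) - snd (r j) \<in> Domain A" if "j < d" for j
    using r_in(3)[OF that] N_Domain by blast
  have "x i (neg_part p f) = (\<Sum>j\<in>negs p. x j f * (if i = j then 1 else 0))"
    unfolding neg_part_def using assms(1) dom
    by (subst x_combination) (auto simp: negs_def x_diff intro!: sum.cong)
  also have "\<dots> = (if i \<in> negs p then x i f else 0)"
    using finite_zeros_negs by (simp add: if_distrib[of "(*) _"] cong: if_cong)
  finally have 1: "x i (neg_part p f) = (if i \<in> negs p then x i f else 0)" .
  have "zero_part p f \<in> Domain A" "neg_part p f \<in> Domain A" using parts_E E_Domain by blast+
  moreover from this have "f - zero_part p f \<in> Domain A"
    using assms(4) csubspace_diff[OF Domain_A] by blast
  ultimately show ?thesis
    using assms by (auto simp: x_linear 0 1 zeros_def negs_def)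
qed

context
  fixes p :: "nat \<Rightarrow> real"
  assumes p: "\<And>i. i < d \<Longrightarrow> p i \<in> {-1, 0, 1}"
begin

text \<open>The corrections of f are themselves eigenvectors at \<open>mu\<close> and
  \<open>l0\<close>, so the corrected vector is a sum of the kind excluded by
  \<open>eigenvectors_vanish\<close>.\<close>

lemma E_other:
  assumes l: "l \<noteq> c - 1" "l \<noteq> c - 2" "l \<le> c - 3 / 4" and f: "f \<in> E p (complex_of_real l)"
  shows "f = 0"
proof (rule eigenvectors_vanish(3)[OF p _ _ f l])
  show "- neg_part p f \<in> E p mu" "- zero_part p f \<in> E p l0"
    using parts_E complex_vector.subspace_neg[OF E_subspace] by blast+
  show "x i (- neg_part p f + - zero_part p f + f) = 0" if "i < d" "p i \<le> 0" for i
    using parts_x[of _ p f, OF that(1) p[OF that(1)] that(2) E_Domain[OF f]] by (simp add: algebra_simps)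
qed

lemma zero_E: "0 \<in> E p z"
  by (rule complex_vector.subspace_0[OF E_subspace])

lemma E_l0_expansion:
  assumes f: "f \<in> E p l0" shows "f = zero_part p f"
proof -
  have "f - zero_part p f = 0"
  proof (rule eigenvectors_vanish(2)[OF p])
    show "- neg_part p f \<in> E p mu" "f - zero_part p f \<in> E p l0"
      using f parts_E complex_vector.subspace_neg[OF E_subspace] csubspace_diff[OF E_subspace] by blast+
    \<comment> \<open>No third eigenvector takes part: 0 is in every eigenspace, and c - 3 is merely
      an admissible value different from c - 1 and c - 2.\<close>
    show "0 \<in> E p (complex_of_real (c - 3))" by (rule zero_E)
    show "x i (- neg_part p f + (f - zero_part p f) + 0) = 0" if "i < d" "p i \<le> 0" for i
      using parts_x[of _ p f, OF that(1) p[OF that(1)] that(2) E_Domain[OF f]] by (simp add: algebra_simps)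
  qed auto
  then show ?thesis by simp
qed

lemma E_mu_expansion:
  assumes f: "f \<in> E p mu" shows "f = neg_part p f"
proof -
  have "f - neg_part p f = 0"
  proof (rule eigenvectors_vanish(1)[OF p])
    show "f - neg_part p f \<in> E p mu" "- zero_part p f \<in> E p l0"
      using f parts_E complex_vector.subspace_neg[OF E_subspace] csubspace_diff[OF E_subspace] by blast+
    show "0 \<in> E p (complex_of_real (c - 3))" by (rule zero_E)
    show "x i (f - neg_part p f + - zero_part p f + 0) = 0" if "i < d" "p i \<le> 0" for i
      using parts_x[of _ p f, OF that(1) p[OF that(1)] that(2) E_Domain[OF f]] by (simp add: algebra_simps)
  qed auto
  then show ?thesis by simp
qed

lemma cdim_of_coordinates:
  assumes I: "finite I" "I \<subseteq> {..<d}" and v: "\<And>i. i \<in> I \<Longrightarrow> v i \<in> V" "\<And>i. i \<in> I \<Longrightarrow> v i \<in> Domain A"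
    and xv: "\<And>i j. i \<in> I \<Longrightarrow> j \<in> I \<Longrightarrow> x i (v j) = (if i = j then 1 else 0)"
    and span: "\<And>f. f \<in> V \<Longrightarrow> f = (\<Sum>i\<in>I. x i f *\<^sub>C v i)"
  shows "cdim V = card I"
proof -
  have inj: "inj_on v I"
  proof (rule inj_onI, rule ccontr)
    fix i j assume "i \<in> I" "j \<in> I" "v i = v j" "i \<noteq> j"
    then show False using xv[of i i] xv[of i j] by simp
  qed
  have "cindependent (v ` I)"
  proof (rule cindependentI)
    fix a b assume 0: "(\<Sum>u\<in>v ` I. a u *\<^sub>C u) = 0" and "b \<in> v ` I"
    then obtain i where i: "i \<in> I" "b = v i" by blast
    have "(\<Sum>j\<in>I. a (v j) *\<^sub>C v j) = 0" using 0 inj by (simp add: sum.reindex)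
    then have "x i (\<Sum>j\<in>I. a (v j) *\<^sub>C v j) = x i 0" by (rule arg_cong)
    moreover have "x i 0 = 0"
      using clinear_on_zero[OF G_linear Domain_A] by (simp add: x_def sb.XY_linear)
    moreover have "x i (\<Sum>j\<in>I. a (v j) *\<^sub>C v j) = (\<Sum>j\<in>I. a (v j) * x i (v j))"
      by (rule x_combination) (rule v(2))
    moreover have "\<dots> = (\<Sum>j\<in>I. if j = i then a (v i) else 0)"
      using i xv by (intro sum.cong) auto
    ultimately show "a b = 0" using i I(1) by simp
  qed (use I(1) in simp)
  moreover have "V \<subseteq> cspan (v ` I)"
  proof
    fix f assume "f \<in> V"
    then have "f = (\<Sum>i\<in>I. x i f *\<^sub>C v i)" by (rule span)
    also have "\<dots> \<in> cspan (v ` I)"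
      by (auto intro!: complex_vector.span_sum complex_vector.span_scale intro: complex_vector.span_base)
    finally show "f \<in> cspan (v ` I)" .
  qed
  moreover have "v ` I \<subseteq> V" using v(1) by blast
  ultimately have "cdim V = card (v ` I)"
    by (intro complex_vector.dim_unique) auto
  then show ?thesis using card_image[OF inj] by simp
qed

lemma cdim_E_l0: "cdim (E p l0) = card (zeros p)"
proof (rule cdim_of_coordinates[of _ "\<lambda>i. fst (r i)"])
  show "fst (r i) \<in> Domain A" if "i \<in> zeros p" for i
    using that r_in(4) by (simp add: zeros_def)
  show "f = (\<Sum>i\<in>zeros p. x i f *\<^sub>C fst (r i))" if "f \<in> E p l0" for f
    using E_l0_expansion[OF that] by (simp add: zero_part_def)
qed (use zeros_E finite_zeros_negs in \<open>auto simp: zeros_def x_fst\<close>)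

lemma cdim_E_mu: "cdim (E p mu) = card (negs p)"
proof (rule cdim_of_coordinates[of _ "\<lambda>i. fst (r i) - snd (r i)"])
  show "fst (r i) - snd (r i) \<in> Domain A" if "i \<in> negs p" for i
    using that subsetD[OF N_Domain r_in(3)] by (simp add: negs_def)
  show "f = (\<Sum>i\<in>negs p. x i f *\<^sub>C (fst (r i) - snd (r i)))" if "f \<in> E p mu" for f
    using E_mu_expansion[OF that] by (simp add: neg_part_def)
qed (use negs_E finite_zeros_negs in \<open>auto simp: negs_def x_diff\<close>)

lemma eigenvalue_count_H:
  assumes l: "l \<le> c - 3 / 4"
  shows "eigenvalue_count (H p) {..l}
    = (if c - 2 \<le> l then card (negs p) else 0) + (if c - 1 \<le> l then card (zeros p) else 0)"
proof -
  let ?E = "\<lambda>l. eigenspace (H p) (complex_of_real l)"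
  have sub: "{l'. l' \<in> {..l} \<and> ?E l' \<noteq> {0}} \<subseteq> {l'. l' \<in> {c - 2, c - 1} \<and> l' \<le> l}"
  proof
    fix l' assume "l' \<in> {l'. l' \<in> {..l} \<and> ?E l' \<noteq> {0}}"
    then have l': "l' \<in> {..l}" "?E l' \<noteq> {0}" by blast+
    then obtain f where "f \<in> E p (complex_of_real l')" "f \<noteq> 0"
      using zero_E unfolding E_def by blast
    then show "l' \<in> {l'. l' \<in> {c - 2, c - 1} \<and> l' \<le> l}" using E_other[of l' f] l' l by auto
  qed
  \<comment> \<open>Either point may fail to be an eigenvalue; its eigenspace then contributes
    dimension 0.\<close>
  have "eigenvalue_count (H p) {..l} = (\<Sum>l' | l' \<in> {c - 2, c - 1} \<and> l' \<le> l. cdim (?E l'))"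
    unfolding eigenvalue_count_def
  proof (rule sum.mono_neutral_left[OF _ sub])
    show "\<forall>i\<in>{l'. l' \<in> {c - 2, c - 1} \<and> l' \<le> l} - {l'. l' \<in> {..l} \<and> ?E l' \<noteq> {0}}. cdim (?E i) = 0"
    proof
      fix i assume "i \<in> {l'. l' \<in> {c - 2, c - 1} \<and> l' \<le> l} - {l'. l' \<in> {..l} \<and> ?E l' \<noteq> {0}}"
      then have "?E i = {0}" by auto
      then show "cdim (?E i) = 0" using complex_vector.dim_le_card[of "{0}" "{}"] by simp
    qed
  qed simp
  also have "{l'. l' \<in> {c - 2, c - 1} \<and> l' \<le> l}
      = (if c - 2 \<le> l then {c - 2} else {}) \<union> (if c - 1 \<le> l then {c - 1} else {})" by auto
  also have "(\<Sum>l'\<in>\<dots>. cdim (?E l'))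
      = (if c - 2 \<le> l then cdim (?E (c - 2)) else 0) + (if c - 1 \<le> l then cdim (?E (c - 1)) else 0)"
    by (subst sum.union_disjoint) auto
  finally show ?thesis
    using cdim_E_l0 cdim_E_mu unfolding E_def l0_def mu_def by simp
qed

end

end

section \<open>The essential spectrum\<close>

lemma norm_scaleC: "norm (a *\<^sub>C x) = cmod a * norm x" for x :: "'a::chilbert"
proof (rule power2_eq_imp_eq)
  have "cinner (a *\<^sub>C x) (a *\<^sub>C x) = complex_of_real ((cmod a)\<^sup>2) * cinner x x"
    by (simp only: cinner_scaleC_left cinner_scaleC_right complex_norm_square mult_ac)
  then have "complex_of_real ((norm (a *\<^sub>C x))\<^sup>2) = complex_of_real ((cmod a * norm x)\<^sup>2)"
    by (simp only: cinner_self of_real_mult power_mult_distrib)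
  then show "(norm (a *\<^sub>C x))\<^sup>2 = (cmod a * norm x)\<^sup>2" by (simp only: of_real_eq_iff)
qed auto

lemma tendsto_scaleC: "(f \<longlongrightarrow> x) F \<Longrightarrow> ((\<lambda>n. a *\<^sub>C f n) \<longlongrightarrow> a *\<^sub>C (x::'a::chilbert)) F"
proof -
  have "bounded_linear (\<lambda>x::'a. a *\<^sub>C x)"
    by (rule bounded_linear_intro[of _ "cmod a"])
      (simp_all add: scaleC_add_right scaleR_eq_scaleC scaleC_scaleC norm_scaleC mult.commute)
  then show "(f \<longlongrightarrow> x) F \<Longrightarrow> ?thesis" by (rule bounded_linear.tendsto)
qed

context semibounded_triplet
begin

text \<open>At distance at least 1 below \<open>c\<close>, S - z does not decrease norms, so it is
  injective and, \<open>S\<close> being closed, has closed range. The orthogonal complement of the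
  range is N(cnj z), which is finite-dimensional by its boundary values.\<close>

lemma fredholm_below:
  assumes closed_S: "closed S" and z: "Re z \<le> c - 1"
  shows "fredholm (op_shift S z)"
proof -
  have shift_iff: "(f, y) \<in> op_shift S z \<longleftrightarrow> (f, y + z *\<^sub>C f) \<in> S" for f y
    by (auto simp: op_shift_def) (metis add_diff_cancel)
  have lower: "norm f \<le> norm y" if fy: "(f, y) \<in> op_shift S z" for f y
  proof -
    have "c * (norm f)\<^sup>2 \<le> Re (cinner f (y + z *\<^sub>C f))"
      using fy by (intro lower_bound) (simp add: shift_iff)
    then have "c * (norm f)\<^sup>2 \<le> Re (cinner f y) + Re z * (norm f)\<^sup>2"
      by (simp add: cinner_simps cinner_self)
    moreover have "Re z * (norm f)\<^sup>2 \<le> (c - 1) * (norm f)\<^sup>2"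
      by (rule mult_right_mono[OF z]) simp
    ultimately have "(norm f)\<^sup>2 \<le> Re (cinner f y)" by (simp add: algebra_simps)
    also have "\<dots> \<le> norm f * norm y"
      using complex_Re_le_cmod[of "cinner f y"] cinner_Cauchy_Schwarz[of f y] by linarith
    finally have "norm f * norm f \<le> norm f * norm y" by (simp add: power2_eq_square)
    then show ?thesis by (cases "norm f = 0") (auto simp: mult_le_cancel_left)
  qed
  have shift_subspace: "csubspace (op_shift S z)"
    unfolding complex_vector.subspace_def
  proof (intro conjI ballI allI)
    show "0 \<in> op_shift S z"
      using complex_vector.subspace_0[OF S_subspace] by (simp add: zero_prod_def shift_iff)
    fix u v assume uv: "u \<in> op_shift S z" "v \<in> op_shift S z"
    obtain f y g w where eq: "u = (f, y)" "v = (g, w)" by (cases u, cases v)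
    show "u + v \<in> op_shift S z"
      using complex_vector.subspace_add[OF S_subspace, of "(f, y + z *\<^sub>C f)" "(g, w + z *\<^sub>C g)"] uv
      by (simp add: eq shift_iff scaleC_add_right algebra_simps)
  next
    fix a u assume u: "u \<in> op_shift S z"
    obtain f y where eq: "u = (f, y)" by (cases u)
    show "a *\<^sub>C u \<in> op_shift S z"
      using complex_vector.subspace_scale[OF S_subspace, of "(f, y + z *\<^sub>C f)" a] u
      by (simp add: eq shift_iff scaleC_prod_def scaleC_add_right scaleC_scaleC mult.commute)
  qed
  let ?R = "Range (op_shift S z)"
  have R_subspace: "csubspace ?R"
    unfolding Range_snd by (rule csubspace_image[OF _ shift_subspace]) (simp add: clinear_on_def)
  have closed_R: "closed ?R"
    unfolding closed_sequential_limits
  proof (intro allI impI)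
    fix y :: "nat \<Rightarrow> 'h" and y0 assume "(\<forall>n. y n \<in> ?R) \<and> y \<longlonglongrightarrow> y0"
    then have y: "\<And>n. \<exists>f. (f, y n) \<in> op_shift S z" "y \<longlonglongrightarrow> y0" by blast+
    then obtain f where f: "\<And>n. (f n, y n) \<in> op_shift S z" by metis
    have "Cauchy f"
      unfolding Cauchy_def dist_norm
    proof (intro allI impI)
      fix e :: real assume "0 < e"
      then obtain M where M: "\<forall>m\<ge>M. \<forall>n\<ge>M. norm (y m - y n) < e"
        using LIMSEQ_imp_Cauchy[OF y(2)] unfolding Cauchy_def dist_norm by blast
      have "norm (f m - f n) \<le> norm (y m - y n)" for m n
        using csubspace_diff[OF shift_subspace f[of m] f[of n]] by (intro lower) simp
      then show "\<exists>M. \<forall>m\<ge>M. \<forall>n\<ge>M. norm (f m - f n) < e" using M by (meson le_less_trans)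
    qed
    then obtain f0 where f0: "f \<longlonglongrightarrow> f0" using Cauchy_convergent_iff convergent_def by blast
    have "(\<lambda>n. (f n, y n + z *\<^sub>C f n)) \<longlonglongrightarrow> (f0, y0 + z *\<^sub>C f0)"
      by (intro tendsto_Pair tendsto_add tendsto_scaleC f0 y)
    moreover have "(f n, y n + z *\<^sub>C f n) \<in> S" for n using f by (simp add: shift_iff)
    ultimately have "(f0, y0 + z *\<^sub>C f0) \<in> S" by (rule closed_sequentially[OF closed_S, rotated])
    then show "y0 \<in> ?R" unfolding shift_iff[symmetric] by blast
  qed
  have "{f. (f, 0) \<in> op_shift S z} = {0}"
  proof (intro equalityI subsetI)
    show "f \<in> {0}" if "f \<in> {f. (f, 0) \<in> op_shift S z}" for f
      using lower[of f 0] that by simp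
    show "f \<in> {f. (f, 0) \<in> op_shift S z}" if "f \<in> {0}" for f
      using that complex_vector.subspace_0[OF shift_subspace] by (simp add: zero_prod_def)
  qed
  then have kernel: "\<exists>B. finite B \<and> cspan B = {f. (f, 0) \<in> op_shift S z}"
    by (intro exI[of _ "{}"]) simp
  obtain B where B: "finite B" "cspan B = N (cnj z)"
    by (rule N_finite_basis[of "cnj z"]) (use z in \<open>auto intro: that\<close>)
  have "h \<in> cspan (?R \<union> B)" for h
  proof -
    obtain q where q: "q \<in> ?R" "\<And>w. w \<in> ?R \<Longrightarrow> cinner w (h - q) = 0"
      by (rule orthogonal_projection[OF R_subspace closed_R]) (rule that)
    have "(h - q, cnj z *\<^sub>C (h - q)) \<in> A"
    proof (rule adjointI)
      fix f k assume fk: "(f, k) \<in> S"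
      then have "(f, k - z *\<^sub>C f) \<in> op_shift S z" by (simp add: shift_iff)
      then have "cinner (k - z *\<^sub>C f) (h - q) = 0" by (intro q) blast
      then have "cinner (h - q) (k - z *\<^sub>C f) = 0"
        using cinner_commute[of "h - q" "k - z *\<^sub>C f"] by simp
      then show "cinner (h - q) k = cinner (cnj z *\<^sub>C (h - q)) f"
        by (simp only: cinner_diff_right[of "h - q"] cinner_scaleC_right cinner_scaleC_left
            complex_cnj_cnj right_minus_eq)
    qed
    then have "h - q \<in> cspan B" unfolding B(2) by (simp add: N_def eigenspace_iff)
    then have "h - q \<in> cspan (?R \<union> B)" using complex_vector.span_mono[of B "?R \<union> B"] by blast
    moreover have "q \<in> cspan (?R \<union> B)" using q(1) by (intro complex_vector.span_base) blast
    ultimately show ?thesis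
      using complex_vector.span_add[of q _ "h - q"] by simp
  qed
  then have "cspan (?R \<union> B) = UNIV" by blast
  then show ?thesis unfolding fredholm_def using kernel closed_R B(1) by blast
qed

end

section \<open>Sharpness of the bounds\<close>

theorem proposition7p5:
  fixes S :: "('h::chilbert \<times> 'h) set"
    and G0 G1 :: "'h \<Rightarrow> 'k::chilbert"
    and n sm sp :: nat
  assumes separable: "separable_space (euclidean :: 'h topology)"
    and op: "is_operator S" "closed S" "densely_defined S" "symmetric_op S" "bounded_from_below S"
    and defect: "has_defect_numbers S n n"
    and triplet: "boundary_triplet n S G0 G1"
    and sum_le: "sm + sp \<le> n"
  shows "\<exists>L1 L2. lagrangian L1 \<and> lagrangian L2 \<and>
    duistermaat L1 L2 (friedrichs_plane S G0 G1) = int sm \<and>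
    duistermaat L2 L1 (friedrichs_plane S G0 G1) = int sp \<and>
    (\<exists>l0::real. below_ess_spec l0 S \<and>
      ((\<lambda>l. real_of_int (spectral_shift (extension_of S G0 G1 L1) (extension_of S G0 G1 L2) l))
         \<longlongrightarrow> - real sm) (at_left l0) \<and>
      ((\<lambda>l. real_of_int (spectral_shift (extension_of S G0 G1 L1) (extension_of S G0 G1 L2) l))
         \<longlongrightarrow> real sp) (at_right l0))"
proof -
  obtain c where c: "\<And>f g. (f, g) \<in> S \<Longrightarrow> c * (norm f)\<^sup>2 \<le> Re (cinner f g)"
    using op(5) unfolding bounded_from_below_def by blast
  interpret semibounded_triplet S c n G0 G1
    by unfold_locales (use op triplet c in \<open>auto simp: is_operator_def\<close>)
  obtain d r where nd: "n \<le> d" and r: "\<And>i. i < d \<Longrightarrow> r i \<in> R"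
    "symplectic_basis n d (\<lambda>i. G (fst (r i))) (\<lambda>i. G (snd (r i)))"
    by (rule symplectic_basis_exists) (rule that)
  interpret triplet_basis S c n G0 G1 d r
    by (intro triplet_basis.intro semibounded_triplet_axioms triplet_basis_axioms.intro r)
  define p1 :: "nat \<Rightarrow> real" where "p1 i = (if i < sm + sp then 0 else 1)" for i
  define p2 :: "nat \<Rightarrow> real" where "p2 i = (if i < sm then -1 else 1)" for i
  have p: "p1 i \<in> {-1, 0, 1}" "p2 i \<in> {-1, 0, 1}" for i by (simp_all add: p1_def p2_def)
  let ?L1 = "sb.diagonal_plane p1" and ?L2 = "sb.diagonal_plane p2"
  \<comment> \<open>The first sm indices carry slopes (0, -1), the next sp carry (0, 1); the common
    slope 1 at all others contributes to neither index.\<close>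
  have "{i. i < d \<and> p2 i < p1 i} = {..<sm}" "{i. i < d \<and> p1 i < p2 i} = {sm..<sm + sp}"
    using nd sum_le by (auto simp: p1_def p2_def split: if_splits)
  then have index: "duistermaat ?L1 ?L2 F = int sm" "duistermaat ?L2 ?L1 F = int sp"
    unfolding F_eq_vertical sb.duistermaat_diagonal by simp_all
  have "zeros p1 = {..<sm + sp}" "negs p1 = {}" "zeros p2 = {}" "negs p2 = {..<sm}"
    using nd sum_le by (auto simp: p1_def p2_def zeros_def negs_def split: if_splits)
  then have count: "eigenvalue_count (H p1) {..l} = (if c - 1 \<le> l then sm + sp else 0)"
      "eigenvalue_count (H p2) {..l} = (if c - 2 \<le> l then sm else 0)" if "l \<le> c - 3 / 4" for l
    using eigenvalue_count_H[OF p(1) that] eigenvalue_count_H[OF p(2) that] by simp_all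
  let ?s = "\<lambda>l. real_of_int (spectral_shift (H p1) (H p2) l)"
  \<comment> \<open>Between c - 2 and c - 1 only the sm eigenvalues of \<open>H p2\<close> at c - 2
    are counted; at c - 1 the sm + sp eigenvalues of \<open>H p1\<close> join them.\<close>
  have left: "(?s \<longlongrightarrow> - real sm) (at_left (c - 1))"
  proof (rule tendsto_eventually)
    have "\<forall>\<^sub>F l in at_left (c - 1). c - 2 < l"
      by (rule eventually_at_left_field[THEN iffD2]) (auto intro!: exI[of _ "c - 2"])
    moreover have "\<forall>\<^sub>F l in at_left (c - 1). l < c - 1" by (simp add: eventually_at_filter)
    ultimately show "\<forall>\<^sub>F l in at_left (c - 1). ?s l = - real sm"
      by eventually_elim (simp add: spectral_shift_def count)
  qed
  have right: "(?s \<longlongrightarrow> real sp) (at_right (c - 1))"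
  proof (rule tendsto_eventually)
    have "\<forall>\<^sub>F l in at_right (c - 1). l < c - 3 / 4"
      by (rule eventually_at_right_field[THEN iffD2]) (auto intro!: exI[of _ "c - 3 / 4"])
    moreover have "\<forall>\<^sub>F l in at_right (c - 1). c - 1 < l" by (simp add: eventually_at_filter)
    ultimately show "\<forall>\<^sub>F l in at_right (c - 1). ?s l = real sp"
      by eventually_elim (simp add: spectral_shift_def count)
  qed
  have "below_ess_spec (c - 1) S"
    unfolding below_ess_spec_def ess_spec_def using fredholm_below[OF op(2)] by force
  then show ?thesis
    using index left right sb.lagrangian_diagonal unfolding H_def by blast
qed

end
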